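(* In any $d$-dimensional normed space, the functional Steiner point achieves competitive ratio $d+1$ for chasing convex functions and competitive ratio $d$ for chasing convex bodies.
   Context: Let $X$ be a $d$-dimensional normed space with dual unit ball $B^*_1$. For convex $W:X\to\mathbb R^+$ with concave conjugate $W^*(v)=\min_w(W(w)-v^Tw)$ finite on $B^*_1$ and $v^*=\arg\min_w(W(w)-v^Tw)$, the functional Steiner point is $s(W)=\frac{1}{\mathrm{vol}(B^*_1)}\int_{v\in B^*_1}v^*\,dv = -d\,\frac{1}{\mu(\partial B^*_1)}\int_{\theta\in\partial B^*_1}W^*(\theta)\,n(\theta)\,d\mu(\theta)$, where $n(\theta)\in X$ is the outward unit normal ($\|n(\theta)\|_X=1$, $n(\theta)^T\theta=1$) and $\mu$ is the cone measure (law of $z/\|z\|$ for uniform $z\in B^*_1$). The algorithm follows $x_t=s(W_t)$ where $W_t(x)=\inf_{x_s:[0,t]\to X,\,x_0=0}\int_0^t f_s(x_s)+\|x'_s\|\,ds$ is the work function (discretized for discrete requests by setting $f_t=f_n$ on $[n-1,n)$ and playing the point of the path on $[n-1,n)$ minimizing $f_n$). Convex bodies $K_n$ are encoded as $f_n(x)=3\,d(x,K_n)$. *)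

theory Defs
  imports "HOL-Analysis.Analysis"
begin

text \<open>
  A \<open>d\<close>-dimensional normed space is the vector space underlying a type \<open>'a\<close> of class
  \<open>euclidean_space\<close> with \<open>DIM('a) = d\<close>, together with an arbitrary norm \<open>N\<close> on it.  The
  Euclidean structure of the type only provides the pairing \<open>v \<bullet> w\<close> (written \<open>v\<^sup>Tw\<close> in
  coordinates), which identifies the dual space with \<open>'a\<close>, and Lebesgue measure.
\<close>

definition norm_fun :: "('a::real_vector \<Rightarrow> real) \<Rightarrow> bool" where
  "norm_fun N \<longleftrightarrow>
     (\<forall>x. N x \<ge> 0) \<and> (\<forall>x. N x = 0 \<longleftrightarrow> x = 0) \<and>
     (\<forall>c x. N (c *\<^sub>R x) = \<bar>c\<bar> * N x) \<and> (\<forall>x y. N (x + y) \<le> N x + N y)"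

definition dual_ball :: "('a::euclidean_space \<Rightarrow> real) \<Rightarrow> 'a set" where
  "dual_ball N = {v. \<forall>w. N w \<le> 1 \<longrightarrow> v \<bullet> w \<le> 1}"

definition conj_point :: "('a::euclidean_space \<Rightarrow> real) \<Rightarrow> 'a \<Rightarrow> 'a" where
  "conj_point W v = (ARG_MIN (\<lambda>w. W w - v \<bullet> w) w. True)"

text \<open>
  The conjugate point is unique only for almost every \<open>v\<close>, and the choice made by
  \<open>ARG_MIN\<close> on the exceptional null set need not be Borel measurable.  The average is
  therefore taken with respect to the completed measure \<open>lebesgue\<close>.
\<close>

definition functional_steiner ::
    "('a::euclidean_space \<Rightarrow> real) \<Rightarrow> ('a \<Rightarrow> real) \<Rightarrow> 'a" where
  "functional_steiner N W =
     (1 / measure lebesgue (dual_ball N)) *\<^sub>R (LINT v:dual_ball N|lebesgue. conj_point W v)"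

text \<open>
  Offline paths on \<open>[0, t]\<close> are the absolutely continuous ones starting at the origin.  Such
  a path \<open>p\<close> is paired with an integrable derivative \<open>p'\<close>, which it determines almost
  everywhere.
\<close>

definition paths :: "real \<Rightarrow> ((real \<Rightarrow> 'a::euclidean_space) \<times> (real \<Rightarrow> 'a)) set" where
  "paths t = {(p, p'). p 0 = 0 \<and> p' absolutely_integrable_on {0..t} \<and>
                       (\<forall>s\<in>{0..t}. p s = integral {0..s} p')}"

definition path_cost ::
    "('a::euclidean_space \<Rightarrow> real) \<Rightarrow> (real \<Rightarrow> 'a \<Rightarrow> real) \<Rightarrow> real
      \<Rightarrow> (real \<Rightarrow> 'a) \<times> (real \<Rightarrow> 'a) \<Rightarrow> real" where
  "path_cost N f t = (\<lambda>(p, p'). integral {0..t} (\<lambda>s. f s (p s) + N (p' s)))"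

text \<open>
  At time \<open>0\<close> no path reaches a point \<open>x \<noteq> 0\<close>.  The value \<open>N x\<close> used there is the limit of
  the work function as \<open>t\<close> tends to \<open>0\<close>.
\<close>

definition work_function ::
    "('a::euclidean_space \<Rightarrow> real) \<Rightarrow> (real \<Rightarrow> 'a \<Rightarrow> real) \<Rightarrow> real \<Rightarrow> 'a \<Rightarrow> real" where
  "work_function N f t x =
     (if t = 0 then N x else (INF q \<in> {q \<in> paths t. fst q t = x}. path_cost N f t q))"

definition steiner_path ::
    "('a::euclidean_space \<Rightarrow> real) \<Rightarrow> (real \<Rightarrow> 'a \<Rightarrow> real) \<Rightarrow> real \<Rightarrow> 'a" where
  "steiner_path N f t = functional_steiner N (work_function N f t)"

definition variation ::
    "('a::real_vector \<Rightarrow> real) \<Rightarrow> real set \<Rightarrow> (real \<Rightarrow> 'a) \<Rightarrow> ereal" where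
  "variation N I x =
     (SUP (k, \<tau>) \<in> {(k::nat, \<tau>::nat \<Rightarrow> real). mono_on {..k} \<tau> \<and> \<tau> ` {..k} \<subseteq> I}.
        ereal (\<Sum>i<k. N (x (\<tau> (Suc i)) - x (\<tau> i))))"

text \<open>
  Requests in continuous time: nonnegative convex functions, piecewise continuous in time
  (continuous off a finite set of times) and bounded in time at every point.
\<close>

definition convex_requests :: "real \<Rightarrow> (real \<Rightarrow> 'a::euclidean_space \<Rightarrow> real) \<Rightarrow> bool" where
  "convex_requests T f \<longleftrightarrow>
     (\<forall>t\<in>{0..T}. convex_on UNIV (f t) \<and> (\<forall>x. f t x \<ge> 0)) \<and>
     (\<exists>D. finite D \<and> (\<forall>x. continuous_on ({0..T} - D) (\<lambda>t. f t x))) \<and>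
     (\<forall>x. bounded ((\<lambda>t. f t x) ` {0..T}))"

definition offline_opt ::
    "('a::euclidean_space \<Rightarrow> real) \<Rightarrow> (real \<Rightarrow> 'a \<Rightarrow> real) \<Rightarrow> real \<Rightarrow> real" where
  "offline_opt N f T = (INF q \<in> paths T. path_cost N f T q)"

text \<open>
  Discrete requests are numbered from \<open>1\<close>; request \<open>n\<close> is in force on \<open>[n - 1, n)\<close>.
\<close>

definition step_requests :: "(nat \<Rightarrow> 'a \<Rightarrow> real) \<Rightarrow> real \<Rightarrow> 'a \<Rightarrow> real" where
  "step_requests f s = f (Suc (nat \<lfloor>s\<rfloor>))"

text \<open>
  The discrete algorithm answers request \<open>n\<close> by a point of the Steiner path whose \<open>f n\<close>-value
  is minimal over \<open>[n - 1, n)\<close>.  As that infimum may only be approached at the right end, the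
  path's point at time \<open>n\<close> is also admitted.  Ties are not broken: any sequence satisfying
  this predicate is a run of the algorithm.
\<close>

definition steiner_run ::
    "('a::euclidean_space \<Rightarrow> real) \<Rightarrow> (nat \<Rightarrow> 'a \<Rightarrow> real) \<Rightarrow> nat \<Rightarrow> (nat \<Rightarrow> 'a) \<Rightarrow> bool" where
  "steiner_run N f m x \<longleftrightarrow>
     (let X = steiner_path N (step_requests f) in
        x 0 = 0 \<and>
        (\<forall>n\<in>{1..m}. \<exists>\<tau>\<in>{real n - 1..real n}.
            x n = X \<tau> \<and> (\<forall>t\<in>{real n - 1..<real n}. f n (X \<tau>) \<le> f n (X t))))"

definition function_cost ::
    "('a::real_vector \<Rightarrow> real) \<Rightarrow> (nat \<Rightarrow> 'a \<Rightarrow> real) \<Rightarrow> nat \<Rightarrow> (nat \<Rightarrow> 'a) \<Rightarrow> real" where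
  "function_cost N f m x = (\<Sum>n=1..m. N (x n - x (n - 1)) + f n (x n))"

definition function_opt ::
    "('a::real_vector \<Rightarrow> real) \<Rightarrow> (nat \<Rightarrow> 'a \<Rightarrow> real) \<Rightarrow> nat \<Rightarrow> real" where
  "function_opt N f m = (INF y \<in> {y. y 0 = 0}. function_cost N f m y)"

definition movement_cost :: "('a::real_vector \<Rightarrow> real) \<Rightarrow> nat \<Rightarrow> (nat \<Rightarrow> 'a) \<Rightarrow> real" where
  "movement_cost N m x = (\<Sum>n=1..m. N (x n - x (n - 1)))"

definition body_opt ::
    "('a::real_vector \<Rightarrow> real) \<Rightarrow> (nat \<Rightarrow> 'a set) \<Rightarrow> nat \<Rightarrow> real" where
  "body_opt N K m =
     (INF y \<in> {y. y 0 = 0 \<and> (\<forall>n\<in>{1..m}. y n \<in> K n)}. movement_cost N m y)"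

definition body_request ::
    "('a::real_vector \<Rightarrow> real) \<Rightarrow> (nat \<Rightarrow> 'a set) \<Rightarrow> nat \<Rightarrow> 'a \<Rightarrow> real" where
  "body_request N K n x = 3 * (INF y \<in> K n. N (x - y))"

end

theory Submission
  imports Defs
begin

text \<open>
  Write \<open>F\<^sub>t(v) = min\<^sub>w (W\<^sub>t(w) - v \<bullet> w)\<close>, a concave function of \<open>v\<close> in the dual ball whose
  supergradient is \<open>- v\<^sup>*\<close>.  Both costs are bounded by an increasing potential built from \<open>F\<^sub>t\<close>.

  Movement: the average of \<open>d F\<^sub>t(v) - v \<bullet> v\<^sup>*\<close> over the dual ball is, by the divergence theorem,
  \<open>d\<close> times the average of \<open>F\<^sub>t\<close> over the boundary.  The difference of two Steiner points is the average
  of a gradient, hence \<open>d\<close> times a boundary average of \<open>(F\<^sub>t - F\<^sub>s) n\<close>, and \<open>F\<^sub>t - F\<^sub>s \<ge> 0\<close>.  So the path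
  moves at most as far as this potential grows, and by symmetry of the ball the potential is at
  most \<open>d min W\<^sub>T\<close>.

  Service: a nearly optimal path to \<open>v\<^sup>*\<close> hardly moves in a short time interval, so \<open>F\<^sub>t(v)\<close> grows at
  least at rate \<open>f\<^sub>t(v\<^sup>*)\<close>.  Averaging over \<open>v\<close> and using Jensen's inequality bounds the service cost by
  the average of \<open>F\<^sub>T\<close>, which is at most \<open>min W\<^sub>T\<close>.  The estimate is uniform only on \<open>\<rho>\<close> times the dual
  ball for \<open>\<rho> < 1\<close>, which is the dual ball of the norm \<open>\<rho> N\<close>; then \<open>\<rho>\<close> tends to \<open>1\<close>.

  Bodies: a request \<open>3 d(x, K)\<close> lasting unit time makes it cheaper to end in \<open>K\<close>, so every \<open>v\<^sup>*\<close> and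
  with it the Steiner point lies in \<open>K\<close> at the end of the request, and only movement is paid.
\<close>

section \<open>Norms and dual balls\<close>

text \<open>\<open>conj_point\<close> is an arbitrary selection of minimisers, guaranteed to exist
  only in the interior of the dual ball, so its measurability and integrability up to the boundary
  have to be earned. Nothing is integrated over the boundary: boundary terms arise by comparing the
  ball with contracted copies and letting the ratio tend to 1. Regularity in time rests on the
  monotone potential, which controls the displacement of the Steiner path; the path can therefore
  jump only at countably many times, and the service integral makes sense. For \<rho> < 1 the slack
  \<open>1 - \<rho>\<close> bounds minimisers and the lengths of near-optimal paths, so each local
  service estimate has an error of time step times increment of a fixed function, which disappears
  under refinement. Existence of a discrete run asks for more, namely continuity of the path on each
  closed request interval. Inside the interval this comes from slowing offline paths down; at the
  left end that argument degenerates and upper semicontinuity of the potential replaces it.\<close>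

lemma norm_funD:
  assumes "norm_fun N"
  shows "N x \<ge> 0" "N x = 0 \<longleftrightarrow> x = 0" "N (c *\<^sub>R x) = \<bar>c\<bar> * N x" "N (x + y) \<le> N x + N y"
  using assms unfolding norm_fun_def by auto

lemma norm_fun_zero: "norm_fun N \<Longrightarrow> N 0 = 0"
  by (simp add: norm_funD)

lemma norm_fun_minus: "norm_fun N \<Longrightarrow> N (- x) = N x"
  using norm_funD(3)[of N "-1" x] by simp

lemma norm_fun_diff_commute: "norm_fun N \<Longrightarrow> N (x - y) = N (y - x)"
  using norm_fun_minus[of N "x - y"] by simp

lemma norm_fun_triangle: "norm_fun N \<Longrightarrow> N (x - z) \<le> N (x - y) + N (y - z)"
  using norm_funD(4)[of N "x - y" "y - z"] by simp

lemma norm_fun_scale: "norm_fun N \<Longrightarrow> \<rho> > 0 \<Longrightarrow> norm_fun (\<lambda>x. \<rho> * N x)"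
  unfolding norm_fun_def by (auto simp: distrib_left[symmetric] mult_left_mono)

lemma norm_fun_convex: "norm_fun N \<Longrightarrow> convex_on UNIV N"
  unfolding convex_on_def
  by (auto intro: order_trans[OF norm_funD(4)] simp: norm_funD(3))

lemma norm_fun_continuous:
  fixes N :: "'a::euclidean_space \<Rightarrow> real"
  shows "norm_fun N \<Longrightarrow> continuous_on S N"
  using convex_on_continuous[OF open_UNIV norm_fun_convex] continuous_on_subset by blast

lemma norm_fun_normalize:
  assumes N: "norm_fun N" and "x \<noteq> 0"
  shows "N x = norm x * N (x /\<^sub>R norm x)"
  using norm_funD(3)[OF N, of "norm x" "x /\<^sub>R norm x"] assms(2) by simp

lemma norm_fun_lower:
  fixes N :: "'a::euclidean_space \<Rightarrow> real"
  assumes N: "norm_fun N"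
  obtains c where "c > 0" "\<And>x. c * norm x \<le> N x"
proof -
  have "\<exists>z\<in>sphere (0::'a) 1. \<forall>y\<in>sphere 0 1. N z \<le> N y"
    by (rule continuous_attains_inf) (use N norm_fun_continuous in auto)
  then obtain z where z: "norm z = 1" "\<And>y. norm y = 1 \<Longrightarrow> N z \<le> N y" by auto
  have "N z > 0" using z(1) norm_funD(1,2)[OF N, of z] by (metis less_eq_real_def norm_zero zero_neq_one)
  moreover have "N z * norm x \<le> N x" for x
    using norm_fun_normalize[OF N, of x] z(2)[of "x /\<^sub>R norm x"] norm_fun_zero[OF N]
    by (cases "x = 0") (auto simp: mult.commute mult_left_mono)
  ultimately show thesis by (rule that)
qed

lemma norm_fun_upper:
  fixes N :: "'a::euclidean_space \<Rightarrow> real"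
  assumes N: "norm_fun N"
  obtains C where "C > 0" "\<And>x. N x \<le> C * norm x"
proof -
  have "bounded (N ` sphere 0 1)"
    by (intro compact_imp_bounded compact_continuous_image norm_fun_continuous[OF N] compact_sphere)
  then obtain C where C: "C > 0" "\<And>y. norm y = 1 \<Longrightarrow> N y \<le> C" unfolding bounded_pos by force
  have "N x \<le> C * norm x" for x
    using norm_fun_normalize[OF N, of x] C(2)[of "x /\<^sub>R norm x"] norm_fun_zero[OF N]
    by (cases "x = 0") (auto simp: mult.commute mult_left_mono)
  with C(1) show thesis by (rule that)
qed

lemma dual_ball_iff:
  assumes N: "norm_fun N"
  shows "v \<in> dual_ball N \<longleftrightarrow> (\<forall>w. v \<bullet> w \<le> N w)"
proof
  assume v: "v \<in> dual_ball N"
  show "\<forall>w. v \<bullet> w \<le> N w"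
  proof
    fix w
    show "v \<bullet> w \<le> N w"
    proof (cases "w = 0")
      case False
      then have pos: "N w > 0" using norm_funD(1,2)[OF N, of w] by linarith
      then have "N (w /\<^sub>R N w) \<le> 1" by (simp add: norm_funD(3)[OF N])
      then have "v \<bullet> (w /\<^sub>R N w) \<le> 1" using v unfolding dual_ball_def by blast
      then show ?thesis using pos by (simp add: field_simps)
    qed (simp add: norm_fun_zero[OF N])
  qed
next
  assume "\<forall>w. v \<bullet> w \<le> N w"
  then show "v \<in> dual_ball N" unfolding dual_ball_def by (auto intro: order_trans)
qed

lemma dual_ball_convex: "convex (dual_ball N)"
proof -
  have "dual_ball N = (\<Inter>w\<in>{w. N w \<le> 1}. {v. v \<bullet> w \<le> 1})" by (auto simp: dual_ball_def)
  moreover have "convex {v. v \<bullet> w \<le> 1}" for w :: 'a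
    using convex_halfspace_le[of w 1] by (simp add: inner_commute)
  ultimately show ?thesis by (auto intro: convex_INT)
qed

lemma dual_ball_compact:
  fixes N :: "'a::euclidean_space \<Rightarrow> real"
  assumes N: "norm_fun N"
  shows "compact (dual_ball N)"
proof -
  obtain C where C: "C > 0" "\<And>x. N x \<le> C * norm x" using norm_fun_upper[OF N] by blast
  have "norm v \<le> C" if "v \<in> dual_ball N" for v
  proof (cases "v = 0")
    case False
    have "v \<bullet> v \<le> C * norm v" using that C(2)[of v] unfolding dual_ball_iff[OF N] by (meson order_trans)
    then show ?thesis using False by (simp add: dot_square_norm power2_eq_square)
  qed (use C in simp)
  then have "bounded (dual_ball N)" unfolding bounded_iff by blast
  moreover have "closed (dual_ball N)"
  proof -
    have "dual_ball N = (\<Inter>w\<in>{w. N w \<le> 1}. {v. v \<bullet> w \<le> 1})" by (auto simp: dual_ball_def)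
    moreover have "closed {v. v \<bullet> w \<le> 1}" for w :: 'a
      using closed_halfspace_le[of w 1] by (simp add: inner_commute)
    ultimately show ?thesis by auto
  qed
  ultimately show ?thesis by (simp add: compact_eq_bounded_closed)
qed

text \<open>The slack \<open>r < 1\<close> is the form in which interiority is used: for
  \<open>W\<close> above \<open>N\<close> it makes \<open>W w - v \<bullet> w\<close> grow at least
  like \<open>(1 - r) * N w\<close>.\<close>

lemma interior_dual_ball_iff:
  fixes N :: "'a::euclidean_space \<Rightarrow> real"
  assumes N: "norm_fun N"
  shows "v \<in> interior (dual_ball N) \<longleftrightarrow> (\<exists>r. 0 < r \<and> r < 1 \<and> (\<forall>w. v \<bullet> w \<le> r * N w))"
proof
  assume "v \<in> interior (dual_ball N)"
  then obtain e where e: "e > 0" "ball v e \<subseteq> dual_ball N"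
    using mem_interior by blast
  \<comment> \<open>Small enough for \<open>(1 + \<delta>) *\<^sub>R v\<close> to stay in the ball
    around \<open>v\<close>; the slack is then \<open>1 / (1 + \<delta>)\<close>.\<close>
  define \<delta> where "\<delta> = e / (2 * (norm v + 1))"
  have d: "\<delta> > 0" using e by (simp add: \<delta>_def add_nonneg_pos)
  have "\<delta> * norm v < e"
  proof -
    have "\<delta> * norm v \<le> \<delta> * (norm v + 1)" using d by simp
    also have "\<dots> = e / 2" by (simp add: \<delta>_def field_simps add_nonneg_pos add_nonneg_eq_0_iff)
    also have "\<dots> < e" using e by simp
    finally show ?thesis .
  qed
  then have "(1 + \<delta>) *\<^sub>R v \<in> ball v e"
    using d by (simp add: dist_norm algebra_simps)
  then have "(1 + \<delta>) *\<^sub>R v \<in> dual_ball N" using e by auto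
  then have "(1 + \<delta>) * (v \<bullet> w) \<le> N w" for w unfolding dual_ball_iff[OF N] by simp
  then have "v \<bullet> w \<le> (1 / (1 + \<delta>)) * N w" for w using d by (simp add: field_simps)
  then show "\<exists>r. 0 < r \<and> r < 1 \<and> (\<forall>w. v \<bullet> w \<le> r * N w)"
    using d by (intro exI[of _ "1 / (1 + \<delta>)"]) simp
next
  assume "\<exists>r. 0 < r \<and> r < 1 \<and> (\<forall>w. v \<bullet> w \<le> r * N w)"
  then obtain r where r: "r < 1" "\<And>w. v \<bullet> w \<le> r * N w" by blast
  obtain c where c: "c > 0" "\<And>x. c * norm x \<le> N x" using norm_fun_lower[OF N] by blast
  \<comment> \<open>Moving \<open>v\<close> by less than \<open>c * (1 - r)\<close> changes its
    pairing with \<open>w\<close> by at most \<open>(1 - r) * N w\<close>, exactly the slack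
    available.\<close>
  have "ball v (c * (1 - r)) \<subseteq> dual_ball N"
  proof
    fix u assume u: "u \<in> ball v (c * (1 - r))"
    have "u \<bullet> w \<le> N w" for w
    proof -
      have "(u - v) \<bullet> w \<le> norm (u - v) * norm w" by (rule norm_cauchy_schwarz)
      also have "\<dots> \<le> c * (1 - r) * norm w"
        using u by (intro mult_right_mono) (auto simp: dist_norm norm_minus_commute)
      also have "\<dots> = (1 - r) * (c * norm w)" by simp
      also have "\<dots> \<le> (1 - r) * N w" using r(1) c(2) by (intro mult_left_mono) auto
      finally show ?thesis using r(2)[of w] by (simp add: inner_diff_left algebra_simps)
    qed
    then show "u \<in> dual_ball N" unfolding dual_ball_iff[OF N] by simp
  qed
  moreover have "c * (1 - r) > 0" using c r by simp
  ultimately show "v \<in> interior (dual_ball N)" using mem_interior by blast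
qed

lemma zero_in_interior_dual_ball:
  fixes N :: "'a::euclidean_space \<Rightarrow> real"
  shows "norm_fun N \<Longrightarrow> 0 \<in> interior (dual_ball N)"
  unfolding interior_dual_ball_iff by (auto intro!: exI[of _ "1/2"] simp: norm_funD(1))

lemma interior_dual_ball_shrink:
  fixes N :: "'a::euclidean_space \<Rightarrow> real"
  assumes N: "norm_fun N" and v: "v \<in> interior (dual_ball N)" and y: "y \<in> dual_ball N"
    and r: "0 < r" "r \<le> 1"
  shows "y + r *\<^sub>R (v - y) \<in> interior (dual_ball N)"
proof -
  have "y - r *\<^sub>R (y - v) \<in> interior (dual_ball N)"
    using mem_interior_convex_shrink[OF dual_ball_convex v y r] .
  then show ?thesis by (simp add: algebra_simps)
qed

lemma dual_ball_scale:
  assumes N: "norm_fun N" and r: "\<rho> > 0"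
  shows "dual_ball (\<lambda>x. \<rho> * N x) = (\<lambda>v. \<rho> *\<^sub>R v) ` dual_ball N"
proof (intro subset_antisym subsetI)
  fix v assume "v \<in> dual_ball (\<lambda>x. \<rho> * N x)"
  then have "v /\<^sub>R \<rho> \<in> dual_ball N"
    unfolding dual_ball_iff[OF N] dual_ball_iff[OF norm_fun_scale[OF N r]]
    using r by (auto simp: field_simps)
  moreover have "v = \<rho> *\<^sub>R (v /\<^sub>R \<rho>)" using r by simp
  ultimately show "v \<in> (\<lambda>v. \<rho> *\<^sub>R v) ` dual_ball N" by blast
next
  fix v assume "v \<in> (\<lambda>v. \<rho> *\<^sub>R v) ` dual_ball N"
  then show "v \<in> dual_ball (\<lambda>x. \<rho> * N x)"
    unfolding dual_ball_iff[OF norm_fun_scale[OF N r]]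
    using r dual_ball_iff[OF N] by auto
qed

lemma dual_ball_scale_subset:
  fixes N :: "'a::euclidean_space \<Rightarrow> real"
  assumes N: "norm_fun N" and r: "0 < \<rho>" "\<rho> < 1"
  shows "dual_ball (\<lambda>x. \<rho> * N x) \<subseteq> interior (dual_ball N)"
  using r unfolding dual_ball_iff[OF norm_fun_scale[OF N r(1)]] interior_dual_ball_iff[OF N] subset_iff
  by blast

text \<open>Half of the bipolar theorem: the dual ball determines the norm. It reduces norm bounds
  on integrals and on displacements of Steiner points to bounds on single linear
  functionals.\<close>

lemma norm_fun_le_dual:
  fixes N :: "'a::euclidean_space \<Rightarrow> real"
  assumes N: "norm_fun N" and le: "\<And>y. y \<in> dual_ball N \<Longrightarrow> y \<bullet> x \<le> M"
  shows "N x \<le> M"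
proof (rule ccontr)
  assume "\<not> N x \<le> M"
  moreover have "M \<ge> 0" using le[of 0] by (simp add: dual_ball_def)
  ultimately obtain m where m: "m > 0" "M < m" "m < N x"
    by (metis dense leD le_less_trans not_le)
  define S where "S = {w. N w \<le> m}"
  have "convex S"
    unfolding convex_def S_def using N m(1)
    by (auto intro!: order_trans[OF norm_funD(4)[OF N]] convex_bound_le simp: norm_funD(3))
  moreover have "closed S" unfolding S_def
    by (intro closed_Collect_le norm_fun_continuous[OF N] continuous_on_const)
  moreover have "x \<notin> S" using m by (simp add: S_def)
  ultimately obtain a b where ab: "a \<bullet> x < b" "\<forall>w\<in>S. a \<bullet> w > b"
    using separating_hyperplane_closed_point by blast
  have b: "b < 0" using ab(2)[rule_format, of 0] m by (simp add: S_def norm_fun_zero[OF N])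
  \<comment> \<open>\<open>b < 0\<close> because the separated set contains the origin, so dividing
    by \<open>b\<close> reverses the separation; the factor \<open>m\<close> passes from the ball of
    radius \<open>m\<close> to the unit ball.\<close>
  define y where "y = (m / b) *\<^sub>R a"
  have "y \<in> dual_ball N" unfolding dual_ball_def
  proof (clarify)
    fix w assume "N w \<le> 1"
    then have "N (m *\<^sub>R w) \<le> m" using m by (simp add: norm_funD(3)[OF N])
    then have "a \<bullet> (m *\<^sub>R w) > b" using ab(2) by (auto simp: S_def)
    then show "y \<bullet> w \<le> 1" using b by (simp add: y_def field_simps)
  qed
  then have "y \<bullet> x \<le> M" by (rule le)
  moreover have "y \<bullet> x > m"
  proof -
    have "(a \<bullet> x) / b > 1" using ab(1) b by (simp add: field_simps)
    then have "m * ((a \<bullet> x) / b) > m * 1" using m(1) by (intro mult_strict_left_mono)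
    then show ?thesis by (simp add: y_def)
  qed
  ultimately show False using m by simp
qed

section \<open>Conjugate points\<close>

lemma lebesgue_integral_affine:
  fixes g :: "'a::euclidean_space \<Rightarrow> 'b::{banach, second_countable_topology}"
  assumes c: "c \<noteq> 0" and g: "g \<in> borel_measurable lebesgue"
  shows "integrable lebesgue (\<lambda>x. g (t + c *\<^sub>R x)) \<longleftrightarrow> integrable lebesgue g"
    and "integral\<^sup>L lebesgue g = (\<bar>c\<bar> ^ DIM('a)) *\<^sub>R integral\<^sup>L lebesgue (\<lambda>x. g (t + c *\<^sub>R x))"
    and "(\<lambda>x. g (t + c *\<^sub>R x)) \<in> borel_measurable lebesgue"
proof -
  let ?T = "\<lambda>x::'a. t + c *\<^sub>R x"
  \<comment> \<open>A coordinatewise scaling with all factors equal to \<open>c\<close>, the shape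
    of \<open>lebesgue_affine_euclidean\<close>.\<close>
  have eq: "?T = (\<lambda>x. t + (\<Sum>j\<in>Basis. (c * (x \<bullet> j)) *\<^sub>R j))"
    by (simp add: scaleR_scaleR[symmetric] scaleR_sum_right[symmetric] euclidean_representation del: scaleR_scaleR)
  have T[measurable]: "?T \<in> lebesgue \<rightarrow>\<^sub>M lebesgue"
    unfolding eq using c by (intro lebesgue_affine_measurable) auto
  have d: "lebesgue = density (distr lebesgue lebesgue ?T) (\<lambda>_. ennreal (\<bar>c\<bar> ^ DIM('a)))"
    unfolding eq using lebesgue_affine_euclidean[of "\<lambda>_. c" t] c by simp
  note g[measurable]
  show "(\<lambda>x. g (t + c *\<^sub>R x)) \<in> borel_measurable lebesgue" by measurable
  have "integrable lebesgue g \<longleftrightarrow> integrable (distr lebesgue lebesgue ?T) (\<lambda>x. (\<bar>c\<bar> ^ DIM('a)) *\<^sub>R g x)"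
    by (subst d, subst integrable_density) (use c in auto)
  also have "\<dots> \<longleftrightarrow> integrable lebesgue (\<lambda>x. (\<bar>c\<bar> ^ DIM('a)) *\<^sub>R g (?T x))"
    by (subst integrable_distr_eq) auto
  also have "\<dots> \<longleftrightarrow> integrable lebesgue (\<lambda>x. g (?T x))"
  proof
    assume "integrable lebesgue (\<lambda>x. (\<bar>c\<bar> ^ DIM('a)) *\<^sub>R g (?T x))"
    from integrable_scaleR_right[OF this, of "inverse (\<bar>c\<bar> ^ DIM('a))"]
    show "integrable lebesgue (\<lambda>x. g (?T x))" using c by simp
  qed simp
  finally show "integrable lebesgue (\<lambda>x. g (t + c *\<^sub>R x)) \<longleftrightarrow> integrable lebesgue g" by simp
  have "integral\<^sup>L lebesgue g = integral\<^sup>L (distr lebesgue lebesgue ?T) (\<lambda>x. (\<bar>c\<bar> ^ DIM('a)) *\<^sub>R g x)"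
    by (subst d, subst integral_density) (use c in auto)
  also have "\<dots> = integral\<^sup>L lebesgue (\<lambda>x. (\<bar>c\<bar> ^ DIM('a)) *\<^sub>R g (?T x))"
    by (subst integral_distr) auto
  finally show "integral\<^sup>L lebesgue g = (\<bar>c\<bar> ^ DIM('a)) *\<^sub>R integral\<^sup>L lebesgue (\<lambda>x. g (t + c *\<^sub>R x))"
    by simp
qed

lemma affine_image_mem_iff:
  fixes t :: "'a::real_vector"
  assumes "r > 0"
  shows "t + r *\<^sub>R v \<in> (\<lambda>v. t + r *\<^sub>R v) ` S \<longleftrightarrow> v \<in> S"
  using assms by (auto simp: image_iff intro!: bexI[of _ v])

lemma absolutely_integrable_affine:
  fixes g :: "'a::euclidean_space \<Rightarrow> 'b::euclidean_space"
  assumes r: "r > 0" and g: "g absolutely_integrable_on ((\<lambda>v. t + r *\<^sub>R v) ` S)"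
  shows "(\<lambda>v. g (t + r *\<^sub>R v)) absolutely_integrable_on S"
    and "integral ((\<lambda>v. t + r *\<^sub>R v) ` S) g = (r ^ DIM('a)) *\<^sub>R integral S (\<lambda>v. g (t + r *\<^sub>R v))"
proof -
  let ?V = "(\<lambda>v. t + r *\<^sub>R v) ` S"
  let ?g = "\<lambda>x. indicator ?V x *\<^sub>R g x"
  have r0: "r \<noteq> 0" using r by simp
  have gi: "integrable lebesgue ?g" using g unfolding set_integrable_def .
  then have gm: "?g \<in> borel_measurable lebesgue" by (rule borel_measurable_integrable)
  have eq: "?g (t + r *\<^sub>R v) = indicator S v *\<^sub>R g (t + r *\<^sub>R v)" for v
    using affine_image_mem_iff[OF r, of t v S] by (simp add: indicator_def)
  show ab: "(\<lambda>v. g (t + r *\<^sub>R v)) absolutely_integrable_on S"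
    using lebesgue_integral_affine(1)[OF r0 gm, of t] gi unfolding eq set_integrable_def by simp
  show "integral ?V g = (r ^ DIM('a)) *\<^sub>R integral S (\<lambda>v. g (t + r *\<^sub>R v))"
    using lebesgue_integral_affine(2)[OF r0 gm, of t] r unfolding eq
    using set_lebesgue_integral_eq_integral(2)[OF g] set_lebesgue_integral_eq_integral(2)[OF ab]
    unfolding set_lebesgue_integral_def by simp
qed

lemma integral_reflect_symmetric:
  fixes g :: "'a::euclidean_space \<Rightarrow> 'b::euclidean_space"
  assumes g: "g absolutely_integrable_on S" and S: "\<And>v. - v \<in> S \<longleftrightarrow> v \<in> S"
  shows "integral S (\<lambda>v. g (- v)) = integral S g"
proof -
  let ?g = "\<lambda>x. indicator S x *\<^sub>R g x"
  have gi: "integrable lebesgue ?g" using g unfolding set_integrable_def .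
  then have gm: "?g \<in> borel_measurable lebesgue" by (rule borel_measurable_integrable)
  have eq: "?g (0 + (- 1) *\<^sub>R v) = indicator S v *\<^sub>R g (- v)" for v
    using S[of v] by (simp add: indicator_def)
  have ab: "(\<lambda>v. g (- v)) absolutely_integrable_on S"
    using lebesgue_integral_affine(1)[OF _ gm, of "- 1" 0] gi unfolding eq set_integrable_def by simp
  show ?thesis
    using lebesgue_integral_affine(2)[OF _ gm, of "- 1" 0] unfolding eq
    using set_lebesgue_integral_eq_integral(2)[OF g] set_lebesgue_integral_eq_integral(2)[OF ab]
    unfolding set_lebesgue_integral_def by simp
qed

text \<open>Measurability of \<open>p\<close> is a conclusion here. The countable infimum of the
  \<open>u n\<close> and supremum of the \<open>l n\<close> are measurable, enclose \<open>p\<close>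
  and agree almost everywhere; completeness of \<open>lebesgue\<close> does the rest.\<close>

lemma integrable_squeeze:
  fixes p :: "'a::euclidean_space \<Rightarrow> real"
  assumes l: "\<And>n. integrable lebesgue (l n)" and u: "\<And>n. integrable lebesgue (u n)"
    and le: "\<And>(n::nat) x. l n x \<le> p x" "\<And>n x. p x \<le> u n x"
    and lim: "(\<lambda>n. integral\<^sup>L lebesgue (\<lambda>x. u n x - l n x)) \<longlonglongrightarrow> 0"
  shows "integrable lebesgue p"
proof -
  define U where "U = (\<lambda>x. INF n. u n x)"
  define L where "L = (\<lambda>x. SUP n. l n x)"
  have bu: "bdd_below (range (\<lambda>n. u n x))" for x using le(2) by (intro bdd_belowI[of _ "p x"]) auto
  have bl: "bdd_above (range (\<lambda>n. l n x))" for x using le(1) by (intro bdd_aboveI[of _ "p x"]) auto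
  have pU: "p x \<le> U x" for x unfolding U_def by (rule cINF_greatest) (use le in auto)
  have Lp: "L x \<le> p x" for x unfolding L_def by (rule cSUP_least) (use le in auto)
  have Uu: "U x \<le> u n x" for n x unfolding U_def using bu by (rule cINF_lower) simp
  have lL: "l n x \<le> L x" for n x unfolding L_def using bl by (rule cSUP_upper[rotated]) simp
  have [measurable]: "l n \<in> borel_measurable lebesgue" "u n \<in> borel_measurable lebesgue" for n
    using l u by auto
  have Um[measurable]: "U \<in> borel_measurable lebesgue" unfolding U_def by measurable
  have Lm[measurable]: "L \<in> borel_measurable lebesgue" unfolding L_def
    using bl by (intro borel_measurable_cSUP) auto
  have Ui: "integrable lebesgue U"
  proof (rule Bochner_Integration.integrable_bound)
    show "integrable lebesgue (\<lambda>x. \<bar>u 0 x\<bar> + \<bar>l 0 x\<bar>)" using u l by auto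
    show "AE x in lebesgue. norm (U x) \<le> norm (\<bar>u 0 x\<bar> + \<bar>l 0 x\<bar>)"
    proof (rule AE_I2)
      fix x show "norm (U x) \<le> norm (\<bar>u 0 x\<bar> + \<bar>l 0 x\<bar>)"
        using Uu[of x 0] pU[of x] le(1)[of 0 x] by auto
    qed
  qed simp
  have Li: "integrable lebesgue L"
  proof (rule Bochner_Integration.integrable_bound)
    show "integrable lebesgue (\<lambda>x. \<bar>u 0 x\<bar> + \<bar>l 0 x\<bar>)" using u l by auto
    show "AE x in lebesgue. norm (L x) \<le> norm (\<bar>u 0 x\<bar> + \<bar>l 0 x\<bar>)"
    proof (rule AE_I2)
      fix x show "norm (L x) \<le> norm (\<bar>u 0 x\<bar> + \<bar>l 0 x\<bar>)"
        using Lp[of x] lL[of 0 x] le(2)[of x 0] by auto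
    qed
  qed simp
  have "integral\<^sup>L lebesgue (\<lambda>x. U x - L x) \<le> integral\<^sup>L lebesgue (\<lambda>x. u n x - l n x)" for n
    by (rule integral_mono) (use Ui Li u l Uu lL in \<open>auto intro: diff_mono\<close>)
  then have "integral\<^sup>L lebesgue (\<lambda>x. U x - L x) \<le> 0" using LIMSEQ_le_const[OF lim] by blast
  moreover have nn: "U x - L x \<ge> 0" for x using pU Lp by (meson diff_ge_0_iff_ge order_trans)
  then have "integral\<^sup>L lebesgue (\<lambda>x. U x - L x) \<ge> 0" by simp
  ultimately have "integral\<^sup>L lebesgue (\<lambda>x. U x - L x) = 0" by simp
  then have "AE x in lebesgue. U x - L x = 0"
    by (subst (asm) integral_nonneg_eq_0_iff_AE) (use Ui Li nn in auto)
  then obtain Z where Z: "{x \<in> space lebesgue. \<not> (U x - L x = 0)} \<subseteq> Z" "emeasure lebesgue Z = 0" "Z \<in> sets lebesgue"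
    by (rule AE_E)
  have "p absolutely_integrable_on UNIV"
  proof (rule absolutely_integrable_spike[where f=U and S=Z])
    show "U absolutely_integrable_on UNIV" using Ui by (simp add: set_integrable_def)
    show "negligible Z" using Z by (simp add: negligible_iff_null_sets null_sets_def)
    fix x assume "x \<in> UNIV - Z"
    then have "U x = L x" using Z(1) by auto
    then show "p x = U x" using pU[of x] Lp[of x] by simp
  qed
  then show ?thesis by (simp add: set_integrable_def)
qed

lemma integral_const_lmeasurable:
  "S \<in> lmeasurable \<Longrightarrow> integral S (\<lambda>_. c) = measure lebesgue S * (c::real)"
  using lmeasure_integral[of S] integral_mult_right[of S c "\<lambda>_. 1"] by simp

lemma integral_restrict_subset:
  fixes g :: "'a::euclidean_space \<Rightarrow> 'b::euclidean_space"
  assumes "V \<subseteq> U"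
  shows "integral U (\<lambda>v. if v \<in> V then g v else 0) = integral V g"
    and "(\<lambda>v. if v \<in> V then g v else 0) absolutely_integrable_on U \<longleftrightarrow> g absolutely_integrable_on V"
proof -
  show "integral U (\<lambda>v. if v \<in> V then g v else 0) = integral V g"
    using integral_restrict_Int[of U V g] assms by (simp add: Int_absorb2)
  have "indicat_real U v *\<^sub>R (if v \<in> V then g v else 0) = indicat_real V v *\<^sub>R g v" for v
    using assms by (auto simp: indicator_def)
  then show "(\<lambda>v. if v \<in> V then g v else 0) absolutely_integrable_on U \<longleftrightarrow> g absolutely_integrable_on V"
    unfolding set_integrable_def by simp
qed

text \<open>Dominated convergence for cut-off integrands. It serves for two exhaustions of the dual
  ball: by scaled balls, and by copies contracted towards a point that may lie on the
  boundary.\<close>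

lemma integral_open_exhaustion:
  fixes g :: "'a::euclidean_space \<Rightarrow> 'b::euclidean_space"
  assumes g: "g absolutely_integrable_on U" and V: "\<And>k. V k \<subseteq> U" "\<And>k. open (V k)"
    and ev: "\<And>u. u \<in> U \<Longrightarrow> \<forall>\<^sub>F k in sequentially. u \<in> V k"
  shows "(\<lambda>k. integral (V k) g) \<longlonglongrightarrow> integral U g"
proof -
  have "(\<lambda>k. integral U (\<lambda>u. if u \<in> V k then g u else 0)) \<longlonglongrightarrow> integral U g"
  proof (rule dominated_convergence(2))
    show "(\<lambda>u. if u \<in> V k then g u else 0) integrable_on U" for k
      using set_integrable_subset[OF g _ V(1), of k] V(2)[of k] integral_restrict_subset(2)[OF V(1), of k g]
      by (simp add: absolutely_integrable_on_def)
    show "(\<lambda>u. norm (g u)) integrable_on U" using g by (simp add: absolutely_integrable_on_def)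
    show "norm (if u \<in> V k then g u else 0) \<le> norm (g u)" for k u by simp
    show "(\<lambda>k. if u \<in> V k then g u else 0) \<longlonglongrightarrow> g u" if "u \<in> U" for u
      by (rule tendsto_eventually, rule eventually_mono[OF ev[OF that]]) simp
  qed
  then show ?thesis by (simp only: integral_restrict_subset(1)[OF V(1)])
qed

section \<open>Concave conjugates and their minimisers\<close>

definition dominates :: "('a::euclidean_space \<Rightarrow> real) \<Rightarrow> ('a \<Rightarrow> real) \<Rightarrow> bool" where
  "dominates W N \<longleftrightarrow> continuous_on UNIV W \<and> (\<forall>x. N x \<le> W x)"

text \<open>The concave conjugate, read off at the selected point instead of as an infimum; that it
  is the minimum is established for \<open>v\<close> in the interior of the dual ball
  (\<open>conj_value_le\<close>).\<close>

definition conj_value :: "('a::euclidean_space \<Rightarrow> real) \<Rightarrow> 'a \<Rightarrow> real" where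
  "conj_value W v = W (conj_point W v) - v \<bullet> conj_point W v"

context
  fixes N W :: "'a::euclidean_space \<Rightarrow> real"
  assumes N: "norm_fun N" and W: "dominates W N"
begin

text \<open>Growth at rate \<open>(1 - r) * c\<close> bounds the sublevel set at height
  \<open>W 0\<close>, the value at the origin, and continuity makes it compact. So the minimum is
  attained and \<open>ARG_MIN\<close> picks a genuine minimiser; both halves of
  \<open>dominates\<close> enter here.\<close>

lemma conj_value_le:
  assumes v: "v \<in> interior (dual_ball N)"
  shows "conj_value W v \<le> W w - v \<bullet> w"
proof -
  obtain r where r: "r < 1" "\<And>w. v \<bullet> w \<le> r * N w"
    using v unfolding interior_dual_ball_iff[OF N] by blast
  obtain c where c: "c > 0" "\<And>x. c * norm x \<le> N x" using norm_fun_lower[OF N] by blast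
  define S where "S = {w. W w - v \<bullet> w \<le> W 0}"
  have "norm w \<le> W 0 / ((1 - r) * c)" if "w \<in> S" for w
  proof -
    have "(1 - r) * (c * norm w) \<le> (1 - r) * N w" using r c by (intro mult_left_mono) auto
    also have "\<dots> = N w - r * N w" by (simp add: algebra_simps)
    also have "\<dots> \<le> W w - v \<bullet> w" using W r(2)[of w] unfolding dominates_def by (meson diff_mono)
    also have "\<dots> \<le> W 0" using that by (simp add: S_def)
    finally show ?thesis using r c by (simp add: field_simps)
  qed
  then have "bounded S" unfolding bounded_iff by blast
  have cont: "continuous_on UNIV (\<lambda>w. W w - v \<bullet> w)"
    using W unfolding dominates_def by (intro continuous_intros) auto
  then have "closed S" unfolding S_def by (intro closed_Collect_le) auto
  with \<open>bounded S\<close> have "compact S" by (simp add: compact_eq_bounded_closed)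
  moreover have "S \<noteq> {}" by (auto simp: S_def intro!: exI[of _ 0])
  ultimately obtain z where z: "z \<in> S" "\<And>w. w \<in> S \<Longrightarrow> W z - v \<bullet> z \<le> W w - v \<bullet> w"
    using continuous_attains_inf[of S "\<lambda>w. W w - v \<bullet> w"] continuous_on_subset[OF cont subset_UNIV] by blast
  have "W z - v \<bullet> z \<le> W w - v \<bullet> w" for w
    using z(2)[of w] z(1) by (cases "w \<in> S") (auto simp: S_def)
  then have "conj_value W v = W z - v \<bullet> z"
    unfolding conj_value_def conj_point_def by (intro arg_min_equality) auto
  then show ?thesis using \<open>W z - v \<bullet> z \<le> W w - v \<bullet> w\<close> by simp
qed

text \<open>The point selected for \<open>v\<close> competes in the minimisation for
  \<open>u\<close>. No differentiability is involved, so any selection of minimisers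
  qualifies.\<close>

lemma conj_value_supergradient:
  assumes "u \<in> interior (dual_ball N)"
  shows "conj_value W u \<le> conj_value W v - (u - v) \<bullet> conj_point W v"
  using conj_value_le[OF assms, of "conj_point W v"]
  by (simp add: conj_value_def inner_diff_left)

lemma conj_value_ge: 
  assumes "v \<in> dual_ball N" shows "conj_value W v \<ge> 0"
  using assms W unfolding dual_ball_iff[OF N] dominates_def conj_value_def by (meson diff_ge_0_iff_ge order_trans)

lemma conj_value_le_zero:
  assumes "v \<in> interior (dual_ball N)" shows "conj_value W v \<le> W 0"
  using conj_value_le[OF assms, of 0] by simp

lemma dominates_zero_nonneg: "W 0 \<ge> 0"
  using W norm_fun_zero[OF N] unfolding dominates_def by metis

lemma N_conj_point_le: "N (conj_point W v) \<le> conj_value W v + v \<bullet> conj_point W v"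
  using W unfolding dominates_def conj_value_def by simp

lemma inner_conj_point_mono:
  assumes "u \<in> interior (dual_ball N)" "v \<in> interior (dual_ball N)"
  shows "(u - v) \<bullet> conj_point W v \<le> (u - v) \<bullet> conj_point W u"
  using conj_value_supergradient[OF assms(1), of v] conj_value_supergradient[OF assms(2), of u]
  by (simp add: inner_diff_left)

text \<open>A minimum of affine functions of \<open>v\<close> is concave, and a finite concave
  function on an open set is continuous.\<close>

lemma conj_value_continuous: "continuous_on (interior (dual_ball N)) (conj_value W)"
proof -
  have "convex_on (interior (dual_ball N)) (\<lambda>v. - conj_value W v)"
    unfolding convex_on_def
  proof (intro conjI ballI allI impI)
    show cv: "convex (interior (dual_ball N))" using dual_ball_convex by (rule convex_interior)
    fix x y :: 'a and s t :: real
    assume x: "x \<in> interior (dual_ball N)" and y: "y \<in> interior (dual_ball N)"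
      and st: "0 \<le> s" "0 \<le> t" "s + t = 1"
    define z where "z = conj_point W (s *\<^sub>R x + t *\<^sub>R y)"
    have "s * conj_value W x + t * conj_value W y \<le> s * (W z - x \<bullet> z) + t * (W z - y \<bullet> z)"
      using st conj_value_le[OF x, of z] conj_value_le[OF y, of z] by (intro add_mono mult_left_mono) auto
    also have "\<dots> = (s + t) * W z - (s *\<^sub>R x + t *\<^sub>R y) \<bullet> z" by (simp add: algebra_simps)
    also have "\<dots> = conj_value W (s *\<^sub>R x + t *\<^sub>R y)" using st by (simp add: conj_value_def z_def)
    finally show "- conj_value W (s *\<^sub>R x + t *\<^sub>R y) \<le> s * - conj_value W x + t * - conj_value W y" by simp
  qed
  then have "continuous_on (interior (dual_ball N)) (\<lambda>v. - conj_value W v)"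
    by (rule convex_on_continuous[OF open_interior])
  then show ?thesis using continuous_on_minus by force
qed

text \<open>The linear term takes away at most the fraction \<rho> of \<open>N\<close>, and the
  remaining \<open>1 - \<rho>\<close> must be paid from \<open>W 0\<close>. The bound degenerates as
  \<rho> tends to 1, which confines the uniform estimates to scaled balls.\<close>

lemma N_conj_point_bound:
  assumes r: "0 < \<rho>" "\<rho> < 1" and v: "v \<in> dual_ball (\<lambda>x. \<rho> * N x)"
  shows "N (conj_point W v) \<le> W 0 / (1 - \<rho>)"
proof -
  have v': "v \<in> interior (dual_ball N)" using dual_ball_scale_subset[OF N r] v by blast
  have "v \<bullet> conj_point W v \<le> \<rho> * N (conj_point W v)"
    using v unfolding dual_ball_iff[OF norm_fun_scale[OF N r(1)]] by blast
  then have "(1 - \<rho>) * N (conj_point W v) \<le> W 0"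
    using N_conj_point_le[of v] conj_value_le_zero[OF v'] by (simp add: algebra_simps)
  then show ?thesis using r by (simp add: field_simps)
qed

end

lemma interior_dual_ball_scale:
  fixes N :: "'a::euclidean_space \<Rightarrow> real"
  assumes N: "norm_fun N" and r: "\<rho> > 0"
  shows "interior (dual_ball (\<lambda>x. \<rho> * N x)) = (\<lambda>v. \<rho> *\<^sub>R v) ` interior (dual_ball N)"
  unfolding dual_ball_scale[OF N r] using r by (intro interior_injective_linear_image) (auto simp: inj_on_def linear_iff algebra_simps)

lemma interior_dual_ball_lmeasurable:
  fixes N :: "'a::euclidean_space \<Rightarrow> real"
  shows "norm_fun N \<Longrightarrow> interior (dual_ball N) \<in> lmeasurable"
  by (intro lmeasurable_open open_interior bounded_subset[OF compact_imp_bounded[OF dual_ball_compact] interior_subset])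

lemma negligible_frontier_dual_ball:
  fixes N :: "'a::euclidean_space \<Rightarrow> real"
  shows "norm_fun N \<Longrightarrow> negligible (dual_ball N - interior (dual_ball N))"
  by (rule negligible_subset[OF negligible_convex_frontier[OF dual_ball_convex, of N]])
     (use closure_subset in \<open>auto simp: frontier_def\<close>)

lemma dual_ball_add_small:
  fixes N :: "'a::euclidean_space \<Rightarrow> real"
  assumes N: "norm_fun N" and r: "0 < \<rho>" "\<rho> < \<rho>'"
  obtains \<delta> where "\<delta> > 0"
    "\<And>v h. v \<in> dual_ball (\<lambda>x. \<rho> * N x) \<Longrightarrow> \<bar>h\<bar> \<le> \<delta> \<Longrightarrow> v + h *\<^sub>R b \<in> dual_ball (\<lambda>x. \<rho>' * N x)"
proof -
  obtain c where c: "c > 0" "\<And>x. c * norm x \<le> N x" using norm_fun_lower[OF N] by blast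
  define \<delta> where "\<delta> = c * (\<rho>' - \<rho>) / (norm b + 1)"
  have pos: "norm b + 1 > 0" by (simp add: add_nonneg_pos)
  have d: "\<delta> > 0" using c r pos by (simp add: \<delta>_def)
  have db: "\<delta> * norm b \<le> c * (\<rho>' - \<rho>)"
  proof -
    have "\<delta> * norm b \<le> \<delta> * (norm b + 1)" using d by simp
    also have "\<dots> = c * (\<rho>' - \<rho>)" using pos by (simp add: \<delta>_def)
    finally show ?thesis .
  qed
  have "v + h *\<^sub>R b \<in> dual_ball (\<lambda>x. \<rho>' * N x)"
    if v: "v \<in> dual_ball (\<lambda>x. \<rho> * N x)" and h: "\<bar>h\<bar> \<le> \<delta>" for v h
  proof -
    have "(v + h *\<^sub>R b) \<bullet> w \<le> \<rho>' * N w" for w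
    proof -
      have "h * (b \<bullet> w) \<le> \<bar>h\<bar> * \<bar>b \<bullet> w\<bar>" by (metis abs_ge_self abs_mult)
      also have "\<dots> \<le> \<delta> * (norm b * norm w)"
        using h d Cauchy_Schwarz_ineq2[of b w] by (intro mult_mono) auto
      also have "\<dots> = (\<delta> * norm b) * norm w" by simp
      also have "\<dots> \<le> (c * (\<rho>' - \<rho>)) * norm w" using db by (rule mult_right_mono) simp
      also have "\<dots> = (\<rho>' - \<rho>) * (c * norm w)" by simp
      also have "\<dots> \<le> (\<rho>' - \<rho>) * N w" using r c by (intro mult_left_mono) auto
      finally have "h * (b \<bullet> w) \<le> (\<rho>' - \<rho>) * N w" .
      moreover have "v \<bullet> w \<le> \<rho> * N w" using v unfolding dual_ball_iff[OF norm_fun_scale[OF N r(1)]] by blast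
      ultimately show ?thesis by (simp add: inner_add_left algebra_simps)
    qed
    then show ?thesis using r by (subst dual_ball_iff[OF norm_fun_scale[OF N]]) auto
  qed
  with d show thesis by (rule that)
qed

context
  fixes N W :: "'a::euclidean_space \<Rightarrow> real"
  assumes N: "norm_fun N" and W: "dominates W N"
begin

text \<open>A selection of supergradients need not be unique, but its difference quotients squeeze it
  between measurable functions whose integrals agree in the limit by translation invariance.\<close>

lemma conj_point_component_integrable:
  assumes r: "0 < \<rho>" "\<rho> < 1"
  shows "integrable lebesgue (\<lambda>v. indicator (dual_ball (\<lambda>x. \<rho> * N x)) v * (conj_point W v \<bullet> b))"
proof -
  \<comment> \<open>An intermediate ball: translates of \<open>K\<close> by at most \<delta> along
    \<open>b\<close> stay in \<open>K'\<close>, where \<open>conj_point W v \<bullet> b\<close> is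
    still bounded by the constant \<open>P\<close>.\<close>
  define \<rho>' where "\<rho>' = (1 + \<rho>) / 2"
  have r': "0 < \<rho>'" "\<rho>' < 1" "\<rho> < \<rho>'" using r by (auto simp: \<rho>'_def)
  let ?c = "conj_point W" and ?F = "conj_value W"
  define K where "K = dual_ball (\<lambda>x. \<rho> * N x)"
  define K' where "K' = dual_ball (\<lambda>x. \<rho>' * N x)"
  define U where "U = interior (dual_ball N)"
  obtain \<delta> where d: "\<delta> > 0" "\<And>v h. v \<in> K \<Longrightarrow> \<bar>h\<bar> \<le> \<delta> \<Longrightarrow> v + h *\<^sub>R b \<in> K'"
    using dual_ball_add_small[OF N r(1) r'(3)] unfolding K_def K'_def by metis
  have KK': "K \<subseteq> K'" using d(2)[of _ 0] d(1) by auto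
  have K'U: "K' \<subseteq> U" using dual_ball_scale_subset[OF N r'(1,2)] by (simp add: K'_def U_def)
  have Kc: "compact K" "compact K'" 
    using dual_ball_compact[OF norm_fun_scale[OF N r(1)]] dual_ball_compact[OF norm_fun_scale[OF N r'(1)]]
    by (auto simp: K_def K'_def)
  then have Kl: "K \<in> lmeasurable" "K' \<in> lmeasurable" by (auto intro: lmeasurable_compact)
  then have Kint: "integrable lebesgue (indicat_real K)" "integrable lebesgue (indicat_real K')"
    by (auto simp: fmeasurable_def)
  have Ks[measurable]: "K \<in> sets lebesgue" "K' \<in> sets lebesgue" using Kl by auto
  define h where "h n = \<delta> / (real n + 1)" for n
  have h: "h n > 0" "h n \<le> \<delta>" for n using d by (auto simp: h_def field_simps)
  have hlim: "h \<longlonglongrightarrow> 0" unfolding h_def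
    using tendsto_mult[OF tendsto_const[of \<delta>] LIMSEQ_inverse_real_of_nat] by (simp add: divide_inverse add.commute)
  have Kp: "v + h n *\<^sub>R b \<in> K'" and Km: "v - h n *\<^sub>R b \<in> K'" if "v \<in> K" for v n
    using d(2)[OF that, of "h n"] d(2)[OF that, of "- h n"] h[of n] by auto
  define Fx where "Fx v = indicator U v *\<^sub>R ?F v" for v
  have "Fx \<in> borel_measurable borel" unfolding Fx_def
    by (rule borel_measurable_continuous_on_indicator) (use conj_value_continuous[OF N W] in \<open>auto simp: U_def\<close>)
  then have Fx[measurable]: "Fx \<in> borel_measurable lebesgue" by (simp add: measurable_completion)
  have FxU: "Fx v = ?F v" if "v \<in> U" for v using that by (simp add: Fx_def)
  \<comment> \<open>A difference quotient of the conjugate along \<open>b\<close>. The supergradient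
    inequality at its two ends places it between \<open>conj_point W v \<bullet> b\<close> and the
    same expression at \<open>v + h n *\<^sub>R b\<close>.\<close>
  define q where "q n v = (Fx v - Fx (h n *\<^sub>R b + 1 *\<^sub>R v)) / h n" for n v
  have q[measurable]: "q n \<in> borel_measurable lebesgue" for n
    using lebesgue_integral_affine(3)[OF _ Fx, of 1 "h n *\<^sub>R b"] unfolding q_def by measurable
  obtain C where C: "C > 0" "\<And>x. C * norm x \<le> N x" using norm_fun_lower[OF N] by blast
  define P where "P = norm b * (W 0 / (1 - \<rho>') / C)"
  have cb: "\<bar>?c v \<bullet> b\<bar> \<le> P" if "v \<in> K'" for v
  proof -
    have "C * norm (?c v) \<le> W 0 / (1 - \<rho>')"
      using C(2)[of "?c v"] N_conj_point_bound[OF N W r'(1,2) that[unfolded K'_def]] by linarith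
    then have "norm (?c v) \<le> W 0 / (1 - \<rho>') / C"
      using C(1) by (subst pos_le_divide_eq) (simp_all only: mult.commute)
    then have "norm (?c v) * norm b \<le> P"
      unfolding P_def by (subst mult.commute) (rule mult_left_mono, simp_all only: norm_ge_zero)
    then show ?thesis using Cauchy_Schwarz_ineq2[of "?c v" b] by linarith
  qed
  have q1: "?c v \<bullet> b \<le> q n v" "q n v \<le> ?c (v + h n *\<^sub>R b) \<bullet> b" if "v \<in> U" "v + h n *\<^sub>R b \<in> U" for v n
  proof -
    have q: "q n v = (?F v - ?F (v + h n *\<^sub>R b)) / h n"
      using FxU that by (simp add: q_def add.commute)
    have "?F (v + h n *\<^sub>R b) \<le> ?F v - h n * (?c v \<bullet> b)"
      using conj_value_supergradient[OF N W, of "v + h n *\<^sub>R b" v] that by (simp add: U_def inner_commute)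
    then show "?c v \<bullet> b \<le> q n v" unfolding q using h(1)[of n] by (simp add: pos_le_divide_eq mult.commute)
    have "?F v \<le> ?F (v + h n *\<^sub>R b) + h n * (?c (v + h n *\<^sub>R b) \<bullet> b)"
      using conj_value_supergradient[OF N W, of v "v + h n *\<^sub>R b"] that by (simp add: U_def inner_commute)
    then show "q n v \<le> ?c (v + h n *\<^sub>R b) \<bullet> b"
      unfolding q using h(1)[of n] by (simp add: pos_divide_le_eq mult.commute)
  qed
  have qu: "?c v \<bullet> b \<le> q n v" if "v \<in> K" for v n
    using q1 Kp[OF that, of n] that KK' K'U by blast
  have ql: "q n (v - h n *\<^sub>R b) \<le> ?c v \<bullet> b" if "v \<in> K" for v n
    using q1(2)[of "v - h n *\<^sub>R b" n] Km[OF that, of n] that KK' K'U by auto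
  have qb: "\<bar>q n v\<bar> \<le> P" if "v \<in> K'" "v + h n *\<^sub>R b \<in> K'" for v n
  proof -
    have "v \<in> U" "v + h n *\<^sub>R b \<in> U" using that K'U by auto
    then show ?thesis using q1[of v n] cb[OF that(1)] cb[OF that(2)] by linarith
  qed
  define u where "u n v = indicator K v * q n v" for n v
  define l where "l n v = indicator K v * q n (- (h n *\<^sub>R b) + 1 *\<^sub>R v)" for n v
  have ui: "integrable lebesgue (u n)" for n
  proof (rule Bochner_Integration.integrable_bound)
    show "integrable lebesgue (\<lambda>v. P * indicator K v)" using Kint by simp
    show "u n \<in> borel_measurable lebesgue" unfolding u_def by measurable
    show "AE v in lebesgue. norm (u n v) \<le> norm (P * indicator K v)"
    proof (rule AE_I2)
      fix v show "norm (u n v) \<le> norm (P * indicator K v)"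
        using qb[of v n] Kp[of v n] KK' by (cases "v \<in> K") (auto simp: u_def)
    qed
  qed
  have li: "integrable lebesgue (l n)" for n
  proof (rule Bochner_Integration.integrable_bound)
    show "integrable lebesgue (\<lambda>v. P * indicator K v)" using Kint by simp
    show "l n \<in> borel_measurable lebesgue" unfolding l_def
      using lebesgue_integral_affine(3)[OF _ q, of 1 n "- (h n *\<^sub>R b)"] by measurable
    show "AE v in lebesgue. norm (l n v) \<le> norm (P * indicator K v)"
    proof (rule AE_I2)
      fix v show "norm (l n v) \<le> norm (P * indicator K v)"
        using qb[of "v - h n *\<^sub>R b" n] Km[of v n] KK' by (cases "v \<in> K") (auto simp: l_def)
    qed
  qed
  show ?thesis unfolding K_def[symmetric]
  proof (rule integrable_squeeze[OF li ui])
    show "l n v \<le> indicator K v * (?c v \<bullet> b)" for n v using ql[of v n] by (auto simp: l_def indicator_def)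
    show "indicator K v * (?c v \<bullet> b) \<le> u n v" for n v using qu[of v n] by (auto simp: u_def indicator_def)
    \<comment> \<open>Translating the integral of \<open>l n\<close> by
      \<open>h n *\<^sub>R b\<close> turns the integral of \<open>u n - l n\<close> into that of
      \<open>s n\<close>. The latter is nonzero only where exactly one of \<open>v\<close> and
      \<open>v + h n *\<^sub>R b\<close> lies in \<open>K\<close>, so off the frontier of
      \<open>K\<close> it vanishes eventually.\<close>
    define s where "s n v = (indicator K v - indicator K (h n *\<^sub>R b + 1 *\<^sub>R v)) * q n v" for n v
    have indm: "(\<lambda>v. indicat_real K (h n *\<^sub>R b + 1 *\<^sub>R v)) \<in> borel_measurable lebesgue" for n
      using lebesgue_integral_affine(3)[of 1 "indicat_real K" "h n *\<^sub>R b"] by auto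
    have sm[measurable]: "s n \<in> borel_measurable lebesgue" for n unfolding s_def using indm by measurable
    have lt: "l n (h n *\<^sub>R b + 1 *\<^sub>R v) = indicator K (h n *\<^sub>R b + 1 *\<^sub>R v) * q n v" for n v
      by (simp add: l_def)
    have lm: "l n \<in> borel_measurable lebesgue" for n using li by (rule borel_measurable_integrable)
    have lti: "integrable lebesgue (\<lambda>v. l n (h n *\<^sub>R b + 1 *\<^sub>R v))" for n
      using lebesgue_integral_affine(1)[OF _ lm, of 1 n "h n *\<^sub>R b"] li by simp
    have "integral\<^sup>L lebesgue (\<lambda>v. u n v - l n v) = integral\<^sup>L lebesgue (s n)" for n
    proof -
      have "integral\<^sup>L lebesgue (l n) = integral\<^sup>L lebesgue (\<lambda>v. l n (h n *\<^sub>R b + 1 *\<^sub>R v))"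
        using lebesgue_integral_affine(2)[OF _ lm, of 1 n "h n *\<^sub>R b"] by simp
      then have "integral\<^sup>L lebesgue (\<lambda>v. u n v - l n v)
          = integral\<^sup>L lebesgue (\<lambda>v. u n v - l n (h n *\<^sub>R b + 1 *\<^sub>R v))"
        using ui li lti by simp
      also have "\<dots> = integral\<^sup>L lebesgue (s n)"
        unfolding lt by (intro Bochner_Integration.integral_cong) (auto simp: s_def u_def algebra_simps)
      finally show ?thesis .
    qed
    moreover have "(\<lambda>n. integral\<^sup>L lebesgue (s n)) \<longlonglongrightarrow> integral\<^sup>L lebesgue (\<lambda>v::'a. 0::real)"
    proof (rule integral_dominated_convergence[where w="\<lambda>v. P * indicator K' v"])
      show "integrable lebesgue (\<lambda>v. P * indicator K' v)" using Kint by simp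
      show "AE v in lebesgue. norm (s n v) \<le> P * indicator K' v" for n
      proof (rule AE_I2)
        fix v
        have "0 \<in> K'" using zero_in_interior_dual_ball[OF norm_fun_scale[OF N r'(1)]] interior_subset by (auto simp: K'_def)
        then have P0: "P \<ge> 0" using cb[of 0] by linarith
        consider "v \<in> K" | "v \<notin> K" "v + h n *\<^sub>R b \<in> K" | "v \<notin> K" "v + h n *\<^sub>R b \<notin> K" by blast
        then show "norm (s n v) \<le> P * indicator K' v"
        proof cases
          case 1
          then show ?thesis using qb[of v n] Kp[of v n] KK' P0 by (auto simp: s_def indicator_def add.commute)
        next
          case 2
          then show ?thesis using qb[of v n] Km[OF 2(2), of n] KK' P0 by (auto simp: s_def indicator_def add.commute)
        next
          case 3
          then show ?thesis using P0 by (simp add: s_def add.commute)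
        qed
      qed
      show "AE v in lebesgue. (\<lambda>n. s n v) \<longlonglongrightarrow> 0"
      proof -
        have "frontier K \<in> null_sets lebesgue"

          using negligible_convex_frontier[OF dual_ball_convex] by (simp add: negligible_iff_null_sets K_def)
        then have "AE v in lebesgue. v \<notin> frontier K" by (rule AE_not_in)
        then show ?thesis
        proof eventually_elim
          fix v assume v: "v \<notin> frontier K"
          have lim: "(\<lambda>n. h n *\<^sub>R b + 1 *\<^sub>R v) \<longlonglongrightarrow> v"
            using tendsto_add[OF tendsto_scaleR[OF hlim tendsto_const[of b]] tendsto_const[of v]] by simp
          have cl: "closed K" using Kc by (simp add: compact_imp_closed)
          have "\<forall>\<^sub>F n in sequentially. s n v = 0"
          proof (cases "v \<in> K")
            case True
            then have vi: "v \<in> interior K" using v cl by (simp add: frontier_def)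
            have "\<forall>\<^sub>F n in sequentially. h n *\<^sub>R b + 1 *\<^sub>R v \<in> interior K"
              using topological_tendstoD[OF lim open_interior vi] .
            then show ?thesis
              by (rule eventually_mono) (use True interior_subset in \<open>auto simp: s_def indicator_def\<close>)
          next
            case False
            have "\<forall>\<^sub>F n in sequentially. h n *\<^sub>R b + 1 *\<^sub>R v \<in> - K"
              using topological_tendstoD[OF lim, of "- K"] cl False by auto
            then show ?thesis by (rule eventually_mono) (use False in \<open>auto simp: s_def\<close>)
          qed
          then show "(\<lambda>n. s n v) \<longlonglongrightarrow> 0" by (rule tendsto_eventually)
        qed
      qed
    qed auto
    ultimately show "(\<lambda>n. integral\<^sup>L lebesgue (\<lambda>v. u n v - l n v)) \<longlonglongrightarrow> 0" by simp
  qed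
qed

lemma conj_point_absolutely_integrable_scaled:
  assumes r: "0 < \<rho>" "\<rho> < 1"
  shows "conj_point W absolutely_integrable_on dual_ball (\<lambda>x. \<rho> * N x)"
proof (rule absolutely_integrable_componentwise)
  fix b :: 'a
  show "(\<lambda>v. conj_point W v \<bullet> b) absolutely_integrable_on dual_ball (\<lambda>x. \<rho> * N x)"
    using conj_point_component_integrable[OF r, of b] by (simp add: set_integrable_def)
qed

lemma conj_value_absolutely_integrable: 
  "conj_value W absolutely_integrable_on interior (dual_ball N)"
proof (rule measurable_bounded_by_integrable_imp_absolutely_integrable)
  let ?U = "interior (dual_ball N)"
  show "?U \<in> sets lebesgue" using interior_dual_ball_lmeasurable[OF N] by auto
  then show "conj_value W \<in> borel_measurable (lebesgue_on ?U)"
    by (rule continuous_imp_measurable_on_sets_lebesgue[OF conj_value_continuous[OF N W]])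
  show "(\<lambda>_. W 0) integrable_on ?U" using interior_dual_ball_lmeasurable[OF N] by (rule integrable_on_const)
  show "norm (conj_value W v) \<le> W 0" if "v \<in> ?U" for v
    using conj_value_le_zero[OF N W that] conj_value_ge[OF N W, of v] that interior_subset by fastforce
qed

end

lemma norm_fun_absolutely_integrable:
  fixes N :: "'b::euclidean_space \<Rightarrow> real" and f :: "'a::euclidean_space \<Rightarrow> 'b"
  assumes N: "norm_fun N" and f: "f absolutely_integrable_on S" and S: "S \<in> sets lebesgue"
  shows "(\<lambda>x. N (f x)) absolutely_integrable_on S"
proof -
  obtain C where C: "C > 0" "\<And>x. N x \<le> C * norm x" using norm_fun_upper[OF N] by blast
  have "N \<in> borel_measurable borel" using norm_fun_continuous[OF N] by (rule borel_measurable_continuous_onI)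
  moreover have "f \<in> borel_measurable (lebesgue_on S)" using f S absolutely_integrable_measurable by blast
  ultimately have m: "(\<lambda>x. N (f x)) \<in> borel_measurable (lebesgue_on S)" by measurable
  show ?thesis
  proof (rule measurable_bounded_by_integrable_imp_absolutely_integrable[OF m S])
    show "(\<lambda>x. C * norm (f x)) integrable_on S"
      using absolutely_integrable_norm[OF f] by (intro integrable_on_mult_right) (auto simp: absolutely_integrable_on_def o_def)
    show "norm (N (f x)) \<le> C * norm (f x)" for x using C(2) norm_funD(1)[OF N] by simp
  qed
qed

section \<open>Exhaustion by scaled balls and integrability up to the boundary\<close>

lemma dual_ball_scale_mono:
  fixes N :: "'a::euclidean_space \<Rightarrow> real"
  assumes N: "norm_fun N" and r: "0 < r" "r \<le> s"
  shows "dual_ball (\<lambda>x. r * N x) \<subseteq> dual_ball (\<lambda>x. s * N x)"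
proof
  fix v assume "v \<in> dual_ball (\<lambda>x. r * N x)"
  then have "v \<bullet> w \<le> r * N w" for w unfolding dual_ball_iff[OF norm_fun_scale[OF N r(1)]] by blast
  moreover have "r * N w \<le> s * N w" for w using r norm_funD(1)[OF N] by (intro mult_right_mono)
  ultimately have "v \<bullet> w \<le> s * N w" for w by (meson order_trans)
  then show "v \<in> dual_ball (\<lambda>x. s * N x)"
    using r by (subst dual_ball_iff[OF norm_fun_scale[OF N]]) auto
qed

text \<open>The offset 2 keeps every value at least 1/2 and below 1; the lower bound 1/2 later makes
  an estimate uniform in \<open>k\<close>.\<close>

definition ratio :: "nat \<Rightarrow> real" where "ratio k = 1 - 1 / (real k + 2)"

lemma ratio: "0 < ratio k" "ratio k < 1" "ratio k \<le> ratio (Suc k)"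
  by (auto simp: ratio_def field_simps)

lemma ratio_lim: "ratio \<longlonglongrightarrow> 1"
proof -
  have "(\<lambda>k. 1 - inverse (real (Suc (Suc k)))) \<longlonglongrightarrow> 1 - 0"
    by (intro tendsto_diff tendsto_const LIMSEQ_Suc[OF LIMSEQ_inverse_real_of_nat])
  then show ?thesis unfolding ratio_def by (simp add: divide_inverse add.commute)
qed

lemma interior_dual_ball_eventually_scale:
  fixes N :: "'a::euclidean_space \<Rightarrow> real"
  assumes N: "norm_fun N" and v: "v \<in> interior (dual_ball N)"
  shows "\<forall>\<^sub>F k in sequentially. v \<in> interior (dual_ball (\<lambda>x. ratio k * N x))"
proof -
  obtain r where r: "0 < r" "r < 1" "\<And>w. v \<bullet> w \<le> r * N w"
    using v unfolding interior_dual_ball_iff[OF N] by blast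
  show ?thesis using order_tendstoD(1)[OF ratio_lim r(2)]
  proof (rule eventually_mono)
    fix k assume k: "r < ratio k"
    have "v \<bullet> w \<le> (r / ratio k) * (ratio k * N w)" for w using r(3)[of w] k r(1) by simp
    then show "v \<in> interior (dual_ball (\<lambda>x. ratio k * N x))"
      unfolding interior_dual_ball_iff[OF norm_fun_scale[OF N ratio(1)]]
      using k r by (intro exI[of _ "r / ratio k"]) auto
  qed
qed

context
  fixes N W :: "'a::euclidean_space \<Rightarrow> real"
  assumes N: "norm_fun N" and W: "dominates W N"
begin

lemma interior_dual_ball_scale_subset:
  assumes r: "0 < r" "r < 1"
  shows "interior (dual_ball (\<lambda>x. r * N x)) \<subseteq> interior (dual_ball N)"
  using interior_subset dual_ball_scale_subset[OF N r] by blast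

text \<open>The pointwise bound blows up as \<open>r\<close> tends to 1, the integral does not. The
  pairing of \<open>v\<close> with \<open>conj_point W (r *\<^sub>R v)\<close> is at most the
  difference quotient \<open>(?F (r *\<^sub>R v) - ?F v) / (1 - r)\<close>, and a change of
  variables compares the integrals of its two terms up to the Jacobian
  \<open>r ^ DIM('a)\<close>.\<close>

lemma conj_point_mass_bound:
  assumes r: "0 < r" "r < 1"
  defines "Ur \<equiv> interior (dual_ball (\<lambda>x. r * N x))" and "U \<equiv> interior (dual_ball N)"
  shows "(\<lambda>v. N (conj_point W v)) absolutely_integrable_on Ur"
    and "integral Ur (\<lambda>v. N (conj_point W v)) \<le> W 0 * measure lebesgue U + real DIM('a) * integral U (conj_value W)"
proof -
  let ?c = "conj_point W" and ?F = "conj_value W"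
  have Url: "Ur \<in> lmeasurable" unfolding Ur_def by (rule interior_dual_ball_lmeasurable[OF norm_fun_scale[OF N r(1)]])
  then have Urs: "Ur \<in> sets lebesgue" by auto
  have Ul: "U \<in> lmeasurable" unfolding U_def by (rule interior_dual_ball_lmeasurable[OF N])
  have sub: "Ur \<subseteq> U" unfolding Ur_def U_def by (rule interior_dual_ball_scale_subset[OF r])
  have "?c absolutely_integrable_on Ur"
    by (rule set_integrable_subset[OF conj_point_absolutely_integrable_scaled[OF N W r] Urs])
       (simp add: Ur_def interior_subset)
  from norm_fun_absolutely_integrable[OF N this Urs]
  show Nc: "(\<lambda>v. N (?c v)) absolutely_integrable_on Ur" .
  have Fi: "?F absolutely_integrable_on U" unfolding U_def by (rule conj_value_absolutely_integrable[OF N W])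
  have Fri: "?F absolutely_integrable_on Ur" by (rule set_integrable_subset[OF Fi Urs sub])
  have im: "Ur = (\<lambda>v. 0 + r *\<^sub>R v) ` U" unfolding Ur_def U_def interior_dual_ball_scale[OF N r(1)] by simp
  note a1 = absolutely_integrable_affine[OF r(1), where g="\<lambda>v. N (?c v)" and t=0 and S=U, folded im, OF Nc]
  note a2 = absolutely_integrable_affine[OF r(1), where g="?F" and t=0 and S=U, folded im, OF Fri]
  let ?d = "DIM('a)"
  define I where "I = integral U ?F"
  have F0: "?F v \<ge> 0" if "v \<in> U" for v
    using conj_value_ge[OF N W] that interior_subset unfolding U_def by blast
  have I0: "I \<ge> 0" unfolding I_def by (rule integral_nonneg) (use Fi F0 in \<open>auto simp: absolutely_integrable_on_def\<close>)
  have IF: "?F integrable_on U" "?F integrable_on Ur" "(\<lambda>v. N (?c (0 + r *\<^sub>R v))) integrable_on U"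
    "(\<lambda>v. ?F (0 + r *\<^sub>R v)) integrable_on U"
    using Fi Fri a1(1) a2(1) by (auto simp: absolutely_integrable_on_def)
  have "integral Ur ?F \<le> I" unfolding I_def
    by (rule integral_subset_le[OF sub]) (use IF F0 in auto)
  then have I2: "r ^ ?d * integral U (\<lambda>v. ?F (0 + r *\<^sub>R v)) \<le> I" using a2(2) by simp
  have pw: "N (?c (0 + r *\<^sub>R v)) \<le> W 0 + r / (1 - r) * (?F (0 + r *\<^sub>R v) - ?F v)" if v: "v \<in> U" for v
  proof -
    have rv: "0 + r *\<^sub>R v \<in> Ur" using im v by blast
    then have rvU: "r *\<^sub>R v \<in> interior (dual_ball N)" using sub by (auto simp: U_def)
    have "?F v \<le> ?F (r *\<^sub>R v) - (v - r *\<^sub>R v) \<bullet> ?c (r *\<^sub>R v)"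
      using conj_value_supergradient[OF N W] v by (simp add: U_def)
    then have "(1 - r) * (v \<bullet> ?c (r *\<^sub>R v)) \<le> ?F (r *\<^sub>R v) - ?F v" by (simp add: algebra_simps)
    then have "v \<bullet> ?c (r *\<^sub>R v) \<le> (?F (r *\<^sub>R v) - ?F v) / (1 - r)" using r by (simp add: field_simps)
    then have "r * (v \<bullet> ?c (r *\<^sub>R v)) \<le> r * ((?F (r *\<^sub>R v) - ?F v) / (1 - r))"
      using r(1) by (intro mult_left_mono) auto
    moreover have "N (?c (r *\<^sub>R v)) \<le> ?F (r *\<^sub>R v) + r * (v \<bullet> ?c (r *\<^sub>R v))"
      using N_conj_point_le[OF N W, of "r *\<^sub>R v"] by simp
    ultimately show ?thesis using conj_value_le_zero[OF N W rvU] by simp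
  qed
  have "integral U (\<lambda>v. N (?c (0 + r *\<^sub>R v))) \<le> integral U (\<lambda>v. W 0 + r / (1 - r) * (?F (0 + r *\<^sub>R v) - ?F v))"
    by (rule integral_le) (intro IF integrable_add integrable_on_mult_right integrable_diff integrable_on_const[OF Ul] pw | assumption)+
  also have "\<dots> = W 0 * measure lebesgue U + r / (1 - r) * (integral U (\<lambda>v. ?F (0 + r *\<^sub>R v)) - I)"
  proof -
    have "integral U (\<lambda>v. W 0 + r / (1 - r) * (?F (0 + r *\<^sub>R v) - ?F v))
      = integral U (\<lambda>v. W 0) + integral U (\<lambda>v. r / (1 - r) * (?F (0 + r *\<^sub>R v) - ?F v))"
      using IF integrable_on_const[OF Ul] by (intro integral_add integrable_on_mult_right integrable_diff) auto
    also have "integral U (\<lambda>v. W 0) = W 0 * measure lebesgue U"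
      using lmeasure_integral[OF Ul] integral_mult_right[of U "W 0" "\<lambda>_. 1"] by simp
    also have "integral U (\<lambda>v. r / (1 - r) * (?F (0 + r *\<^sub>R v) - ?F v))
      = r / (1 - r) * (integral U (\<lambda>v. ?F (0 + r *\<^sub>R v)) - I)"
      unfolding I_def using IF by (simp add: integral_diff del: add_0)
    finally show ?thesis .
  qed
  finally have "r ^ ?d * integral U (\<lambda>v. N (?c (0 + r *\<^sub>R v))) \<le>
      r ^ ?d * (W 0 * measure lebesgue U + r / (1 - r) * (integral U (\<lambda>v. ?F (0 + r *\<^sub>R v)) - I))"
    using r by (intro mult_left_mono) auto
  also have "\<dots> = r ^ ?d * (W 0 * measure lebesgue U) + r / (1 - r) * (r ^ ?d * integral U (\<lambda>v. ?F (0 + r *\<^sub>R v)) - r ^ ?d * I)"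
    by (simp add: algebra_simps)
  also have "\<dots> \<le> 1 * (W 0 * measure lebesgue U) + r / (1 - r) * (I - r ^ ?d * I)"
    using r I2 dominates_zero_nonneg[OF N W]
    by (intro add_mono mult_mono mult_left_mono) (auto simp: power_le_one)
  \<comment> \<open>Bernoulli bounds \<open>1 - r ^ ?d\<close> by \<open>real ?d * (1 - r)\<close>:
    this cancels the denominator and is the source of the factor \<open>DIM('a)\<close>.\<close>
  also have "r / (1 - r) * (I - r ^ ?d * I) \<le> real ?d * I"
  proof -
    have "1 + real ?d * (r - 1) \<le> (1 + (r - 1)) ^ ?d" using r by (intro Bernoulli_inequality) auto
    then have b: "1 - r ^ ?d \<le> real ?d * (1 - r)" by (simp add: algebra_simps)
    have "r / (1 - r) * (I - r ^ ?d * I) = r * ((1 - r ^ ?d) / (1 - r)) * I"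
      by (simp add: left_diff_distrib diff_divide_distrib right_diff_distrib mult_ac)
    also have "\<dots> \<le> 1 * real ?d * I"
    proof (intro mult_right_mono mult_mono)
      show "(1 - r ^ ?d) / (1 - r) \<le> real ?d" using b r by (simp add: pos_divide_le_eq)
    qed (use r I0 in \<open>auto simp: power_le_one\<close>)
    finally show ?thesis by simp
  qed
  finally show "integral Ur (\<lambda>v. N (?c v)) \<le> W 0 * measure lebesgue U + real ?d * integral U ?F"
    using a1(2) by (simp add: I_def)
qed

text \<open>Selected points can be unbounded near the boundary. The bound of
  \<open>conj_point_mass_bound\<close>, uniform over scaled balls, makes
  \<open>N (conj_point W v)\<close> integrable by monotone convergence; a multiple of it then
  dominates the vector-valued map.\<close>

lemma conj_point_absolutely_integrable: "conj_point W absolutely_integrable_on interior (dual_ball N)"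
proof -
  let ?c = "conj_point W" and ?F = "conj_value W"
  define U where "U = interior (dual_ball N)"
  define Uk where "Uk k = interior (dual_ball (\<lambda>x. ratio k * N x))" for k
  have sub: "Uk k \<subseteq> U" for k unfolding U_def Uk_def by (rule interior_dual_ball_scale_subset[OF ratio(1,2)])
  have mono: "Uk k \<subseteq> Uk (Suc k)" for k
    unfolding Uk_def by (intro interior_mono dual_ball_scale_mono[OF N] ratio)
  have ev: "\<forall>\<^sub>F k in sequentially. v \<in> Uk k" if "v \<in> U" for v
    using interior_dual_ball_eventually_scale[OF N] that by (simp add: U_def Uk_def)
  have Uks: "Uk k \<in> sets lebesgue" for k
    using interior_dual_ball_lmeasurable[OF norm_fun_scale[OF N ratio(1)]] by (auto simp: Uk_def)
  have Nc: "(\<lambda>v. N (?c v)) integrable_on U"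
  proof (rule conjunct1[OF monotone_convergence_increasing])
    let ?f = "\<lambda>k v. if v \<in> Uk k then N (?c v) else 0"
    have ak: "(\<lambda>v. N (?c v)) absolutely_integrable_on Uk k" for k
      unfolding Uk_def by (rule conj_point_mass_bound(1)[OF ratio(1,2)])
    show "?f k integrable_on U" for k using ak[of k] integral_restrict_subset(2)[OF sub, of k "\<lambda>v. N (?c v)"] by (simp add: absolutely_integrable_on_def)
    show "?f k v \<le> ?f (Suc k) v" for k v using mono[of k] norm_funD(1)[OF N] by auto
    show "(\<lambda>k. ?f k v) \<longlonglongrightarrow> N (?c v)" if "v \<in> U" for v
      by (rule tendsto_eventually, rule eventually_mono[OF ev[OF that]]) simp
    have "\<bar>integral U (?f k)\<bar> \<le> W 0 * measure lebesgue U + real DIM('a) * integral U ?F" for k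
      using conj_point_mass_bound(2)[OF ratio(1,2), of k] integral_restrict_subset(1)[OF sub, of k "\<lambda>v. N (?c v)"]
        integral_nonneg[of "\<lambda>v. N (?c v)" "Uk k"] ak[of k] norm_funD(1)[OF N]
      by (simp add: U_def Uk_def absolutely_integrable_on_def)
    then show "bounded (range (\<lambda>k. integral U (?f k)))" unfolding bounded_iff by auto
  qed
  obtain C where C: "C > 0" "\<And>x. C * norm x \<le> N x" using norm_fun_lower[OF N] by blast
  have "?c absolutely_integrable_on U"
  proof (rule dominated_convergence_absolutely_integrable)
    have "?c absolutely_integrable_on Uk k" for k
      by (rule set_integrable_subset[OF conj_point_absolutely_integrable_scaled[OF N W ratio(1,2)[of k]] Uks])
         (simp add: Uk_def interior_subset)
    then show "(\<lambda>v. if v \<in> Uk k then ?c v else 0) absolutely_integrable_on U" for k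
      by (simp only: integral_restrict_subset(2)[OF sub])
    show "(\<lambda>v. (1 / C) * N (?c v)) integrable_on U" by (rule integrable_on_mult_right[OF Nc])
    show "norm (?c v) \<le> (1 / C) * N (?c v)" for v using C(1) C(2)[of "?c v"] by (simp add: field_simps)
    show "(\<lambda>k. if v \<in> Uk k then ?c v else 0) \<longlonglongrightarrow> ?c v" if "v \<in> U" for v
      by (rule tendsto_eventually, rule eventually_mono[OF ev[OF that]]) simp
  qed
  then show ?thesis by (simp add: U_def)
qed

lemma inner_conj_point_absolutely_integrable:
  "(\<lambda>v. (v - y) \<bullet> conj_point W v) absolutely_integrable_on interior (dual_ball N)"
proof -
  let ?c = "conj_point W" and ?U = "interior (dual_ball N)"
  obtain R where R: "\<And>v. v \<in> dual_ball N \<Longrightarrow> norm v \<le> R"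
    using compact_imp_bounded[OF dual_ball_compact[OF N]] unfolding bounded_iff by blast
  show ?thesis
  proof (rule measurable_bounded_by_integrable_imp_absolutely_integrable)
    show Us: "?U \<in> sets lebesgue" using interior_dual_ball_lmeasurable[OF N] by auto
    have [measurable]: "?c \<in> borel_measurable (lebesgue_on ?U)"
      using conj_point_absolutely_integrable absolutely_integrable_measurable[OF Us] by blast
    have [measurable]: "(\<lambda>v. v - y) \<in> borel_measurable (lebesgue_on ?U)"
      by (intro continuous_imp_measurable_on_sets_lebesgue continuous_intros Us)
    show "(\<lambda>v. (v - y) \<bullet> ?c v) \<in> borel_measurable (lebesgue_on ?U)" by measurable
    show "(\<lambda>v. (R + norm y) * norm (?c v)) integrable_on ?U"
      using absolutely_integrable_norm[OF conj_point_absolutely_integrable]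
      by (intro integrable_on_mult_right) (auto simp: absolutely_integrable_on_def o_def)
    show "norm ((v - y) \<bullet> ?c v) \<le> (R + norm y) * norm (?c v)" if "v \<in> ?U" for v
    proof -
      have "norm ((v - y) \<bullet> ?c v) \<le> norm (v - y) * norm (?c v)" using Cauchy_Schwarz_ineq2 by simp
      also have "\<dots> \<le> (R + norm y) * norm (?c v)"
        using R[of v] that interior_subset norm_triangle_ineq4[of v y] by (intro mult_right_mono) force+
      finally show ?thesis .
    qed
  qed
qed

end

section \<open>The Steiner potential\<close>

text \<open>With \<open>- conj_point W v\<close> in the role of the gradient of
  \<open>conj_value W\<close>, the integrand is the divergence of the field
  \<open>conj_value W v *\<^sub>R v\<close>.\<close>

definition steiner_potential :: "('a::euclidean_space \<Rightarrow> real) \<Rightarrow> ('a \<Rightarrow> real) \<Rightarrow> real" where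
  "steiner_potential N W =
     (real DIM('a) * integral (interior (dual_ball N)) (conj_value W)
       - integral (interior (dual_ball N)) (\<lambda>v. v \<bullet> conj_point W v))
       / measure lebesgue (interior (dual_ball N))"

lemma measure_interior_dual_ball_pos:
  fixes N :: "'a::euclidean_space \<Rightarrow> real"
  assumes N: "norm_fun N"
  shows "measure lebesgue (interior (dual_ball N)) > 0"
proof -
  have "\<not> negligible (interior (dual_ball N))"
    using zero_in_interior_dual_ball[OF N] by (intro open_not_negligible) auto
  then show ?thesis
    using negligible_iff_measure0[OF interior_dual_ball_lmeasurable[OF N]]
    by (metis less_eq_real_def measure_nonneg)
qed

lemma affine_contraction_image:
  fixes N :: "'a::euclidean_space \<Rightarrow> real"
  assumes N: "norm_fun N" and y: "y \<in> dual_ball N" and r: "0 < r" "r \<le> 1"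
  defines "U \<equiv> interior (dual_ball N)"
  shows "(\<lambda>v. (1 - r) *\<^sub>R y + r *\<^sub>R v) ` U \<subseteq> U" and "open ((\<lambda>v. (1 - r) *\<^sub>R y + r *\<^sub>R v) ` U)"
proof -
  show "(\<lambda>v. (1 - r) *\<^sub>R y + r *\<^sub>R v) ` U \<subseteq> U"
    using interior_dual_ball_shrink[OF N _ y r] by (auto simp: U_def algebra_simps)
  have "(\<lambda>v. (1 - r) *\<^sub>R y + r *\<^sub>R v) ` U = (+) ((1 - r) *\<^sub>R y) ` (\<lambda>v. r *\<^sub>R v) ` U" by (simp add: image_image)
  then show "open ((\<lambda>v. (1 - r) *\<^sub>R y + r *\<^sub>R v) ` U)"
    using r by (auto simp: U_def intro!: open_translation open_scaling)
qed

context
  fixes N W :: "'a::euclidean_space \<Rightarrow> real"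
  assumes N: "norm_fun N" and W: "dominates W N"
begin

text \<open>The exponent \<open>Suc DIM('a)\<close> combines the Jacobian of the contraction with
  one more factor \<open>r\<close> from shrinking \<open>v - y\<close>.\<close>

lemma contracted_inner_conj_point:
  assumes y: "y \<in> dual_ball N" and r: "0 < r" "r < 1"
  defines "U \<equiv> interior (dual_ball N)"
  shows "(\<lambda>v. (v - y) \<bullet> conj_point W ((1 - r) *\<^sub>R y + r *\<^sub>R v)) absolutely_integrable_on U"
    and "integral U (\<lambda>v. (v - y) \<bullet> conj_point W ((1 - r) *\<^sub>R y + r *\<^sub>R v))
      = (1 / r ^ Suc DIM('a)) * integral ((\<lambda>v. (1 - r) *\<^sub>R y + r *\<^sub>R v) ` U) (\<lambda>u. (u - y) \<bullet> conj_point W u)"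
proof -
  let ?T = "\<lambda>v. (1 - r) *\<^sub>R y + r *\<^sub>R v"
  let ?g = "\<lambda>u. (u - y) \<bullet> conj_point W u"
  have TU: "?T ` U \<subseteq> U" "open (?T ` U)" using affine_contraction_image[OF N y, of r] r by (auto simp: U_def)
  have "?g absolutely_integrable_on ?T ` U"
    by (rule set_integrable_subset[OF inner_conj_point_absolutely_integrable[OF N W, of y, folded U_def] _ TU(1)])
       (use TU(2) in auto)
  note a = absolutely_integrable_affine[OF r(1) this]
  have eq: "?g (?T v) = r * ((v - y) \<bullet> conj_point W (?T v))" for v
    by (simp add: algebra_simps)
  have "(\<lambda>v. (1 / r) *\<^sub>R ?g (?T v)) absolutely_integrable_on U" using a(1) by (intro absolutely_integrable_scaleR_left)
  then show i: "(\<lambda>v. (v - y) \<bullet> conj_point W (?T v)) absolutely_integrable_on U"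
    unfolding eq using r by simp
  show "integral U (\<lambda>v. (v - y) \<bullet> conj_point W (?T v)) = (1 / r ^ Suc DIM('a)) * integral (?T ` U) ?g"
    using a(2) r unfolding eq by (simp add: field_simps)
qed

text \<open>An arbitrary selection need not be continuous, so the limit cannot be taken inside the
  integrand. The substitution moves the parameter into the domain, and the contracted copies exhaust
  \<open>U\<close>.\<close>

lemma contracted_inner_conj_point_tendsto:
  assumes y: "y \<in> dual_ball N"
  defines "U \<equiv> interior (dual_ball N)"
  shows "(\<lambda>k. integral U (\<lambda>v. (v - y) \<bullet> conj_point W ((1 - ratio k) *\<^sub>R y + ratio k *\<^sub>R v)))
      \<longlonglongrightarrow> integral U (\<lambda>v. (v - y) \<bullet> conj_point W v)"
proof -
  let ?g = "\<lambda>u. (u - y) \<bullet> conj_point W u"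
  define V where "V k = (\<lambda>v. (1 - ratio k) *\<^sub>R y + ratio k *\<^sub>R v) ` U" for k
  have V: "V k \<subseteq> U" "open (V k)" for k
    using affine_contraction_image[OF N y, of "ratio k"] ratio[of k] by (auto simp: U_def V_def)
  have g: "?g absolutely_integrable_on U" unfolding U_def by (rule inner_conj_point_absolutely_integrable[OF N W])
  have "(\<lambda>k. integral (V k) ?g) \<longlonglongrightarrow> integral U ?g"
  proof (rule integral_open_exhaustion[OF g V])
    fix u assume u: "u \<in> U"
    \<comment> \<open>The preimage of \<open>u\<close> under the contraction tends to
      \<open>u\<close>, hence eventually lies in the open set \<open>U\<close>.\<close>
    have "(\<lambda>k. y + (1 / ratio k) *\<^sub>R (u - y)) \<longlonglongrightarrow> y + (1 / 1) *\<^sub>R (u - y)"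
      by (intro tendsto_intros ratio_lim) simp
    then have "\<forall>\<^sub>F k in sequentially. y + (1 / ratio k) *\<^sub>R (u - y) \<in> U"
      using topological_tendstoD[of _ u sequentially U] u by (simp add: U_def)
    then show "\<forall>\<^sub>F k in sequentially. u \<in> V k"
    proof (rule eventually_mono)
      fix k assume "y + (1 / ratio k) *\<^sub>R (u - y) \<in> U"
      moreover have "u = (1 - ratio k) *\<^sub>R y + ratio k *\<^sub>R (y + (1 / ratio k) *\<^sub>R (u - y))"
        using ratio(1)[of k] by (simp add: algebra_simps)
      ultimately show "u \<in> V k" unfolding V_def by blast
    qed
  qed
  then have "(\<lambda>k. (1 / ratio k ^ Suc DIM('a)) * integral (V k) ?g) \<longlonglongrightarrow> (1 / 1 ^ Suc DIM('a)) * integral U ?g"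
    by (intro tendsto_intros ratio_lim) auto
  then show ?thesis
    using contracted_inner_conj_point(2)[OF y ratio(1,2), folded U_def] by (simp add: V_def)
qed

lemma contracted_conj_value:
  assumes y: "y \<in> dual_ball N" and r: "0 < r" "r < 1"
  defines "U \<equiv> interior (dual_ball N)"
  shows "(\<lambda>v. conj_value W ((1 - r) *\<^sub>R y + r *\<^sub>R v)) absolutely_integrable_on U"
    and "r ^ DIM('a) * integral U (\<lambda>v. conj_value W ((1 - r) *\<^sub>R y + r *\<^sub>R v))
      = integral ((\<lambda>v. (1 - r) *\<^sub>R y + r *\<^sub>R v) ` U) (conj_value W)"
proof -
  let ?T = "\<lambda>v. (1 - r) *\<^sub>R y + r *\<^sub>R v"
  have TU: "?T ` U \<subseteq> U" "open (?T ` U)" using affine_contraction_image[OF N y, of r] r by (auto simp: U_def)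
  have "conj_value W absolutely_integrable_on ?T ` U"
    by (rule set_integrable_subset[OF conj_value_absolutely_integrable[OF N W, folded U_def] _ TU(1)])
       (use TU(2) in auto)
  note a = absolutely_integrable_affine[OF r(1) this]
  show "(\<lambda>v. conj_value W (?T v)) absolutely_integrable_on U" by (rule a(1))
  show "r ^ DIM('a) * integral U (\<lambda>v. conj_value W (?T v)) = integral (?T ` U) (conj_value W)"
    using a(2) by simp
qed

lemma inner_conj_point_integrable: "(\<lambda>v. v \<bullet> conj_point W v) integrable_on interior (dual_ball N)"
  using inner_conj_point_absolutely_integrable[OF N W, of 0] by (simp add: absolutely_integrable_on_def)

lemma conj_value_integrable: "conj_value W integrable_on interior (dual_ball N)"
  using conj_value_absolutely_integrable[OF N W] by (simp add: absolutely_integrable_on_def)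

lemma inner_absolutely_integrable: "(\<lambda>v. v \<bullet> x) absolutely_integrable_on interior (dual_ball N)"
proof -
  have "integrable lebesgue (\<lambda>v. indicator (dual_ball N) v *\<^sub>R (v \<bullet> x))"
    using borel_integrable_compact[OF dual_ball_compact[OF N], of "\<lambda>v. v \<bullet> x"]
    by (simp add: integrable_completion continuous_on_inner)
  then have "(\<lambda>v. v \<bullet> x) absolutely_integrable_on dual_ball N" unfolding set_integrable_def .
  then show ?thesis by (rule set_integrable_subset) (auto simp: interior_subset)
qed

lemma integral_inner_eq_0: "integral (interior (dual_ball N)) (\<lambda>v. v \<bullet> x) = 0"
proof -
  have "- v \<in> interior (dual_ball N)" if "v \<in> interior (dual_ball N)" for v
  proof -
    obtain r where r: "0 < r" "r < 1" "\<And>w. v \<bullet> w \<le> r * N w"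
      using \<open>v \<in> interior (dual_ball N)\<close> unfolding interior_dual_ball_iff[OF N] by blast
    have "- v \<bullet> w \<le> r * N w" for w using r(3)[of "- w"] by (simp add: norm_fun_minus[OF N])
    then show ?thesis using r(1,2) unfolding interior_dual_ball_iff[OF N] by blast
  qed
  then have "- v \<in> interior (dual_ball N) \<longleftrightarrow> v \<in> interior (dual_ball N)" for v
    by (metis minus_minus)
  from integral_reflect_symmetric[OF inner_absolutely_integrable[of x] this]
  show ?thesis by (simp add: integral_neg)
qed

text \<open>Testing every minimum with the same point \<open>x\<close> leaves a linear term, whose
  mean over the symmetric ball is zero.\<close>

lemma integral_conj_value_le:
  "integral (interior (dual_ball N)) (conj_value W) \<le> measure lebesgue (interior (dual_ball N)) * W x"
proof -
  let ?U = "interior (dual_ball N)"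
  have U: "?U \<in> lmeasurable" by (rule interior_dual_ball_lmeasurable[OF N])
  have i: "(\<lambda>v. v \<bullet> x) integrable_on ?U" using inner_absolutely_integrable by (simp add: absolutely_integrable_on_def)
  have "integral ?U (conj_value W) \<le> integral ?U (\<lambda>v. W x - v \<bullet> x)"
    by (rule integral_le[OF conj_value_integrable integrable_diff[OF integrable_on_const[OF U] i] conj_value_le[OF N W]])
  also have "\<dots> = integral ?U (\<lambda>v. W x) - 0"
    using integral_diff[OF integrable_on_const[OF U] i] integral_inner_eq_0 by simp
  also have "integral ?U (\<lambda>v. W x) = measure lebesgue ?U * W x" by (rule integral_const_lmeasurable[OF U])
  finally show ?thesis by simp
qed

text \<open>The subtracted integral is nonnegative: monotonicity compares
  \<open>conj_point W v\<close> with \<open>conj_point W 0\<close>, and the pairing with that fixed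
  point has mean zero.\<close>

lemma steiner_potential_le: "steiner_potential N W \<le> real DIM('a) * W x"
proof -
  let ?U = "interior (dual_ball N)"
  have i: "(\<lambda>v. v \<bullet> conj_point W 0) integrable_on ?U"
    using inner_absolutely_integrable by (simp add: absolutely_integrable_on_def)
  have "integral ?U (\<lambda>v. v \<bullet> conj_point W 0) \<le> integral ?U (\<lambda>v. v \<bullet> conj_point W v)"
  proof (rule integral_le[OF i inner_conj_point_integrable])
    fix v assume "v \<in> ?U"
    then show "v \<bullet> conj_point W 0 \<le> v \<bullet> conj_point W v"
      using inner_conj_point_mono[OF N W, of v 0] zero_in_interior_dual_ball[OF N] by simp
  qed
  then have "integral ?U (\<lambda>v. v \<bullet> conj_point W v) \<ge> 0" by (simp add: integral_inner_eq_0)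
  moreover have "real DIM('a) * integral ?U (conj_value W) \<le> real DIM('a) * (measure lebesgue ?U * W x)"
    using integral_conj_value_le[of x] by (intro mult_left_mono) auto
  ultimately have "real DIM('a) * integral ?U (conj_value W) - integral ?U (\<lambda>v. v \<bullet> conj_point W v)
      \<le> (real DIM('a) * W x) * measure lebesgue ?U"
    by (simp only: mult_ac)
  then show ?thesis
    unfolding steiner_potential_def by (simp only: pos_divide_le_eq[OF measure_interior_dual_ball_pos[OF N]])
qed

end

lemma set_integral_dual_ball:
  fixes N :: "'a::euclidean_space \<Rightarrow> real" and g :: "'a \<Rightarrow> 'b::euclidean_space"
  assumes N: "norm_fun N" and g: "g absolutely_integrable_on interior (dual_ball N)"
  shows "(LINT v:dual_ball N|lebesgue. g v) = integral (interior (dual_ball N)) g"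
proof -
  have "negligible {x \<in> interior (dual_ball N) - dual_ball N. g x \<noteq> 0}"
    "negligible {x \<in> dual_ball N - interior (dual_ball N). g x \<noteq> 0}"
    using interior_subset[of "dual_ball N"]
    by (auto intro: negligible_subset[OF negligible_frontier_dual_ball[OF N]])
  then have "g absolutely_integrable_on dual_ball N" "integral (dual_ball N) g = integral (interior (dual_ball N)) g"
    using absolutely_integrable_spike_set[OF g] integral_spike_set[of "dual_ball N" "interior (dual_ball N)" g] by auto
  then show ?thesis using set_lebesgue_integral_eq_integral(2) by metis
qed

text \<open>On the boundary a minimum may fail to exist and \<open>conj_point\<close> is then an
  unspecified value, but the boundary of a convex set is negligible.\<close>

lemma functional_steiner_eq:
  fixes N :: "'a::euclidean_space \<Rightarrow> real"
  assumes N: "norm_fun N" and W: "dominates W N"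
  shows "functional_steiner N W = (1 / measure lebesgue (interior (dual_ball N))) *\<^sub>R
    integral (interior (dual_ball N)) (conj_point W)"
proof -
  have "measure lebesgue (dual_ball N) = measure lebesgue (interior (dual_ball N))"
  proof -
    have "negligible (sym_diff (dual_ball N) (interior (dual_ball N)))"
      by (rule negligible_subset[OF negligible_frontier_dual_ball[OF N]])
        (use interior_subset[of "dual_ball N"] in auto)
    then show ?thesis using measure_negligible_symdiff[OF interior_dual_ball_lmeasurable[OF N]]
      by (metis Un_commute)
  qed
  then show ?thesis
    unfolding functional_steiner_def
    using set_integral_dual_ball[OF N conj_point_absolutely_integrable[OF N W]] by simp
qed

section \<open>Movement of the Steiner point against growth of the potential\<close>

context
  fixes N W1 W2 :: "'a::euclidean_space \<Rightarrow> real" and \<eta> :: real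
  assumes N: "norm_fun N" and W1: "dominates W1 N" and W2: "dominates W2 N"
    and le: "\<And>v. v \<in> interior (dual_ball N) \<Longrightarrow> conj_value W1 v \<le> conj_value W2 v + \<eta>"
begin

text \<open>The nonnegative function \<open>g = conj_value W2 - conj_value W1 + \<eta>\<close> has a larger integral over the
  dual ball than over its image under the contraction towards \<open>y\<close>; differentiating at ratio \<open>1\<close>
  gives the divergence theorem for the field \<open>(v - y) g(v)\<close> without a surface measure.\<close>

lemma steiner_potential_dual:
  assumes y: "y \<in> dual_ball N"
  defines "U \<equiv> interior (dual_ball N)"
  shows "y \<bullet> (integral U (conj_point W1) - integral U (conj_point W2))
    \<le> measure lebesgue U * (steiner_potential N W2 - steiner_potential N W1 + real DIM('a) * \<eta>)"
proof -
  let ?c1 = "conj_point W1" and ?c2 = "conj_point W2" and ?F1 = "conj_value W1" and ?F2 = "conj_value W2"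
  let ?d = "DIM('a)"
  have Ul: "U \<in> lmeasurable" unfolding U_def by (rule interior_dual_ball_lmeasurable[OF N])
  define vol where "vol = measure lebesgue U"
  have vol: "vol > 0" unfolding vol_def U_def by (rule measure_interior_dual_ball_pos[OF N])
  define g where "g v = ?F2 v - ?F1 v + \<eta>" for v
  have Fi: "?F1 absolutely_integrable_on U" "?F2 absolutely_integrable_on U"
    unfolding U_def by (intro conj_value_absolutely_integrable[OF N W1] conj_value_absolutely_integrable[OF N W2])+
  have consti: "(\<lambda>_. \<eta>) absolutely_integrable_on U" using Ul by (rule absolutely_integrable_on_const)
  have gi: "g absolutely_integrable_on U" unfolding g_def
    by (intro set_integral_add set_integral_diff Fi consti)
  have g0: "g v \<ge> 0" if "v \<in> U" for v using le[of v] that by (simp add: g_def U_def)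
  define G where "G = integral U g"
  define I1 where "I1 = integral U (\<lambda>v. (v - y) \<bullet> ?c1 v)"
  define J where "J k = integral U (\<lambda>v. (v - y) \<bullet> ?c2 ((1 - ratio k) *\<^sub>R y + ratio k *\<^sub>R v))" for k
  \<comment> \<open>The inequality for one contraction, with the common factor
    \<open>1 - ratio k\<close> already cancelled: \<open>1 - r ^ ?d\<close> leaves the geometric
    sum, whose limit at ratio 1 is the dimension.\<close>
  have key: "0 \<le> (\<Sum>i<?d. ratio k ^ i) * G + ratio k ^ ?d * (I1 - J k)" for k
  proof -
    define r where "r = ratio k"
    have r: "0 < r" "r < 1" using ratio by (auto simp: r_def)
    let ?T = "\<lambda>v. (1 - r) *\<^sub>R y + r *\<^sub>R v"
    have TU: "?T ` U \<subseteq> U" "open (?T ` U)" using affine_contraction_image[OF N y, of r] r by (auto simp: U_def)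
    have gT: "g absolutely_integrable_on ?T ` U"
      by (rule set_integrable_subset[OF gi _ TU(1)]) (use TU(2) in auto)
    note a = absolutely_integrable_affine[OF r(1) gT]
    have "integral (?T ` U) g \<le> G" unfolding G_def
      by (rule integral_subset_le[OF TU(1)]) (use gT gi g0 in \<open>auto simp: absolutely_integrable_on_def\<close>)
    then have 1: "r ^ ?d * integral U (\<lambda>v. g (?T v)) \<le> G" using a(2) by simp
    have c2i: "(\<lambda>v. (v - y) \<bullet> ?c2 (?T v)) integrable_on U"
      using contracted_inner_conj_point(1)[OF N W2 y r] by (simp add: U_def absolutely_integrable_on_def)
    have c1i: "(\<lambda>v. (v - y) \<bullet> ?c1 v) integrable_on U"
      using inner_conj_point_absolutely_integrable[OF N W1] by (simp add: U_def absolutely_integrable_on_def)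
    have gis: "g integrable_on U" "(\<lambda>v. g (?T v)) integrable_on U"
      using gi a(1) by (auto simp: absolutely_integrable_on_def)
    have "G - integral U (\<lambda>v. g (?T v)) = integral U (\<lambda>v. g v - g (?T v))"
      unfolding G_def using gis by (simp add: integral_diff)
    also have "\<dots> \<le> integral U (\<lambda>v. (1 - r) * ((v - y) \<bullet> ?c1 v - (v - y) \<bullet> ?c2 (?T v)))"
    proof (rule integral_le)
      show "(\<lambda>v. g v - g (?T v)) integrable_on U" using gis by (rule integrable_diff)
      show "(\<lambda>v. (1 - r) * ((v - y) \<bullet> ?c1 v - (v - y) \<bullet> ?c2 (?T v))) integrable_on U"
        by (intro integrable_on_mult_right integrable_diff c1i c2i)
      fix v assume v: "v \<in> U"
      then have Tv: "?T v \<in> U" using TU(1) by blast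
      \<comment> \<open>Both increments are needed from above, so the supergradient of
        \<open>?F2\<close> is taken at the contracted point and that of \<open>?F1\<close> at
        \<open>v\<close>; this is why \<open>J\<close> involves \<open>?c2\<close> at contracted
        points.\<close>
      have "?F2 v \<le> ?F2 (?T v) - (v - ?T v) \<bullet> ?c2 (?T v)"
        using conj_value_supergradient[OF N W2] v by (simp add: U_def)
      moreover have "?F1 (?T v) \<le> ?F1 v - (?T v - v) \<bullet> ?c1 v"
        using conj_value_supergradient[OF N W1] Tv by (simp add: U_def)
      moreover have "v - ?T v = (1 - r) *\<^sub>R (v - y)" "?T v - v = - ((1 - r) *\<^sub>R (v - y))"
        by (simp_all add: algebra_simps)
      ultimately show "g v - g (?T v) \<le> (1 - r) * ((v - y) \<bullet> ?c1 v - (v - y) \<bullet> ?c2 (?T v))"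
        unfolding g_def by (simp add: right_diff_distrib)
    qed
    also have "\<dots> = (1 - r) * (I1 - J k)"
      using integral_diff[OF c1i c2i] by (simp add: I1_def J_def r_def)
    finally have "r ^ ?d * (G - integral U (\<lambda>v. g (?T v))) \<le> r ^ ?d * ((1 - r) * (I1 - J k))"
      using r by (intro mult_left_mono) auto
    with 1 have "0 \<le> (1 - r ^ ?d) * G + r ^ ?d * ((1 - r) * (I1 - J k))" by (simp add: algebra_simps)
    also have "1 - r ^ ?d = (1 - r) * (\<Sum>i<?d. r ^ i)" by (rule one_diff_power_eq)
    finally have "0 \<le> (1 - r) * ((\<Sum>i<?d. r ^ i) * G + r ^ ?d * (I1 - J k))" by (simp add: algebra_simps)
    then show ?thesis using r by (simp add: zero_le_mult_iff r_def)
  qed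
  have "(\<lambda>k. (\<Sum>i<?d. ratio k ^ i) * G + ratio k ^ ?d * (I1 - J k))
      \<longlonglongrightarrow> (\<Sum>i<?d. 1 ^ i) * G + 1 ^ ?d * (I1 - integral U (\<lambda>v. (v - y) \<bullet> ?c2 v))"
    unfolding J_def by (intro tendsto_intros ratio_lim contracted_inner_conj_point_tendsto[OF N W2 y, folded U_def])
  then have "0 \<le> (\<Sum>i<?d. 1 ^ i) * G + 1 ^ ?d * (I1 - integral U (\<lambda>v. (v - y) \<bullet> ?c2 v))"
    by (rule LIMSEQ_le_const) (use key in auto)
  then have k: "0 \<le> real ?d * G + (I1 - integral U (\<lambda>v. (v - y) \<bullet> ?c2 v))" by simp
  have split: "integral U (\<lambda>v. (v - y) \<bullet> conj_point W v)
      = integral U (\<lambda>v. v \<bullet> conj_point W v) - y \<bullet> integral U (conj_point W)" if W: "dominates W N" for W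
  proof -
    have i: "conj_point W integrable_on U"
      using conj_point_absolutely_integrable[OF N W] by (simp add: U_def absolutely_integrable_on_def)
    have "integral U (\<lambda>v. y \<bullet> conj_point W v) = y \<bullet> integral U (conj_point W)"
      using integral_linear[OF i bounded_linear_inner_right[of y]] by (simp add: o_def)
    moreover have "(\<lambda>v. y \<bullet> conj_point W v) integrable_on U"
      using integrable_linear[OF i bounded_linear_inner_right[of y]] by (simp add: o_def)
    ultimately show ?thesis
      using inner_conj_point_integrable[OF N W] by (simp add: inner_diff_left integral_diff U_def)
  qed
  have Geq: "G = integral U ?F2 - integral U ?F1 + vol * \<eta>"
  proof -
    have "integral U (\<lambda>_. \<eta>) = vol * \<eta>" unfolding vol_def by (rule integral_const_lmeasurable[OF Ul])
    then show ?thesis unfolding G_def g_def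
      using Fi consti by (simp add: integral_add integral_diff absolutely_integrable_on_def integrable_diff)
  qed
  have dG: "real ?d * G = real ?d * integral U ?F2 - real ?d * integral U ?F1 + vol * (real ?d * \<eta>)"
    unfolding Geq by (simp add: algebra_simps)
  have M: "vol * steiner_potential N W = real ?d * integral U (conj_value W) - integral U (\<lambda>v. v \<bullet> conj_point W v)" for W
    using vol by (simp add: steiner_potential_def U_def vol_def)
  have "y \<bullet> (integral U ?c1 - integral U ?c2) \<le> vol * steiner_potential N W2 - vol * steiner_potential N W1 + vol * (real ?d * \<eta>)"
    using k dG M[of W1] M[of W2] unfolding I1_def split[OF W1] split[OF W2] inner_diff_right by linarith
  then show ?thesis unfolding vol_def[symmetric] by (simp only: distrib_left right_diff_distrib)
qed

text \<open>In \<open>steiner_potential_dual\<close> the centre \<open>y\<close> of the contraction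
  doubles as a linear functional. Letting it range over the whole dual ball, boundary included,
  recovers the norm of the displacement.\<close>

lemma functional_steiner_movement:
  "N (functional_steiner N W1 - functional_steiner N W2)
    \<le> steiner_potential N W2 - steiner_potential N W1 + real DIM('a) * \<eta>"
proof (rule norm_fun_le_dual[OF N])
  let ?U = "interior (dual_ball N)"
  fix y assume y: "y \<in> dual_ball N"
  have vol: "measure lebesgue ?U > 0" by (rule measure_interior_dual_ball_pos[OF N])
  have "y \<bullet> (functional_steiner N W1 - functional_steiner N W2) =
     (y \<bullet> (integral ?U (conj_point W1) - integral ?U (conj_point W2))) / measure lebesgue ?U"
    unfolding functional_steiner_eq[OF N W1] functional_steiner_eq[OF N W2]
    by (simp add: inner_diff_right diff_divide_distrib)
  also have "\<dots> \<le> steiner_potential N W2 - steiner_potential N W1 + real DIM('a) * \<eta>"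
    unfolding pos_divide_le_eq[OF vol] using steiner_potential_dual[OF y] by (simp only: mult.commute)
  finally show "y \<bullet> (functional_steiner N W1 - functional_steiner N W2)
    \<le> steiner_potential N W2 - steiner_potential N W1 + real DIM('a) * \<eta>" .
qed

text \<open>The error \<eta> allows the comparison to run backwards in time: a bound on the growth
  of the conjugate becomes a bound on the growth of the potential.\<close>

lemma steiner_potential_mono: "steiner_potential N W1 \<le> steiner_potential N W2 + real DIM('a) * \<eta>"
  using functional_steiner_movement norm_funD(1)[OF N] by (smt (verit))

end

text \<open>The slack leaves the origin as the only minimiser. This supplies the start of the
  Steiner path and the zero initial values of the potentials.\<close>

lemma conj_point_norm_eq_0:
  fixes N :: "'a::euclidean_space \<Rightarrow> real"
  assumes N: "norm_fun N" and v: "v \<in> interior (dual_ball N)"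
  shows "conj_point N v = 0"
proof -
  have d: "dominates N N" using norm_fun_continuous[OF N] by (simp add: dominates_def)
  obtain r where r: "0 < r" "r < 1" "\<And>w. v \<bullet> w \<le> r * N w"
    using v unfolding interior_dual_ball_iff[OF N] by blast
  have "N (conj_point N v) \<le> v \<bullet> conj_point N v"
    using conj_value_le[OF N d v, of 0] norm_fun_zero[OF N] by (simp add: conj_value_def)
  also have "\<dots> \<le> r * N (conj_point N v)" by (rule r(3))
  finally have "(1 - r) * N (conj_point N v) \<le> 0" by (simp add: algebra_simps)
  then show ?thesis using r norm_funD(1,2)[OF N, of "conj_point N v"] by (simp add: mult_le_0_iff)
qed

section \<open>Limits, averages and semicontinuity of the potential\<close>

lemma integral_scaled_dual_ball_tendsto:
  fixes N :: "'a::euclidean_space \<Rightarrow> real" and g :: "'a \<Rightarrow> 'b::euclidean_space"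
  assumes N: "norm_fun N" and g: "g absolutely_integrable_on interior (dual_ball N)"
  shows "(\<lambda>k. integral (interior (dual_ball (\<lambda>x. ratio k * N x))) g) \<longlonglongrightarrow> integral (interior (dual_ball N)) g"
proof (rule integral_open_exhaustion[OF g])
  show "interior (dual_ball (\<lambda>x. ratio k * N x)) \<subseteq> interior (dual_ball N)" for k
    using dual_ball_scale_subset[OF N ratio(1,2), of k] interior_subset by blast
qed (use interior_dual_ball_eventually_scale[OF N] in auto)

lemma dominates_scale:
  assumes "norm_fun N" "dominates W N" "\<rho> \<le> 1"
  shows "dominates W (\<lambda>x. \<rho> * N x)"
  using assms mult_left_le_one_le norm_funD(1)[OF assms(1)] unfolding dominates_def
  by (metis mult_right_mono mult_1 order_trans)

lemma functional_steiner_scaled_tendsto: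
  fixes N :: "'a::euclidean_space \<Rightarrow> real"
  assumes N: "norm_fun N" and W: "dominates W N"
  shows "(\<lambda>k. functional_steiner (\<lambda>x. ratio k * N x) W) \<longlonglongrightarrow> functional_steiner N W"
proof -
  have Nk: "norm_fun (\<lambda>x. ratio k * N x)" for k by (rule norm_fun_scale[OF N ratio(1)])
  have Wk: "dominates W (\<lambda>x. ratio k * N x)" for k
    using dominates_scale[OF N W] ratio(2)[of k] by simp
  have m: "measure lebesgue (interior (dual_ball N)) = integral (interior (dual_ball N)) (\<lambda>_. 1)"
    if "norm_fun N" for N :: "'a \<Rightarrow> real"
    using integral_const_lmeasurable[OF interior_dual_ball_lmeasurable[OF that], of 1] by simp
  have "(\<lambda>k. (1 / measure lebesgue (interior (dual_ball (\<lambda>x. ratio k * N x)))) *\<^sub>R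
      integral (interior (dual_ball (\<lambda>x. ratio k * N x))) (conj_point W))
    \<longlonglongrightarrow> (1 / measure lebesgue (interior (dual_ball N))) *\<^sub>R integral (interior (dual_ball N)) (conj_point W)"
    unfolding m[OF N] m[OF Nk]
  proof (intro tendsto_intros integral_scaled_dual_ball_tendsto N)
    show "conj_point W absolutely_integrable_on interior (dual_ball N)"
      by (rule conj_point_absolutely_integrable[OF N W])
    show "(\<lambda>_. 1::real) absolutely_integrable_on interior (dual_ball N)"
      using interior_dual_ball_lmeasurable[OF N] by (rule absolutely_integrable_on_const)
    show "integral (interior (dual_ball N)) (\<lambda>_. 1::real) \<noteq> 0"
      using measure_interior_dual_ball_pos[OF N] by (simp add: m[OF N])
  qed
  then show ?thesis by (simp only: functional_steiner_eq[OF N W] functional_steiner_eq[OF Nk Wk])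
qed

text \<open>A functional strictly separating the average from the set would contradict its own
  integral. Both Jensen's inequality and the feasibility of Steiner points for bodies rest on
  this.\<close>

lemma integral_average_in_convex:
  fixes g :: "'a::euclidean_space \<Rightarrow> 'b::euclidean_space"
  assumes U: "U \<in> lmeasurable" "measure lebesgue U > 0" and g: "g integrable_on U"
    and S: "convex S" "closed S" "\<And>v. v \<in> U \<Longrightarrow> g v \<in> S"
  shows "(1 / measure lebesgue U) *\<^sub>R integral U g \<in> S"
proof (rule ccontr)
  let ?m = "measure lebesgue U"
  assume "\<not> ?thesis"
  then obtain a b where ab: "a \<bullet> ((1 / ?m) *\<^sub>R integral U g) < b" "\<forall>x\<in>S. b < a \<bullet> x"
    using separating_hyperplane_closed_point[OF S(1,2)] by blast
  have ia: "integral U (\<lambda>v. a \<bullet> g v) = a \<bullet> integral U g"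
    using integral_linear[OF g bounded_linear_inner_right[of a]] by (simp add: o_def)
  have "integral U (\<lambda>_. b) \<le> integral U (\<lambda>v. a \<bullet> g v)"
  proof (rule integral_le)
    show "(\<lambda>v. a \<bullet> g v) integrable_on U"
      using integrable_linear[OF g bounded_linear_inner_right[of a]] by (simp add: o_def)
    show "b \<le> a \<bullet> g v" if "v \<in> U" for v using ab(2) S(3)[OF that] by (simp add: less_imp_le)
  qed (rule integrable_on_const[OF U(1)])
  moreover have "integral U (\<lambda>_. b) = ?m * b" by (rule integral_const_lmeasurable[OF U(1)])
  ultimately have "b \<le> (a \<bullet> integral U g) / ?m" using U(2) by (simp add: pos_le_divide_eq mult.commute ia)
  then show False using ab(1) by simp
qed

text \<open>The average of points of the graph lies in the epigraph, a closed convex subset of the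
  product space.\<close>

lemma integral_average_jensen:
  fixes g :: "'a::euclidean_space \<Rightarrow> 'b::euclidean_space"
  assumes U: "U \<in> lmeasurable" "measure lebesgue U > 0" and g: "g integrable_on U"
    and f: "convex_on UNIV f" and fg: "(\<lambda>v. f (g v)) integrable_on U"
  shows "f ((1 / measure lebesgue U) *\<^sub>R integral U g) \<le> (1 / measure lebesgue U) * integral U (\<lambda>v. f (g v))"
proof -
  have cont: "continuous_on UNIV f" using convex_on_continuous[OF open_UNIV f] .
  have ig: "((\<lambda>v. (g v, f (g v))) has_integral (integral U g, integral U (\<lambda>v. f (g v)))) U"
    using has_integral_add[OF
        has_integral_linear[OF integrable_integral[OF g] bounded_linear_Pair[OF bounded_linear_ident bounded_linear_zero]]
        has_integral_linear[OF integrable_integral[OF fg] bounded_linear_Pair[OF bounded_linear_zero bounded_linear_ident]]]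
    by (simp add: o_def)
  have "(1 / measure lebesgue U) *\<^sub>R integral U (\<lambda>v. (g v, f (g v))) \<in> epigraph UNIV f"
  proof (rule integral_average_in_convex[OF U])
    show "(\<lambda>v. (g v, f (g v))) integrable_on U" using ig by (rule has_integral_integrable)
    show "convex (epigraph UNIV f)" using f convex_epigraph by blast
    have "closed {z. f (fst z) \<le> snd z}"
      by (intro closed_Collect_le continuous_on_compose2[OF cont] continuous_intros) auto
    then show "closed (epigraph UNIV f)" by (simp add: epigraph_def case_prod_unfold)
  qed (simp add: epigraph_def)
  then show ?thesis by (simp add: integral_unique[OF ig] epigraph_def)
qed

text \<open>The potential involves minimisers, while only the conjugates converge.
  \<open>Q k\<close> replaces the radial derivative by a difference quotient of the conjugate: it
  bounds \<open>vol\<close> times the potential from above by concavity, it passes to the limit, and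
  for the limit function it exceeds that multiple by little once \<open>k\<close> is large.\<close>

lemma steiner_potential_upper_limit:
  fixes N W :: "'a::euclidean_space \<Rightarrow> real" and Wn :: "nat \<Rightarrow> 'a \<Rightarrow> real"
  assumes N: "norm_fun N" and W: "dominates W N" and Wn: "\<And>n. dominates (Wn n) N"
    and bound: "\<And>n. Wn n 0 \<le> C"
    and lim: "\<And>v. v \<in> interior (dual_ball N) \<Longrightarrow> (\<lambda>n. conj_value (Wn n) v) \<longlonglongrightarrow> conj_value W v"
    and e: "e > 0"
  shows "\<forall>\<^sub>F n in sequentially. steiner_potential N (Wn n) < steiner_potential N W + e"
proof -
  define U where "U = interior (dual_ball N)"
  define vol where "vol = measure lebesgue U"
  have vol: "vol > 0" unfolding vol_def U_def by (rule measure_interior_dual_ball_pos[OF N])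
  let ?d = "DIM('a)"
  have M: "vol * steiner_potential N W = real ?d * integral U (conj_value W) - integral U (\<lambda>v. v \<bullet> conj_point W v)" for W
    using vol by (simp add: steiner_potential_def U_def vol_def)
  define I where "I k W = integral U (\<lambda>v. conj_value W (ratio k *\<^sub>R v))" for k W
  define Q where "Q k W = real ?d * integral U (conj_value W) + (integral U (conj_value W) - I k W) / (1 - ratio k)" for k W
  have 0: "0 \<in> dual_ball N" using zero_in_interior_dual_ball[OF N] interior_subset by blast
  have Fr: "(\<lambda>v. conj_value W (ratio k *\<^sub>R v)) integrable_on U" if "dominates W N" for k W
    using contracted_conj_value(1)[OF N that 0 ratio(1,2)[of k]] by (simp add: U_def absolutely_integrable_on_def)
  have Fi: "conj_value W integrable_on U" if "dominates W N" for W
    using conj_value_integrable[OF N that] by (simp add: U_def)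
  have ci: "(\<lambda>v. v \<bullet> conj_point W v) integrable_on U" if "dominates W N" for W
    using inner_conj_point_integrable[OF N that] by (simp add: U_def)
  have cri: "(\<lambda>v. v \<bullet> conj_point W (ratio k *\<^sub>R v)) integrable_on U" if "dominates W N" for k W
    using contracted_inner_conj_point(1)[OF N that 0 ratio(1,2)[of k]] by (simp add: U_def absolutely_integrable_on_def)
  have rU: "ratio k *\<^sub>R v \<in> U" if "v \<in> U" for k v
    using interior_dual_ball_shrink[OF N _ 0, of v "ratio k"] that ratio[of k] by (simp add: U_def)
  have MQ: "vol * steiner_potential N W \<le> Q k W" if W: "dominates W N" for k W
  proof -
    have "- integral U (\<lambda>v. v \<bullet> conj_point W v) = integral U (\<lambda>v. - (v \<bullet> conj_point W v))" by (simp add: integral_neg)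
    also have "\<dots> \<le> integral U (\<lambda>v. 1 / (1 - ratio k) * (conj_value W v - conj_value W (ratio k *\<^sub>R v)))"
    proof (rule integral_le)
      fix v assume v: "v \<in> U"
      have "conj_value W (ratio k *\<^sub>R v) \<le> conj_value W v - (ratio k *\<^sub>R v - v) \<bullet> conj_point W v"
        using conj_value_supergradient[OF N W] rU[OF v] by (simp add: U_def)
      then have "- (v \<bullet> conj_point W v) * (1 - ratio k) \<le> conj_value W v - conj_value W (ratio k *\<^sub>R v)"
        by (simp add: algebra_simps)
      then show "- (v \<bullet> conj_point W v) \<le> 1 / (1 - ratio k) * (conj_value W v - conj_value W (ratio k *\<^sub>R v))"
        using ratio(2)[of k] by (simp add: pos_le_divide_eq)
    qed (intro integrable_on_mult_right integrable_diff integrable_neg Fi Fr ci W)+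
    also have "\<dots> = (integral U (conj_value W) - I k W) / (1 - ratio k)"
      using integral_diff[OF Fi[OF W] Fr[OF W, of k]] integral_mult_right[of U "1 / (1 - ratio k)"]
      by (simp add: I_def)
    finally show ?thesis by (simp add: M Q_def)
  qed
  have QM: "Q k W \<le> vol * steiner_potential N W + (integral U (\<lambda>v. v \<bullet> conj_point W v)
      - integral U (\<lambda>v. v \<bullet> conj_point W (ratio k *\<^sub>R v)))" for k
  proof -
    have "(integral U (conj_value W) - I k W) / (1 - ratio k)
      = integral U (\<lambda>v. 1 / (1 - ratio k) * (conj_value W v - conj_value W (ratio k *\<^sub>R v)))"
      using integral_diff[OF Fi[OF W] Fr[OF W, of k]] integral_mult_right[of U "1 / (1 - ratio k)"]
      by (simp add: I_def)
    also have "\<dots> \<le> integral U (\<lambda>v. - (v \<bullet> conj_point W (ratio k *\<^sub>R v)))"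
    proof (rule integral_le)
      fix v assume v: "v \<in> U"
      have "conj_value W v \<le> conj_value W (ratio k *\<^sub>R v) - (v - ratio k *\<^sub>R v) \<bullet> conj_point W (ratio k *\<^sub>R v)"
        using conj_value_supergradient[OF N W] v by (simp add: U_def)
      then have "conj_value W v - conj_value W (ratio k *\<^sub>R v) \<le> - (v \<bullet> conj_point W (ratio k *\<^sub>R v)) * (1 - ratio k)"
        by (simp add: algebra_simps)
      then show "1 / (1 - ratio k) * (conj_value W v - conj_value W (ratio k *\<^sub>R v)) \<le> - (v \<bullet> conj_point W (ratio k *\<^sub>R v))"
        using ratio(2)[of k] by (simp add: pos_divide_le_eq)
    qed (intro integrable_on_mult_right integrable_diff integrable_neg Fi Fr cri W)+
    also have "\<dots> = - integral U (\<lambda>v. v \<bullet> conj_point W (ratio k *\<^sub>R v))" by (simp add: integral_neg)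
    finally show ?thesis by (simp add: M Q_def)
  qed
  have "(\<lambda>k. integral U (\<lambda>v. v \<bullet> conj_point W v) - integral U (\<lambda>v. v \<bullet> conj_point W (ratio k *\<^sub>R v)))
      \<longlonglongrightarrow> integral U (\<lambda>v. v \<bullet> conj_point W v) - integral U (\<lambda>v. v \<bullet> conj_point W v)"
    using contracted_inner_conj_point_tendsto[OF N W 0] by (intro tendsto_intros) (simp add: U_def)
  then have "\<forall>\<^sub>F k in sequentially. integral U (\<lambda>v. v \<bullet> conj_point W v)
      - integral U (\<lambda>v. v \<bullet> conj_point W (ratio k *\<^sub>R v)) < vol * e"
    using vol e by (intro order_tendstoD) auto
  then obtain k where "integral U (\<lambda>v. v \<bullet> conj_point W v)
      - integral U (\<lambda>v. v \<bullet> conj_point W (ratio k *\<^sub>R v)) < vol * e"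
    using eventually_happens'[OF sequentially_bot] by blast
  \<comment> \<open>\<open>k\<close> has been fixed using the limit function alone; what remains is
    convergence in \<open>n\<close> of two integrals of conjugates.\<close>
  then have Qk: "Q k W < vol * steiner_potential N W + vol * e" using QM[of k] by linarith
  have const: "(\<lambda>_. C) integrable_on U" using interior_dual_ball_lmeasurable[OF N] by (auto simp: U_def intro: integrable_on_const)
  have Fb: "norm (conj_value (Wn n) v) \<le> C" if "v \<in> U" for n v
    using conj_value_le_zero[OF N Wn, of v n] conj_value_ge[OF N Wn, of v n] bound[of n] that interior_subset
    by (force simp: U_def)
  have "(\<lambda>n. Q k (Wn n)) \<longlonglongrightarrow> Q k W"
    unfolding Q_def I_def
  proof (intro tendsto_intros)
    show "(\<lambda>n. integral U (conj_value (Wn n))) \<longlonglongrightarrow> integral U (conj_value W)"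
      by (rule dominated_convergence(2)[OF Fi[OF Wn] const Fb]) (use lim in \<open>auto simp: U_def\<close>)
    then show "(\<lambda>n. integral U (conj_value (Wn n))) \<longlonglongrightarrow> integral U (conj_value W)" .
    show "(\<lambda>n. integral U (\<lambda>v. conj_value (Wn n) (ratio k *\<^sub>R v))) \<longlonglongrightarrow> integral U (\<lambda>v. conj_value W (ratio k *\<^sub>R v))"
      by (rule dominated_convergence(2)[OF Fr[OF Wn] const Fb]) (use lim rU in \<open>auto simp: U_def\<close>)
    show "1 - ratio k \<noteq> 0" using ratio(2)[of k] by simp
  qed
  from order_tendstoD(2)[OF this Qk]
  show ?thesis
  proof (rule eventually_mono)
    fix n assume "Q k (Wn n) < vol * steiner_potential N W + vol * e"
    with MQ[OF Wn, of n k] have "vol * steiner_potential N (Wn n) < vol * (steiner_potential N W + e)"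
      by (simp add: distrib_left)
    then show "steiner_potential N (Wn n) < steiner_potential N W + e" using vol by simp
  qed
qed

section \<open>Work functions\<close>

lemma norm_fun_integral_le:
  fixes N :: "'b::euclidean_space \<Rightarrow> real" and g :: "'a::euclidean_space \<Rightarrow> 'b"
  assumes N: "norm_fun N" and g: "g integrable_on S" and Ng: "(\<lambda>s. N (g s)) integrable_on S"
  shows "N (integral S g) \<le> integral S (\<lambda>s. N (g s))"
proof (rule norm_fun_le_dual[OF N])
  fix y assume y: "y \<in> dual_ball N"
  have "y \<bullet> integral S g = integral S (\<lambda>s. y \<bullet> g s)"
    using integral_linear[OF g bounded_linear_inner_right[of y]] by (simp add: o_def)
  also have "\<dots> \<le> integral S (\<lambda>s. N (g s))"
  proof (rule integral_le[OF _ Ng])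
    show "(\<lambda>s. y \<bullet> g s) integrable_on S"
      using integrable_linear[OF g bounded_linear_inner_right[of y]] by (simp add: o_def)
  qed (use y dual_ball_iff[OF N] in blast)
  finally show "y \<bullet> integral S g \<le> integral S (\<lambda>s. N (g s))" .
qed

lemma negligible_countable:
  fixes S :: "'a::euclidean_space set"
  assumes "countable S" shows "negligible S"
  using negligible_countable_Union[of "(\<lambda>x. {x}) ` S"] assms by auto

lemma tendsto_of_modulus:
  fixes g :: "'a::topological_space \<Rightarrow> 'b::real_normed_vector" and P :: "'a \<Rightarrow> real"
  assumes P: "(P \<longlongrightarrow> P s) (at s within S)"
    and le: "\<And>t. t \<in> S \<Longrightarrow> norm (g t - g s) \<le> K * \<bar>P t - P s\<bar>"
  shows "(g \<longlongrightarrow> g s) (at s within S)"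
proof (rule LIM_zero_cancel, rule Lim_null_comparison)
  show "\<forall>\<^sub>F t in at s within S. norm (g t - g s) \<le> K * \<bar>P t - P s\<bar>"
    using le by (simp add: eventually_at_filter)
  have "((\<lambda>t. K * \<bar>P t - P s\<bar>) \<longlongrightarrow> K * \<bar>P s - P s\<bar>) (at s within S)"
    by (intro tendsto_intros P)
  then show "((\<lambda>t. K * \<bar>P t - P s\<bar>) \<longlongrightarrow> 0) (at s within S)" by simp
qed

lemma le_mult_cINF:
  fixes g :: "'a \<Rightarrow> real"
  assumes "A \<noteq> {}" "c > 0" "\<And>y. y \<in> A \<Longrightarrow> x \<le> c * g y"
  shows "x \<le> c * (INF y \<in> A. g y)"
proof -
  have "x / c \<le> (INF y \<in> A. g y)"
    using assms by (intro cINF_greatest) (auto simp: pos_divide_le_eq mult.commute)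
  then show ?thesis using assms(2) by (simp add: pos_divide_le_eq mult.commute)
qed

section \<open>Absolutely continuous paths on intervals\<close>

definition segment_path :: "real \<Rightarrow> real \<Rightarrow> (real \<Rightarrow> 'a::euclidean_space) \<Rightarrow> (real \<Rightarrow> 'a) \<Rightarrow> bool" where
  "segment_path a b p p' \<longleftrightarrow>
     p' absolutely_integrable_on {a..b} \<and> (\<forall>s\<in>{a..b}. p s = p a + integral {a..s} p')"

lemma paths_iff_segment: "t \<ge> 0 \<Longrightarrow> (p, p') \<in> paths t \<longleftrightarrow> p 0 = 0 \<and> segment_path 0 t p p'"
  by (auto simp: paths_def segment_path_def)

lemma segment_pathD:
  assumes "segment_path a b p p'"
  shows "p' absolutely_integrable_on {a..b}" "a \<le> s \<Longrightarrow> s \<le> b \<Longrightarrow> p s = p a + integral {a..s} p'"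
  using assms unfolding segment_path_def by (blast, meson atLeastAtMost_iff)

lemma segment_path_integrable: "segment_path a b p p' \<Longrightarrow> p' integrable_on {a..b}"
  by (simp add: segment_path_def absolutely_integrable_on_def)

lemma segment_path_diff:
  assumes p: "segment_path a b p p'" and "a \<le> c" "c \<le> d" "d \<le> b"
  shows "p d = p c + integral {c..d} p'"
proof -
  have i: "p' integrable_on {a..d}"
    by (rule integrable_on_subinterval[OF segment_path_integrable[OF p]]) (use assms in auto)
  have "p d = p a + integral {a..d} p'"
    by (rule segment_pathD(2)[OF p]) (use assms in linarith)+
  also have "\<dots> = (p a + integral {a..c} p') + integral {c..d} p'"
    using Henstock_Kurzweil_Integration.integral_combine[OF assms(2,3) i] by (simp only: add.assoc)
  also have "p a + integral {a..c} p' = p c"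
    by (rule segment_pathD(2)[OF p, symmetric]) (use assms in linarith)+
  finally show ?thesis .
qed

lemma segment_path_sub:
  assumes p: "segment_path a b p p'" and "a \<le> c" "d \<le> b"
  shows "segment_path c d p p'"
  unfolding segment_path_def
proof (intro conjI ballI)
  show "p' absolutely_integrable_on {c..d}"
    by (rule set_integrable_subset[OF segment_pathD(1)[OF p]]) (use assms in auto)
  show "p s = p c + integral {c..s} p'" if "s \<in> {c..d}" for s
    using segment_path_diff[OF p, of c s] assms that by force
qed

lemma segment_path_continuous:
  assumes p: "segment_path a b p p'"
  shows "continuous_on {a..b} p"
proof -
  have "continuous_on {a..b} (\<lambda>s. p a + integral {a..s} p')"
    using segment_path_integrable[OF p] by (intro continuous_intros indefinite_integral_continuous_1)
  then show ?thesis by (rule continuous_on_eq) (simp add: segment_pathD(2)[OF p, symmetric])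
qed

lemma segment_path_join:
  assumes p: "segment_path a b p p'" and r: "segment_path b c r r'" and eq: "p b = r b" and ab: "a \<le> b" "b \<le> c"
  shows "segment_path a c (\<lambda>s. if s \<le> b then p s else r s) (\<lambda>s. if s \<le> b then p' s else r' s)"
proof -
  let ?q = "\<lambda>s. if s \<le> b then p s else r s" and ?q' = "\<lambda>s. if s \<le> b then p' s else r' s"
  have 1: "?q' absolutely_integrable_on {a..b}"
    by (rule absolutely_integrable_spike[where f=p' and S="{}"]) (use segment_pathD(1)[OF p] in auto)
  have 2: "?q' absolutely_integrable_on {b..c}"
    by (rule absolutely_integrable_spike[where f=r' and S="{b}"]) (use segment_pathD(1)[OF r] in auto)
  have "?q' absolutely_integrable_on {a..b} \<union> {b..c}" using 1 2 by (rule absolutely_integrable_Un)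
  then have 3: "?q' absolutely_integrable_on {a..c}" using ab by (simp add: ivl_disj_un_two_touch(4))
  have 4: "integral {a..s} ?q' = integral {a..s} p'" if "s \<le> b" for s
    by (rule integral_cong) (use that in auto)
  have 5: "integral {b..s} ?q' = integral {b..s} r'" for s
    by (rule integral_spike[where S="{b}"]) auto
  have "?q s = ?q a + integral {a..s} ?q'" if s: "s \<in> {a..c}" for s
  proof (cases "s \<le> b")
    case True
    then show ?thesis using 4[OF True] segment_pathD(2)[OF p, of s] s ab by simp
  next
    case False
    have "integral {a..s} ?q' = integral {a..b} ?q' + integral {b..s} ?q'"
    proof (rule Henstock_Kurzweil_Integration.integral_combine[symmetric])
      have "?q' integrable_on {a..c}" using 3 by (simp only: absolutely_integrable_on_def)
      then show "?q' integrable_on {a..s}" by (rule integrable_on_subinterval) (use s in auto)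
    qed (use False s ab in auto)
    also have "\<dots> = integral {a..b} p' + integral {b..s} r'" using 4[of b] 5 by simp
    finally have "p a + integral {a..s} ?q' = (p a + integral {a..b} p') + integral {b..s} r'" by simp
    also have "\<dots> = r b + integral {b..s} r'" using segment_pathD(2)[OF p, of b] eq ab by simp
    also have "\<dots> = r s" using segment_pathD(2)[OF r, of s] False s by simp
    finally show ?thesis using False ab by simp
  qed
  with 3 show ?thesis unfolding segment_path_def by blast
qed

lemma segment_path_linear:
  assumes "a < b"
  shows "segment_path a b (\<lambda>s. x + ((s - a) / (b - a)) *\<^sub>R (y - x)) (\<lambda>_. (1 / (b - a)) *\<^sub>R (y - x))"
  unfolding segment_path_def using assms by (auto intro: absolutely_integrable_on_const)

lemma segment_path_const: "segment_path a b (\<lambda>_. x) (\<lambda>_. 0)"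
  by (simp add: segment_path_def)

section \<open>Convex requests: bounds uniform in time\<close>

locale chasing =
  fixes N :: "'a::euclidean_space \<Rightarrow> real" and f :: "real \<Rightarrow> 'a \<Rightarrow> real" and T :: real
  assumes N: "norm_fun N" and T0: "T \<ge> 0" and req: "convex_requests T f"
begin

lemma f_convex: "t \<in> {0..T} \<Longrightarrow> convex_on UNIV (f t)"
  and f_nonneg: "t \<in> {0..T} \<Longrightarrow> f t x \<ge> 0"
  using req by (auto simp: convex_requests_def)

text \<open>Boundedness in time is assumed point by point only. A cube around the ball is the convex
  hull of finitely many points, and convexity carries a common bound from these to the whole
  cube.\<close>

lemma f_bounded: "\<exists>C>0. \<forall>t\<in>{0..T}. \<forall>x. norm x \<le> R \<longrightarrow> f t x \<le> C"
proof -
  define d where "d = \<bar>R\<bar> + 1"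
  obtain S :: "'a set" where S: "finite S" "cbox (0 - (\<Sum>i\<in>Basis. d *\<^sub>R i)) (0 + (\<Sum>i\<in>Basis. d *\<^sub>R i)) = convex hull S"
    using cube_convex_hull[of d "0::'a"] by (metis add_nonneg_pos abs_ge_zero d_def zero_less_one)
  have "\<forall>x. \<exists>B. \<forall>t\<in>{0..T}. \<bar>f t x\<bar> \<le> B" using req by (auto simp: convex_requests_def bounded_iff)
  then obtain B where B: "\<And>t x. t \<in> {0..T} \<Longrightarrow> \<bar>f t x\<bar> \<le> B x" by metis
  define C where "C = (\<Sum>x\<in>S. \<bar>B x\<bar>) + 1"
  have "C > 0" unfolding C_def by (simp add: add_nonneg_pos sum_nonneg)
  moreover have "f t x \<le> C" if t: "t \<in> {0..T}" and x: "norm x \<le> R" for t x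
  proof -
    have "x \<in> convex hull S"
    proof -
      have "- d \<le> x \<bullet> i \<and> x \<bullet> i \<le> d" if "i \<in> Basis" for i
        using Basis_le_norm[OF that, of x] x by (simp add: d_def abs_le_iff)
      then have "x \<in> cbox (0 - (\<Sum>i\<in>Basis. d *\<^sub>R i)) (0 + (\<Sum>i\<in>Basis. d *\<^sub>R i))"
        by (auto simp: mem_box inner_minus_left inner_sum_left inner_Basis sum.delta if_distrib cong: if_cong)
      then show ?thesis using S(2) by simp
    qed
    moreover have "\<forall>z\<in>S. f t z \<le> C"
    proof
      fix z assume z: "z \<in> S"
      have "f t z \<le> \<bar>B z\<bar>" using B[OF t, of z] by linarith
      also have "\<dots> \<le> (\<Sum>x\<in>S. \<bar>B x\<bar>)" using S(1) z by (intro member_le_sum) auto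
      finally show "f t z \<le> C" by (simp add: C_def)
    qed
    moreover have "convex_on (convex hull S) (f t)"
      using f_convex[OF t] convex_on_subset convex_convex_hull by blast
    ultimately show ?thesis using convex_on_convex_hull_bound by blast
  qed
  ultimately show ?thesis by blast
qed

text \<open>A bound on a slightly larger ball limits the slopes of a nonnegative convex function,
  and \<open>f_bounded\<close> provides one that is independent of time.\<close>

lemma f_lipschitz:
  "\<exists>L>0. \<forall>t\<in>{0..T}. \<forall>x y. norm x \<le> R \<longrightarrow> norm y \<le> R \<longrightarrow> \<bar>f t x - f t y\<bar> \<le> L * norm (x - y)"
proof -
  obtain C where C: "C > 0" "\<And>t x. t \<in> {0..T} \<Longrightarrow> norm x \<le> R + 1 \<Longrightarrow> f t x \<le> C"
    using f_bounded[of "R + 1"] by blast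
  have *: "f t y - f t x \<le> C * norm (x - y)" if t: "t \<in> {0..T}" and "norm x \<le> R" "norm y \<le> R" for t x y
  proof (cases "x = y")
    case False
    define \<delta> where "\<delta> = norm (y - x)"
    have d: "\<delta> > 0" using False by (simp add: \<delta>_def)
    \<comment> \<open>\<open>z\<close> continues the segment from \<open>x\<close> to
      \<open>y\<close> by one unit of length, hence the radius \<open>R + 1\<close> in the choice of
      \<open>C\<close>; convexity between \<open>x\<close> and \<open>z\<close> then bounds the
      increase from \<open>x\<close> to \<open>y\<close>.\<close>
    define z where "z = y + (1 / \<delta>) *\<^sub>R (y - x)"
    have "norm z \<le> norm y + norm ((1 / \<delta>) *\<^sub>R (y - x))" unfolding z_def by (rule norm_triangle_ineq)
    also have "norm ((1 / \<delta>) *\<^sub>R (y - x)) = 1" using d by (simp add: \<delta>_def)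
    finally have z: "f t z \<le> C" using C(2)[OF t, of z] that(3) by simp
    have e: "y = (1 / (1 + \<delta>)) *\<^sub>R x + (\<delta> / (1 + \<delta>)) *\<^sub>R z"
    proof -
      have "(1 + \<delta>) *\<^sub>R y = x + \<delta> *\<^sub>R z" using d by (simp add: z_def algebra_simps)
      then have "(1 / (1 + \<delta>)) *\<^sub>R ((1 + \<delta>) *\<^sub>R y) = (1 / (1 + \<delta>)) *\<^sub>R (x + \<delta> *\<^sub>R z)" by simp
      then show ?thesis using d by (simp add: scaleR_add_right)
    qed
    have w: "1 - \<delta> / (1 + \<delta>) = 1 / (1 + \<delta>)" using d by (simp add: field_simps)
    have "\<delta> / (1 + \<delta>) \<ge> 0" "\<delta> / (1 + \<delta>) \<le> 1" using d by auto
    from convex_onD[OF f_convex[OF t] this, of x z] have "f t y \<le> 1 / (1 + \<delta>) * f t x + \<delta> / (1 + \<delta>) * f t z"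
      unfolding w e[symmetric] by blast
    also have "\<dots> \<le> 1 * f t x + \<delta> * C"
    proof (intro add_mono mult_mono)
      show "1 / (1 + \<delta>) \<le> 1" "\<delta> / (1 + \<delta>) \<le> \<delta>" using d by (auto simp: field_simps)
    qed (use d z f_nonneg[OF t] in auto)
    finally show ?thesis by (simp add: \<delta>_def norm_minus_commute mult.commute)
  qed simp
  show ?thesis
  proof (intro exI[of _ C] conjI C(1) ballI allI impI)
    fix t and x y :: 'a assume "t \<in> {0..T}" "norm x \<le> R" "norm y \<le> R"
    then show "\<bar>f t x - f t y\<bar> \<le> C * norm (x - y)"
      using *[of t x y] *[of t y x] by (simp add: norm_minus_commute abs_le_iff)
  qed
qed

text \<open>Continuity in time at a fixed point and a Lipschitz bound in space uniform in time give
  continuity along \<open>g\<close> off a countable set. The set \<open>E\<close> leaves room for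
  jumps of the Steiner path.\<close>

lemma f_along_integrable:
  fixes g :: "real \<Rightarrow> 'a"
  assumes g: "continuous_on ({a..b} - E) g" and E: "countable E"
    and bnd: "\<And>s. s \<in> {a..b} \<Longrightarrow> norm (g s) \<le> R" and ab: "{a..b} \<subseteq> {0..T}"
  shows "(\<lambda>s. f s (g s)) absolutely_integrable_on {a..b}"
proof -
  obtain D where D: "finite D" "\<And>x. continuous_on ({0..T} - D) (\<lambda>t. f t x)"
    using req unfolding convex_requests_def by blast
  define S where "S = {a..b} - (E \<union> D)"
  have cE: "countable (E \<union> D)" using E D(1) by (simp add: countable_finite)
  obtain L where "L > 0" and L: "\<And>t x y. t \<in> {0..T} \<Longrightarrow> norm x \<le> R \<Longrightarrow> norm y \<le> R \<Longrightarrow> \<bar>f t x - f t y\<bar> \<le> L * norm (x - y)"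
    using f_lipschitz[of R] by blast
  obtain C where C: "C > 0" "\<And>t x. t \<in> {0..T} \<Longrightarrow> norm x \<le> R \<Longrightarrow> f t x \<le> C"
    using f_bounded[of R] by blast
  have "continuous_on S (\<lambda>s. f s (g s))"
    unfolding continuous_on_def
  proof
    fix s0 assume s0: "s0 \<in> S"
    have "continuous_on S (\<lambda>s. f s (g s0))" by (rule continuous_on_subset[OF D(2)]) (use ab in \<open>unfold S_def, blast\<close>)
    then have 1: "((\<lambda>s. f s (g s0)) \<longlongrightarrow> f s0 (g s0)) (at s0 within S)" using s0 by (simp add: continuous_on_def)
    have "continuous_on S g" by (rule continuous_on_subset[OF g]) (auto simp: S_def)
    then have "(g \<longlongrightarrow> g s0) (at s0 within S)" using s0 by (simp add: continuous_on_def)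
    then have "((\<lambda>s. L * norm (g s - g s0)) \<longlongrightarrow> L * norm (g s0 - g s0)) (at s0 within S)" by (intro tendsto_intros)
    then have 2: "((\<lambda>s. L * norm (g s - g s0)) \<longlongrightarrow> 0) (at s0 within S)" by simp
    have "\<forall>\<^sub>F s in at s0 within S. norm (f s (g s) - f s (g s0)) \<le> L * norm (g s - g s0)"
      unfolding eventually_at_filter
    proof (rule always_eventually, intro allI impI)
      fix s assume "s \<in> S"
      then have "s \<in> {a..b}" "s \<in> {0..T}" "s0 \<in> {a..b}" using ab s0 by (auto simp: S_def)
      then show "norm (f s (g s) - f s (g s0)) \<le> L * norm (g s - g s0)"
        using L[of s "g s" "g s0"] bnd by simp
    qed
    then have "((\<lambda>s. f s (g s) - f s (g s0)) \<longlongrightarrow> 0) (at s0 within S)"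
      by (rule Lim_null_comparison[OF _ 2])
    from tendsto_add[OF this 1] show "((\<lambda>s. f s (g s)) \<longlongrightarrow> f s0 (g s0)) (at s0 within S)"
      by (simp only: diff_add_cancel add_0_left)
  qed
  moreover have Sl: "S \<in> lmeasurable"
  proof -
    have "E \<union> D \<in> null_sets lebesgue" using negligible_countable[OF cE] by (simp add: negligible_iff_null_sets)
    then have "E \<union> D \<in> sets lebesgue" by (rule null_setsD2)
    moreover have "{a..b} \<in> lmeasurable" by simp
    ultimately show ?thesis unfolding S_def by (rule fmeasurable_Diff[rotated])
  qed
  ultimately have "(\<lambda>s. f s (g s)) \<in> borel_measurable (lebesgue_on S)"
    by (intro continuous_imp_measurable_on_sets_lebesgue) (auto dest: fmeasurableD)
  then have "(\<lambda>s. f s (g s)) absolutely_integrable_on S"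
  proof (rule measurable_bounded_by_integrable_imp_absolutely_integrable)
    show "(\<lambda>_. C) integrable_on S" using Sl by (rule integrable_on_const)
    show "norm (f s (g s)) \<le> C" if "s \<in> S" for s
    proof -
      have "s \<in> {a..b}" "s \<in> {0..T}" using ab that by (auto simp: S_def)
      then show ?thesis using bnd[of s] C(2)[of s "g s"] f_nonneg[of s "g s"] by simp
    qed
  qed (use fmeasurableD[OF Sl] in simp)
  moreover have "negligible {s \<in> S - {a..b}. f s (g s) \<noteq> 0}"
    by (rule negligible_subset[OF negligible_countable[OF cE]]) (auto simp: S_def)
  moreover have "negligible {s \<in> {a..b} - S. f s (g s) \<noteq> 0}"
    by (rule negligible_subset[OF negligible_countable[OF cE]]) (auto simp: S_def)
  ultimately show ?thesis by (rule absolutely_integrable_spike_set)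
qed

lemma f_const_integrable: "0 \<le> a \<Longrightarrow> b \<le> T \<Longrightarrow> (\<lambda>s. f s x) integrable_on {a..b}"
  using f_along_integrable[of a b "{}" "\<lambda>_. x" "norm x"] by (auto simp: absolutely_integrable_on_def)

text \<open>Two separate integrals, because service and length respond differently to waiting and to
  slowing down; \<open>path_cost_eq\<close> reconnects them with \<open>path_cost\<close>.\<close>

definition seg_cost :: "real \<Rightarrow> real \<Rightarrow> (real \<Rightarrow> 'a) \<Rightarrow> (real \<Rightarrow> 'a) \<Rightarrow> real" where
  "seg_cost a b p p' = integral {a..b} (\<lambda>s. f s (p s)) + integral {a..b} (\<lambda>s. N (p' s))"

lemma segment_integrable:
  assumes p: "segment_path a b p p'" and ab: "0 \<le> a" "b \<le> T"
  shows "(\<lambda>s. f s (p s)) integrable_on {a..b}" "(\<lambda>s. N (p' s)) integrable_on {a..b}"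
proof -
  have "compact (p ` {a..b})" using segment_path_continuous[OF p] by (intro compact_continuous_image) auto
  then obtain R where "\<And>s. s \<in> {a..b} \<Longrightarrow> norm (p s) \<le> R"
    by (metis bounded_iff compact_imp_bounded imageI)
  then show "(\<lambda>s. f s (p s)) integrable_on {a..b}"
    using f_along_integrable[of a b "{}" p R] segment_path_continuous[OF p] ab
    by (auto simp: absolutely_integrable_on_def)
  show "(\<lambda>s. N (p' s)) integrable_on {a..b}"
    using norm_fun_absolutely_integrable[OF N segment_pathD(1)[OF p]]
    by (simp add: absolutely_integrable_on_def)
qed

lemma segment_length:
  assumes p: "segment_path a b p p'" and ab: "0 \<le> a" "b \<le> T" and cd: "a \<le> c" "c \<le> d" "d \<le> b"
  shows "N (p d - p c) \<le> integral {c..d} (\<lambda>s. N (p' s))"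
proof -
  have s: "segment_path c d p p'" using segment_path_sub[OF p] cd by simp
  have "N (integral {c..d} p') \<le> integral {c..d} (\<lambda>s. N (p' s))"
    using segment_integrable(2)[OF s] ab cd by (intro norm_fun_integral_le N segment_path_integrable[OF s]) auto
  then show ?thesis using segment_path_diff[OF p cd] by simp
qed

lemma segment_parts_nonneg:
  assumes p: "segment_path a b p p'" and ab: "0 \<le> a" "b \<le> T"
  shows "integral {a..b} (\<lambda>s. f s (p s)) \<ge> 0" "integral {a..b} (\<lambda>s. N (p' s)) \<ge> 0"
  using segment_integrable[OF p ab] f_nonneg norm_funD(1)[OF N] ab by (auto intro!: integral_nonneg)

lemma seg_cost_nonneg: "segment_path a b p p' \<Longrightarrow> 0 \<le> a \<Longrightarrow> b \<le> T \<Longrightarrow> seg_cost a b p p' \<ge> 0"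
  unfolding seg_cost_def using segment_parts_nonneg[of a b p p'] by simp

lemma seg_cost_combine:
  assumes p: "segment_path a b p p'" and ab: "0 \<le> a" "b \<le> T" and c: "a \<le> c" "c \<le> b"
  shows "seg_cost a b p p' = seg_cost a c p p' + seg_cost c b p p'"
  unfolding seg_cost_def
  using Henstock_Kurzweil_Integration.integral_combine[OF c segment_integrable(1)[OF p ab]]
    Henstock_Kurzweil_Integration.integral_combine[OF c segment_integrable(2)[OF p ab]] by simp

lemma path_cost_eq:
  assumes "segment_path 0 t p p'" "t \<le> T"
  shows "path_cost N f t (p, p') = seg_cost 0 t p p'"
  unfolding path_cost_def seg_cost_def
  using segment_integrable[OF assms(1) order_refl assms(2)] by (simp add: integral_add)

lemma seg_cost_join:
  assumes p: "segment_path a b p p'" and r: "segment_path b c r r'" and eq: "p b = r b"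
    and ab: "0 \<le> a" "a \<le> b" "b \<le> c" "c \<le> T"
  shows "seg_cost a c (\<lambda>s. if s \<le> b then p s else r s) (\<lambda>s. if s \<le> b then p' s else r' s)
    = seg_cost a b p p' + seg_cost b c r r'"
proof -
  let ?q = "\<lambda>s. if s \<le> b then p s else r s" and ?q' = "\<lambda>s. if s \<le> b then p' s else r' s"
  have "seg_cost a c ?q ?q' = seg_cost a b ?q ?q' + seg_cost b c ?q ?q'"
    using seg_cost_combine[OF segment_path_join[OF p r eq]] ab by simp
  moreover have "seg_cost a b ?q ?q' = seg_cost a b p p'"
    unfolding seg_cost_def by (intro arg_cong2[where f="(+)"] integral_cong) auto
  moreover have "seg_cost b c ?q ?q' = seg_cost b c r r'"
    unfolding seg_cost_def by (intro arg_cong2[where f="(+)"] integral_spike[where S="{b}"]) auto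
  ultimately show ?thesis by simp
qed

section \<open>Regularity of the work function\<close>

abbreviation W :: "real \<Rightarrow> 'a \<Rightarrow> real" where "W \<equiv> work_function N f"

lemma work_function_le:
  assumes t: "0 \<le> t" "t \<le> T" and p: "p 0 = 0" "segment_path 0 t p p'"
  shows "W t (p t) \<le> seg_cost 0 t p p'"
proof (cases "t = 0")
  case True
  then show ?thesis using p norm_fun_zero[OF N] by (simp add: work_function_def seg_cost_def)
next
  case False
  have "(INF q \<in> {q \<in> paths t. fst q t = p t}. path_cost N f t q) \<le> path_cost N f t (p, p')"
  proof (rule cINF_lower)
    show "bdd_below (path_cost N f t ` {q \<in> paths t. fst q t = p t})"
    proof (rule bdd_belowI2[of _ 0])
      fix q assume "q \<in> {q \<in> paths t. fst q t = p t}"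
      then obtain r r' where q: "q = (r, r')" "segment_path 0 t r r'"
        using t(1) by (cases q) (auto simp: paths_iff_segment)
      then show "0 \<le> path_cost N f t q" using path_cost_eq[OF q(2) t(2)] seg_cost_nonneg[OF q(2)] t by simp
    qed
    show "(p, p') \<in> {q \<in> paths t. fst q t = p t}" using p t by (simp add: paths_iff_segment)
  qed
  then show ?thesis using False path_cost_eq[OF p(2) t(2)] by (simp add: work_function_def)
qed

lemma work_function_near:
  assumes t: "0 < t" "t \<le> T" and e: "e > 0"
  obtains p p' where "p 0 = 0" "segment_path 0 t p p'" "p t = x" "seg_cost 0 t p p' < W t x + e"
proof -
  have "(\<lambda>s. 0 + ((s - 0) / (t - 0)) *\<^sub>R (x - 0), \<lambda>_. (1 / (t - 0)) *\<^sub>R (x - 0)) \<in> {q \<in> paths t. fst q t = x}"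
    using segment_path_linear[OF t(1), of 0 x] t by (simp add: paths_iff_segment)
  then have ne: "{q \<in> paths t. fst q t = x} \<noteq> {}" by blast
  have "\<exists>q\<in>{q \<in> paths t. fst q t = x}. path_cost N f t q < W t x + e"
  proof (rule ccontr)
    assume "\<not> ?thesis"
    then have "W t x + e \<le> (INF q \<in> {q \<in> paths t. fst q t = x}. path_cost N f t q)"
      by (intro cINF_greatest[OF ne]) (simp only: not_le[symmetric] bex_simps not_not, blast)
    then show False using t e by (simp add: work_function_def)
  qed
  then obtain p p' where p: "(p, p') \<in> paths t" "p t = x" "path_cost N f t (p, p') < W t x + e" by auto
  then show thesis using that[of p p'] t path_cost_eq[of t p p'] by (simp add: paths_iff_segment)
qed

text \<open>Moving to \<open>w\<close> arbitrarily fast after time \<open>u\<close> and waiting there costs the distance plus the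
  requests at \<open>w\<close> in the limit.\<close>

lemma work_function_move:
  assumes ut: "0 \<le> u" "u < t" "t \<le> T" and p: "p 0 = 0" "segment_path 0 u p p'"
  shows "W t w \<le> seg_cost 0 u p p' + N (w - p u) + integral {u..t} (\<lambda>s. f s w)"
proof (rule field_le_epsilon)
  fix e :: real assume e: "e > 0"
  define R where "R = norm (p u) + norm (w - p u)"
  obtain C where C: "C > 0" "\<And>t x. t \<in> {0..T} \<Longrightarrow> norm x \<le> R \<Longrightarrow> f t x \<le> C"
    using f_bounded[of R] by blast
  \<comment> \<open>Short enough that service during the move costs at most \<open>e\<close> and
    that time remains before \<open>t\<close>; \<open>C\<close> bounds the requests on the whole
    segment from \<open>p u\<close> to \<open>w\<close>.\<close>
  define d where "d = min ((t - u) / 2) (e / C)"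
  have d: "d > 0" "u + d < t" "d * C \<le> e"
    using ut e C(1) by (auto simp: d_def min_def field_simps)
  let ?l = "\<lambda>s. p u + ((s - u) / (u + d - u)) *\<^sub>R (w - p u)" and ?l' = "\<lambda>s::real. (1 / (u + d - u)) *\<^sub>R (w - p u)"
  let ?k = "\<lambda>s::real. w" and ?k' = "\<lambda>s::real. 0::'a"
  have l: "segment_path u (u + d) ?l ?l'" using d by (intro segment_path_linear) auto
  have k: "segment_path (u + d) t ?k ?k'" by (rule segment_path_const)
  let ?q = "\<lambda>s. if s \<le> u then p s else ?l s" and ?q' = "\<lambda>s. if s \<le> u then p' s else ?l' s"
  have q: "segment_path 0 (u + d) ?q ?q'"
    using segment_path_join[OF p(2) l] ut d by simp
  have qc: "seg_cost 0 (u + d) ?q ?q' = seg_cost 0 u p p' + seg_cost u (u + d) ?l ?l'"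
    using seg_cost_join[OF p(2) l] ut d by simp
  let ?r = "\<lambda>s. if s \<le> u + d then ?q s else ?k s" and ?r' = "\<lambda>s. if s \<le> u + d then ?q' s else ?k' s"
  have qe: "?q (u + d) = ?k (u + d)" using d by simp
  have r: "segment_path 0 t ?r ?r'" using segment_path_join[OF q k qe] ut d by simp
  have rc: "seg_cost 0 t ?r ?r' = seg_cost 0 (u + d) ?q ?q' + seg_cost (u + d) t ?k ?k'"
    using seg_cost_join[OF q k qe] ut d by simp
  have "W t (?r t) \<le> seg_cost 0 t ?r ?r'"
    by (rule work_function_le) (use r ut d p in auto)
  moreover have "?r t = w" using d by simp
  moreover have "seg_cost u (u + d) ?l ?l' \<le> e + N (w - p u)"
  proof -
    have "integral {u..u + d} (\<lambda>s. f s (?l s)) \<le> integral {u..u + d} (\<lambda>s. C)"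
    proof (rule integral_le)
      show "(\<lambda>s. f s (?l s)) integrable_on {u..u + d}" using segment_integrable(1)[OF l] ut d by simp
      show "f s (?l s) \<le> C" if s: "s \<in> {u..u + d}" for s
      proof (rule C(2))
        have "\<bar>(s - u) / d\<bar> \<le> 1" using s d by simp
        then have "norm (((s - u) / d) *\<^sub>R (w - p u)) \<le> 1 * norm (w - p u)"
          unfolding norm_scaleR by (intro mult_right_mono) auto
        then show "norm (?l s) \<le> R" unfolding R_def by (simp, intro norm_triangle_le) simp
      qed (use s ut d in auto)
    qed (rule integrable_const_ivl)
    also have "\<dots> \<le> e" using d by (simp add: mult.commute)
    finally show ?thesis using d unfolding seg_cost_def by (simp add: norm_funD(3)[OF N])
  qed
  moreover have "seg_cost (u + d) t ?k ?k' \<le> integral {u..t} (\<lambda>s. f s w)"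
    unfolding seg_cost_def using ut d
    by (auto simp: norm_fun_zero[OF N] f_nonneg intro!: integral_subset_le f_const_integrable)
  ultimately show "W t w \<le> seg_cost 0 u p p' + N (w - p u) + integral {u..t} (\<lambda>s. f s w) + e"
    using rc qc by simp
qed

text \<open>A near-optimal path to \<open>x\<close> is continued by a fast move to \<open>w\<close>
  and waiting. At time 0 the value \<open>N x\<close> is a convention not realised by a path to
  \<open>x\<close>, so the constant path at the origin and the triangle inequality take
  over.\<close>

lemma work_function_step:
  assumes st: "0 \<le> s" "s < t" "t \<le> T"
  shows "W t w \<le> W s x + N (w - x) + integral {s..t} (\<lambda>r. f r w)"
proof (cases "s = 0")
  case True
  have "W t w \<le> seg_cost 0 0 (\<lambda>_. 0) (\<lambda>_. 0) + N (w - 0) + integral {0..t} (\<lambda>r. f r w)"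
    by (rule work_function_move) (use st True in \<open>auto intro: segment_path_const\<close>)
  moreover have "N w \<le> N x + N (w - x)" using norm_funD(4)[OF N, of x "w - x"] by simp
  ultimately show ?thesis using True by (simp add: seg_cost_def work_function_def)
next
  case False
  show ?thesis
  proof (rule field_le_epsilon)
    fix e :: real assume e: "e > 0"
    obtain p p' where p: "p 0 = 0" "segment_path 0 s p p'" "p s = x" "seg_cost 0 s p p' < W s x + e"
      using work_function_near[of s e x] False st e by auto
    show "W t w \<le> W s x + N (w - x) + integral {s..t} (\<lambda>r. f r w) + e"
      using work_function_move[OF st p(1,2), of w] p(3,4) by simp
  qed
qed

text \<open>No time is left for moving after \<open>t\<close>. A near-optimal path to
  \<open>x\<close> is therefore cut shortly before \<open>t\<close> and sent straight to
  \<open>w\<close>: the detour back is paid by the length of the discarded piece, and the requests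
  at \<open>w\<close> during the remainder cost at most half of \<open>e\<close>.\<close>

lemma work_function_lipschitz:
  assumes t: "0 \<le> t" "t \<le> T"
  shows "W t w \<le> W t x + N (w - x)"
proof (cases "t = 0")
  case True
  then show ?thesis using norm_funD(4)[OF N, of x "w - x"] by (simp add: work_function_def)
next
  case False
  obtain C where C: "C > 0" "\<And>t y. t \<in> {0..T} \<Longrightarrow> norm y \<le> norm w \<Longrightarrow> f t y \<le> C"
    using f_bounded[of "norm w"] by blast
  show ?thesis
  proof (rule field_le_epsilon)
    fix e :: real assume e: "e > 0"
    obtain p p' where p: "p 0 = 0" "segment_path 0 t p p'" "p t = x" "seg_cost 0 t p p' < W t x + e / 2"
      using work_function_near[of t "e / 2" x] False t e by auto
    define u where "u = max 0 (t - e / (2 * C))"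
    have u: "0 \<le> u" "u < t" "(t - u) * C \<le> e / 2"
    proof -
      show "0 \<le> u" "u < t" using False t e C(1) by (auto simp: u_def)
      have "(t - u) * C \<le> (e / (2 * C)) * C" using C(1) by (intro mult_right_mono) (auto simp: u_def)
      then show "(t - u) * C \<le> e / 2" using C(1) by simp
    qed
    have pu: "segment_path 0 u p p'" using segment_path_sub[OF p(2)] u by simp
    have "integral {u..t} (\<lambda>s. f s w) \<le> integral {u..t} (\<lambda>s. C)"
      by (rule integral_le) (use u t C in \<open>auto intro: f_const_integrable\<close>)
    then have "integral {u..t} (\<lambda>s. f s w) \<le> e / 2" using u by simp
    moreover have "W t w \<le> seg_cost 0 u p p' + N (w - p u) + integral {u..t} (\<lambda>s. f s w)"
      using work_function_move[OF u(1,2) t(2) p(1) pu] .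
    moreover have "N (w - p u) \<le> N (w - x) + N (p t - p u)"
      using norm_fun_triangle[OF N, of w "p u" x] p(3) by simp
    moreover have "N (p t - p u) \<le> seg_cost u t p p'"
      using segment_length[OF p(2), of u t] segment_parts_nonneg(1)[of u t p p'] segment_path_sub[OF p(2), of u t] u t
      by (simp add: seg_cost_def)
    moreover have "seg_cost 0 t p p' = seg_cost 0 u p p' + seg_cost u t p p'"
      using seg_cost_combine[OF p(2)] u t by simp
    ultimately show "W t w \<le> W t x + N (w - x) + e" using p(4) by linarith
  qed
qed

lemma work_function_ge:
  assumes t: "0 \<le> t" "t \<le> T"
  shows "N x \<le> W t x"
proof (cases "t = 0")
  case True
  then show ?thesis by (simp add: work_function_def)
next
  case False
  show ?thesis
  proof (rule field_le_epsilon)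
    fix e :: real assume e: "e > 0"
    obtain p p' where p: "p 0 = 0" "segment_path 0 t p p'" "p t = x" "seg_cost 0 t p p' < W t x + e"
      using work_function_near[of t e x] False t e by auto
    show "N x \<le> W t x + e"
      using segment_length[OF p(2), of 0 t] segment_parts_nonneg(1)[OF p(2)] p t by (simp add: seg_cost_def)
  qed
qed

lemma work_function_dominates:
  assumes t: "0 \<le> t" "t \<le> T"
  shows "dominates (W t) N"
proof -
  obtain C where C: "C > 0" "\<And>x. N x \<le> C * norm x" using norm_fun_upper[OF N] by blast
  have le: "\<bar>W t x - W t y\<bar> \<le> C * norm (x - y)" for x y :: 'a
    using work_function_lipschitz[OF t, of x y] work_function_lipschitz[OF t, of y x]
      C(2)[of "x - y"] norm_fun_diff_commute[OF N, of x y] by linarith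
  have "continuous_on UNIV (W t)"
    unfolding continuous_on_def
  proof
    fix x :: 'a
    have "((\<lambda>y. norm (y - x)) \<longlongrightarrow> norm (x - x)) (at x)" by (intro tendsto_intros)
    then show "(W t \<longlongrightarrow> W t x) (at x)"
      by (rule tendsto_of_modulus[where K=C]) (simp add: le)
  qed
  then show ?thesis using work_function_ge[OF t] by (simp add: dominates_def)
qed

text \<open>Stopping a path to \<open>x\<close> at the earlier time leaves a distance to
  \<open>x\<close> that the discarded piece has already paid as length.\<close>

lemma work_function_mono:
  assumes st: "0 \<le> s" "s \<le> t" "t \<le> T"
  shows "W s x \<le> W t x"
proof (cases "s = 0 \<or> s = t")
  case True
  then show ?thesis using work_function_ge[of t x] st by (auto simp: work_function_def)
next
  case False
  show ?thesis
  proof (rule field_le_epsilon)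
    fix e :: real assume e: "e > 0"
    obtain p p' where p: "p 0 = 0" "segment_path 0 t p p'" "p t = x" "seg_cost 0 t p p' < W t x + e"
      using work_function_near[of t e x] False st e by auto
    have ps: "segment_path 0 s p p'" "segment_path s t p p'" using segment_path_sub[OF p(2)] st by auto
    have "W s x \<le> W s (p s) + N (x - p s)" using work_function_lipschitz st by simp
    also have "\<dots> \<le> seg_cost 0 s p p' + seg_cost s t p p'"
      using work_function_le[of s p p'] ps p segment_length[OF p(2), of s t] segment_parts_nonneg(1)[OF ps(2)] st
      by (simp add: seg_cost_def)
    also have "\<dots> = seg_cost 0 t p p'" using seg_cost_combine[OF p(2)] st by simp
    finally show "W s x \<le> W t x + e" using p(4) by simp
  qed
qed

end

section \<open>Service cost\<close>

text \<open>Over a uniform partition the \<open>A\<close> terms telescope and the errors add up to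
  the mesh times \<open>V T - V 0\<close>, which vanishes under refinement.\<close>

lemma integral_le_of_local_bound:
  fixes \<phi> A V :: "real \<Rightarrow> real"
  assumes T: "T \<ge> 0" and i: "\<phi> integrable_on {0..T}"
    and le: "\<And>s t. 0 \<le> s \<Longrightarrow> s < t \<Longrightarrow> t \<le> T \<Longrightarrow> integral {s..t} \<phi> \<le> A t - A s + (t - s) * (V t - V s)"
  shows "integral {0..T} \<phi> \<le> A T - A 0"
proof (cases "T = 0")
  case False
  then have T: "T > 0" using T by simp
  have main: "integral {0..T} \<phi> \<le> A T - A 0 + (T / real (Suc n)) * (V T - V 0)" for n
  proof -
    define h where "h = T / real (Suc n)"
    have h: "h > 0" "real (Suc n) * h = T" using T by (auto simp: h_def)
    have "integral {0..real k * h} \<phi> \<le> A (real k * h) - A 0 + h * (V (real k * h) - V 0)" if "k \<le> Suc n" for k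
      using that
    proof (induction k)
      case (Suc k)
      let ?s = "real k * h" and ?t = "real (Suc k) * h"
      have st: "0 \<le> ?s" "?s < ?t" "?t - ?s = h" using h(1) by (auto simp: algebra_simps)
      have "?t \<le> real (Suc n) * h" using Suc.prems h(1) by (intro mult_right_mono) auto
      then have t: "?t \<le> T" using h(2) by simp
      have it: "\<phi> integrable_on {0..?t}" by (rule integrable_on_subinterval[OF i]) (use t in auto)
      have "integral {0..?t} \<phi> = integral {0..?s} \<phi> + integral {?s..?t} \<phi>"
        by (rule Henstock_Kurzweil_Integration.integral_combine[symmetric]) (use st it in auto)
      also have "\<dots> \<le> (A ?s - A 0 + h * (V ?s - V 0)) + (A ?t - A ?s + (?t - ?s) * (V ?t - V ?s))"
        using Suc by (intro add_mono le st t) auto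
      also have "\<dots> = A ?t - A 0 + h * (V ?t - V 0)" unfolding st(3) by (simp only: right_diff_distrib)
      finally show ?case .
    qed simp
    from this[of "Suc n"] show ?thesis unfolding h(2) by (simp add: h_def)
  qed
  have "(\<lambda>n. T / real (Suc n)) \<longlonglongrightarrow> 0"
    using tendsto_mult[OF tendsto_const[of T] LIMSEQ_inverse_real_of_nat] by (simp add: divide_inverse)
  then have "(\<lambda>n. A T - A 0 + (T / real (Suc n)) * (V T - V 0)) \<longlonglongrightarrow> A T - A 0 + 0 * (V T - V 0)"
    by (intro tendsto_intros)
  then have "integral {0..T} \<phi> \<le> A T - A 0 + 0 * (V T - V 0)"
    by (rule LIMSEQ_le_const) (use main in blast)
  then show ?thesis by simp
qed simp

context chasing
begin

lemma conj_value_time_mono: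
  assumes "0 \<le> s" "s \<le> t" "t \<le> T" and v: "v \<in> interior (dual_ball N)"
  shows "conj_value (W s) v \<le> conj_value (W t) v"
proof -
  have "conj_value (W s) v \<le> W s (conj_point (W t) v) - v \<bullet> conj_point (W t) v"
    using conj_value_le[OF N work_function_dominates v] assms by simp
  also have "\<dots> \<le> conj_value (W t) v" unfolding conj_value_def using work_function_mono assms by simp
  finally show ?thesis .
qed

lemma work_function_dominates_scale:
  assumes "0 \<le> t" "t \<le> T" "\<rho> \<le> 1"
  shows "dominates (W t) (\<lambda>x. \<rho> * N x)"
  using dominates_scale[OF N work_function_dominates[OF assms(1,2)] assms(3)] .

lemma interior_scaled_subset:
  assumes "0 < \<rho>" "\<rho> \<le> 1"
  shows "interior (dual_ball (\<lambda>x. \<rho> * N x)) \<subseteq> interior (dual_ball N)"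
  using dual_ball_scale_mono[OF N assms] by (intro interior_mono) simp

abbreviation scaled_steiner :: "real \<Rightarrow> real \<Rightarrow> 'a" where
  "scaled_steiner \<rho> t \<equiv> functional_steiner (\<lambda>x. \<rho> * N x) (W t)"

abbreviation scaled_potential :: "real \<Rightarrow> real \<Rightarrow> real" where
  "scaled_potential \<rho> t \<equiv> steiner_potential (\<lambda>x. \<rho> * N x) (W t)"

lemma steiner_movement:
  assumes r: "0 < \<rho>" "\<rho> \<le> 1" and st: "0 \<le> s" "s \<le> t" "t \<le> T"
  shows "\<rho> * N (scaled_steiner \<rho> t - scaled_steiner \<rho> s) \<le> scaled_potential \<rho> t - scaled_potential \<rho> s"
proof -
  have "conj_value (W s) v \<le> conj_value (W t) v + 0" if "v \<in> interior (dual_ball (\<lambda>x. \<rho> * N x))" for v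
    using conj_value_time_mono[OF st] that interior_scaled_subset[OF r] by auto
  from functional_steiner_movement[OF norm_fun_scale[OF N r(1)] work_function_dominates_scale
      work_function_dominates_scale this]
  show ?thesis using st r by (simp add: norm_fun_diff_commute[OF N])
qed

lemma scaled_potential_mono:
  assumes "0 < \<rho>" "\<rho> \<le> 1" "0 \<le> s" "s \<le> t" "t \<le> T"
  shows "scaled_potential \<rho> s \<le> scaled_potential \<rho> t"
proof -
  have "0 \<le> \<rho> * N (scaled_steiner \<rho> t - scaled_steiner \<rho> s)"
    using norm_funD(1)[OF N] assms(1) by simp
  then show ?thesis using steiner_movement[OF assms] by linarith
qed

lemma work_function_zero: "W 0 = N"
  by (auto simp: work_function_def)

lemma conj_zero:
  assumes v: "v \<in> interior (dual_ball N)"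
  shows "conj_point (W 0) v = 0" "conj_value (W 0) v = 0"
  using conj_point_norm_eq_0[OF N v] by (auto simp: work_function_zero conj_value_def norm_fun_zero[OF N])

lemma scaled_zero:
  assumes r: "0 < \<rho>" "\<rho> \<le> 1"
  shows "scaled_steiner \<rho> 0 = 0" "scaled_potential \<rho> 0 = 0"
    "integral (interior (dual_ball (\<lambda>x. \<rho> * N x))) (conj_value (W 0)) = 0"
proof -
  let ?U = "interior (dual_ball (\<lambda>x. \<rho> * N x))"
  have d: "dominates (W 0) (\<lambda>x. \<rho> * N x)" using T0 r by (intro work_function_dominates_scale) auto
  have z: "conj_point (W 0) v = 0" "conj_value (W 0) v = 0" if "v \<in> ?U" for v
    using conj_zero that interior_scaled_subset[OF r] by blast+
  have "integral ?U (conj_point (W 0)) = integral ?U (\<lambda>_. 0)" by (rule integral_cong) (simp add: z)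
  then show "scaled_steiner \<rho> 0 = 0" by (simp add: functional_steiner_eq[OF norm_fun_scale[OF N r(1)] d])
  have "integral ?U (conj_value (W 0)) = integral ?U (\<lambda>_. 0)" by (rule integral_cong) (simp add: z)
  then show i: "integral ?U (conj_value (W 0)) = 0" by simp
  have "integral ?U (\<lambda>v. v \<bullet> conj_point (W 0) v) = integral ?U (\<lambda>_. 0)" by (rule integral_cong) (simp add: z)
  then show "scaled_potential \<rho> 0 = 0" using i by (simp add: steiner_potential_def)
qed

lemma scaled_steiner_bound:
  assumes r: "0 < \<rho>" "\<rho> \<le> 1" and t: "0 \<le> t" "t \<le> T"
  shows "\<rho> * N (scaled_steiner \<rho> t) \<le> real DIM('a) * W T 0"
proof -
  have "\<rho> * N (scaled_steiner \<rho> t) \<le> scaled_potential \<rho> t"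
    using steiner_movement[OF r order_refl t] scaled_zero[OF r] by simp
  also have "\<dots> \<le> scaled_potential \<rho> T" using scaled_potential_mono[OF r t(1,2) order_refl] .
  also have "\<dots> \<le> real DIM('a) * W T 0"
    using T0 r by (intro steiner_potential_le norm_fun_scale N work_function_dominates_scale) auto
  finally show ?thesis .
qed

text \<open>The slack \<open>1 - \<rho>\<close> bounds the length of the last piece of a
  near-optimal path by the growth of the conjugate itself. Replacing service along that piece by
  service at its end point then costs a Lipschitz constant times this length times
  \<open>t - s\<close>, hence the multiplicative error
  \<open>1 + \<kappa> * (t - s)\<close>.\<close>

lemma conj_value_increment:
  assumes r: "0 < \<rho>" "\<rho> < 1"
  shows "\<exists>\<kappa>\<ge>0. \<forall>s t. 0 \<le> s \<longrightarrow> s < t \<longrightarrow> t \<le> T \<longrightarrow> (\<forall>v\<in>dual_ball (\<lambda>x. \<rho> * N x).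
      integral {s..t} (\<lambda>r. f r (conj_point (W t) v))
        \<le> (conj_value (W t) v - conj_value (W s) v) * (1 + \<kappa> * (t - s)))"
proof -
  obtain c where c: "c > 0" "\<And>x. c * norm x \<le> N x" using norm_fun_lower[OF N] by blast
  define B where "B = W T 0"
  have B0: "B \<ge> 0" unfolding B_def using T0 by (intro dominates_zero_nonneg[OF N work_function_dominates[of T]]) auto
  \<comment> \<open>Chosen to contain both the minimiser, of norm \<open>N\<close> at most
    \<open>B / (1 - \<rho>)\<close>, and the last piece of the path, of length at most
    \<open>(B + 1) / (1 - \<rho>)\<close>.\<close>
  define R where "R = (B / (1 - \<rho>) + (B + 1) / (1 - \<rho>)) / c"
  obtain L where L0: "L > 0" and
    L: "\<And>t x y. t \<in> {0..T} \<Longrightarrow> norm x \<le> R \<Longrightarrow> norm y \<le> R \<Longrightarrow> \<bar>f t x - f t y\<bar> \<le> L * norm (x - y)"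
    using f_lipschitz[of R] by blast
  define \<kappa> where "\<kappa> = L / c / (1 - \<rho>)"
  have k0: "\<kappa> \<ge> 0" using L0 c r by (simp add: \<kappa>_def)
  have "integral {s..t} (\<lambda>r. f r (conj_point (W t) v))
        \<le> (conj_value (W t) v - conj_value (W s) v) * (1 + \<kappa> * (t - s))"
    if st: "0 \<le> s" "s < t" "t \<le> T" and v: "v \<in> dual_ball (\<lambda>x. \<rho> * N x)" for s t v
  proof (rule field_le_epsilon)
    fix e :: real assume e: "e > 0"
    define w where "w = conj_point (W t) v"
    define \<Delta> where "\<Delta> = conj_value (W t) v - conj_value (W s) v"
    define q where "q = 1 + \<kappa> * (t - s)"
    have q: "q \<ge> 1" using k0 st by (simp add: q_def)
    \<comment> \<open>\<open>\<eta> \<le> 1\<close> keeps the path inside the radius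
      \<open>R\<close>, which was fixed beforehand; \<open>\<eta> * q \<le> e\<close> makes the
      final error admissible.\<close>
    define \<eta> where "\<eta> = min 1 (e / q)"
    have eta: "\<eta> > 0" "\<eta> \<le> 1" "\<eta> * q \<le> e" using e q by (auto simp: \<eta>_def min_def field_simps)
    have vU: "v \<in> interior (dual_ball N)" using dual_ball_scale_subset[OF N r] v by blast
    have dom: "dominates (W t) N" "dominates (W s) N" using st by (auto intro: work_function_dominates)
    have W0: "W t 0 \<le> B" unfolding B_def using st by (intro work_function_mono) auto
    have "N w \<le> W t 0 / (1 - \<rho>)" unfolding w_def by (rule N_conj_point_bound[OF N dom(1) r v])
    also have "\<dots> \<le> B / (1 - \<rho>)" using W0 r by (simp add: divide_right_mono)
    finally have Nw: "N w \<le> B / (1 - \<rho>)" .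
    have D: "0 \<le> \<Delta>" "\<Delta> \<le> B"
      using conj_value_time_mono[of s t v] conj_value_le_zero[OF N dom(1) vU]
        conj_value_ge[OF N dom(2) subsetD[OF interior_subset vU]] vU st W0
      by (auto simp: \<Delta>_def)
    obtain p p' where p: "p 0 = 0" "segment_path 0 t p p'" "p t = w" "seg_cost 0 t p p' < W t w + \<eta>"
      using work_function_near[of t \<eta> w] st eta by auto
    have ps: "segment_path 0 s p p'" "segment_path s t p p'" using segment_path_sub[OF p(2)] st by auto
    define len where "len = integral {s..t} (\<lambda>r. N (p' r))"
    define I where "I = integral {s..t} (\<lambda>r. f r (p r))"
    have fi: "(\<lambda>r. f r (p r)) integrable_on {s..t}" and Ni: "(\<lambda>r. N (p' r)) integrable_on {s..t}"
      using segment_integrable[OF ps(2)] st by auto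
    have I0: "I \<ge> 0" and l0: "len \<ge> 0" unfolding I_def len_def using segment_parts_nonneg[OF ps(2)] st by auto
    have seglen: "N (w - p r) \<le> len" if r: "r \<in> {s..t}" for r
    proof -
      have "N (p t - p r) \<le> integral {r..t} (\<lambda>r. N (p' r))"
        by (rule segment_length[OF p(2)]) (use r st in auto)
      also have "\<dots> \<le> len" unfolding len_def
      proof (rule integral_subset_le)
        show "(\<lambda>r. N (p' r)) integrable_on {r..t}" by (rule integrable_on_subinterval[OF Ni]) (use r in auto)
      qed (use r Ni norm_funD(1)[OF N] in auto)
      finally show ?thesis using p(3) by simp
    qed
    \<comment> \<open>The point \<open>p s\<close> competes in the minimum at time \<open>s\<close>.
      The last piece adds service and length, and the linear term takes back at most the fraction
      \<rho> of the length.\<close>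
    have key: "I + (1 - \<rho>) * len \<le> \<Delta> + \<eta>"
    proof -
      have "seg_cost 0 t p p' = seg_cost 0 s p p' + (I + len)"
        using seg_cost_combine[OF p(2)] st by (simp add: seg_cost_def[of s t] I_def len_def)
      moreover have "W s (p s) \<le> seg_cost 0 s p p'" using work_function_le[OF _ _ p(1) ps(1)] st by simp
      moreover have "conj_value (W s) v \<le> W s (p s) - v \<bullet> p s" by (rule conj_value_le[OF N dom(2) vU])
      moreover have "v \<bullet> (w - p s) \<le> \<rho> * len"
      proof -
        have "v \<bullet> (w - p s) \<le> \<rho> * N (w - p s)"
          using v unfolding dual_ball_iff[OF norm_fun_scale[OF N r(1)]] by blast
        also have "\<dots> \<le> \<rho> * len" using seglen[of s] st r by (intro mult_left_mono) auto
        finally show ?thesis .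
      qed
      moreover have "conj_value (W t) v = W t w - v \<bullet> w" by (simp add: conj_value_def w_def)
      ultimately show ?thesis using p(4) by (simp add: \<Delta>_def inner_diff_right algebra_simps)
    qed
    have lle: "len \<le> (\<Delta> + \<eta>) / (1 - \<rho>)"
      using key I0 r by (simp add: pos_le_divide_eq algebra_simps)
    also have "\<dots> \<le> (B + 1) / (1 - \<rho>)" using D eta r by (intro divide_right_mono) auto
    finally have lB: "len \<le> (B + 1) / (1 - \<rho>)" .
    have norm_le: "norm x \<le> R" if "N x \<le> B / (1 - \<rho>) + (B + 1) / (1 - \<rho>)" for x
      using c(2)[of x] that c(1) unfolding R_def by (subst pos_le_divide_eq) (auto simp: mult.commute)
    have "f r w \<le> f r (p r) + (L / c) * len" if r': "r \<in> {s..t}" for r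
    proof -
      have "N (p r) \<le> N w + N (w - p r)"
        using norm_fun_triangle[OF N, of "p r" 0 w] norm_fun_diff_commute[OF N, of "p r" w] by simp
      then have "norm (p r) \<le> R" using seglen[OF r'] Nw lB by (intro norm_le) linarith
      moreover have "norm w \<le> R"
        using Nw B0 r by (intro norm_le) (smt (verit) divide_nonneg_nonneg)
      ultimately have "\<bar>f r w - f r (p r)\<bar> \<le> L * norm (w - p r)" using r' st by (intro L) auto
      also have "\<dots> = (L / c) * (c * norm (w - p r))" using c by simp
      also have "\<dots> \<le> (L / c) * len"
        using c(1) L0 order_trans[OF c(2) seglen[OF r']] by (intro mult_left_mono) auto
      finally show ?thesis by linarith
    qed
    then have "integral {s..t} (\<lambda>r. f r w) \<le> integral {s..t} (\<lambda>r. f r (p r) + (L / c) * len)"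
      using st fi by (intro integral_le f_const_integrable integrable_add integrable_const_ivl) auto
    also have "\<dots> = I + (t - s) * ((L / c) * len)"
      using fi st by (subst integral_add) (auto simp: I_def integrable_const_ivl)
    also have "(t - s) * ((L / c) * len) \<le> (t - s) * ((L / c) * ((\<Delta> + \<eta>) / (1 - \<rho>)))"
      using lle st L0 c by (intro mult_left_mono) auto
    also have "\<dots> = (\<Delta> + \<eta>) * (\<kappa> * (t - s))" by (simp add: \<kappa>_def)
    also have "I \<le> \<Delta> + \<eta>"
      using key l0 r by (smt (verit) mult_nonneg_nonneg)
    finally have "integral {s..t} (\<lambda>r. f r w) \<le> (\<Delta> + \<eta>) * q" by (simp add: q_def distrib_left)
    also have "\<dots> \<le> \<Delta> * q + e" using eta by (simp add: distrib_right)
    finally show "integral {s..t} (\<lambda>r. f r (conj_point (W t) v))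
        \<le> (conj_value (W t) v - conj_value (W s) v) * (1 + \<kappa> * (t - s)) + e"
      by (simp add: w_def \<Delta>_def q_def)
  qed
  with k0 show ?thesis by blast
qed

lemma convex_integral_request:
  assumes "0 \<le> s" "t \<le> T"
  shows "convex_on UNIV (\<lambda>x. integral {s..t} (\<lambda>r. f r x))"
  unfolding convex_on_def
proof (intro conjI ballI allI impI)
  fix x y :: 'a and u v :: real
  assume uv: "0 \<le> u" "0 \<le> v" "u + v = 1"
  have "integral {s..t} (\<lambda>r. f r (u *\<^sub>R x + v *\<^sub>R y)) \<le> integral {s..t} (\<lambda>r. u * f r x + v * f r y)"
  proof (rule integral_le)
    show "(\<lambda>r. u * f r x + v * f r y) integrable_on {s..t}"
      using assms by (intro integrable_add integrable_on_mult_right f_const_integrable)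
    show "f r (u *\<^sub>R x + v *\<^sub>R y) \<le> u * f r x + v * f r y" if "r \<in> {s..t}" for r
    proof -
      have "convex_on UNIV (f r)" using f_convex[of r] that assms by auto
      then show ?thesis using uv unfolding convex_on_def by blast
    qed
  qed (use assms in \<open>auto intro: f_const_integrable\<close>)
  also have "\<dots> = u * integral {s..t} (\<lambda>r. f r x) + v * integral {s..t} (\<lambda>r. f r y)"
    using f_const_integrable[OF assms] by (subst integral_add) (auto intro: integrable_on_mult_right)
  finally show "integral {s..t} (\<lambda>r. f r (u *\<^sub>R x + v *\<^sub>R y))
    \<le> u * integral {s..t} (\<lambda>r. f r x) + v * integral {s..t} (\<lambda>r. f r y)" .
qed simp

definition average_conj :: "real \<Rightarrow> real \<Rightarrow> real" where
  "average_conj \<rho> t = (1 / measure lebesgue (interior (dual_ball (\<lambda>x. \<rho> * N x)))) *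
     integral (interior (dual_ball (\<lambda>x. \<rho> * N x))) (conj_value (W t))"

text \<open>Jensen is applied to the request integrated over \<open>{s..t}\<close>, since only this
  integral, not its values at single times, is bounded by the growth of the conjugate.\<close>

lemma service_increment:
  assumes r: "0 < \<rho>" "\<rho> < 1"
  shows "\<exists>\<kappa>\<ge>0. \<forall>s t. 0 \<le> s \<longrightarrow> s < t \<longrightarrow> t \<le> T \<longrightarrow>
      integral {s..t} (\<lambda>r. f r (scaled_steiner \<rho> t))
        \<le> (average_conj \<rho> t - average_conj \<rho> s) * (1 + \<kappa> * (t - s))"
proof -
  obtain \<kappa> where k0: "\<kappa> \<ge> 0" and k: "\<And>s t v. 0 \<le> s \<Longrightarrow> s < t \<Longrightarrow> t \<le> T \<Longrightarrow> v \<in> dual_ball (\<lambda>x. \<rho> * N x) \<Longrightarrow>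
      integral {s..t} (\<lambda>r. f r (conj_point (W t) v))
        \<le> (conj_value (W t) v - conj_value (W s) v) * (1 + \<kappa> * (t - s))"
    using conj_value_increment[OF r] by blast
  obtain c where c: "c > 0" "\<And>x. c * norm x \<le> N x" using norm_fun_lower[OF N] by blast
  define U where "U = interior (dual_ball (\<lambda>x. \<rho> * N x))"
  define m where "m = measure lebesgue U"
  have N': "norm_fun (\<lambda>x. \<rho> * N x)" by (rule norm_fun_scale[OF N r(1)])
  have Ul: "U \<in> lmeasurable" unfolding U_def by (rule interior_dual_ball_lmeasurable[OF N'])
  have m: "m > 0" unfolding m_def U_def by (rule measure_interior_dual_ball_pos[OF N'])
  have UB: "U \<subseteq> dual_ball (\<lambda>x. \<rho> * N x)" unfolding U_def by (rule interior_subset)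
  have dom: "dominates (W t) (\<lambda>x. \<rho> * N x)" if "0 \<le> t" "t \<le> T" for t
    using that r by (intro work_function_dominates_scale) auto
  have "integral {s..t} (\<lambda>r. f r (scaled_steiner \<rho> t))
        \<le> (average_conj \<rho> t - average_conj \<rho> s) * (1 + \<kappa> * (t - s))"
    if st: "0 \<le> s" "s < t" "t \<le> T" for s t
  proof -
    let ?c = "conj_point (W t)"
    define \<phi> where "\<phi> x = integral {s..t} (\<lambda>r. f r x)" for x
    have cv: "convex_on UNIV \<phi>" unfolding \<phi>_def using st by (intro convex_integral_request) auto
    have ca: "?c absolutely_integrable_on U"
      unfolding U_def using st by (intro conj_point_absolutely_integrable[OF N' dom]) auto
    then have ci: "?c integrable_on U" by (simp add: absolutely_integrable_on_def)
    have Fi: "conj_value (W t) integrable_on U" "conj_value (W s) integrable_on U"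
      unfolding U_def using st by (auto intro: conj_value_integrable[OF N' dom])
    define R where "R = W t 0 / (1 - \<rho>) / c"
    obtain C where C: "C > 0" "\<And>t x. t \<in> {0..T} \<Longrightarrow> norm x \<le> R \<Longrightarrow> f t x \<le> C"
      using f_bounded[of R] by blast
    have phi_nonneg: "\<phi> x \<ge> 0" for x
      unfolding \<phi>_def using st by (intro integral_nonneg f_const_integrable f_nonneg) auto
    have cphi: "(\<lambda>v. \<phi> (?c v)) integrable_on U"
    proof (rule measurable_bounded_by_integrable_imp_integrable)
      have "\<phi> \<in> borel_measurable borel"
        using convex_on_continuous[OF open_UNIV cv] by (rule borel_measurable_continuous_onI)
      moreover have "?c \<in> borel_measurable (lebesgue_on U)"
        using ca Ul absolutely_integrable_measurable fmeasurableD by blast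
      ultimately show "(\<lambda>v. \<phi> (?c v)) \<in> borel_measurable (lebesgue_on U)" by measurable
      show "(\<lambda>_. C * (t - s)) integrable_on U" using Ul by (rule integrable_on_const)
      show "norm (\<phi> (?c v)) \<le> C * (t - s)" if "v \<in> U" for v
      proof -
        have "c * norm (?c v) \<le> W t 0 / (1 - \<rho>)"
          using c(2)[of "?c v"] N_conj_point_bound[OF N work_function_dominates r, of t v] that UB st by force
        then have "norm (?c v) \<le> R" unfolding R_def using c(1) by (subst pos_le_divide_eq) (auto simp: mult.commute)
        then have "\<phi> (?c v) \<le> integral {s..t} (\<lambda>r. C)"
          unfolding \<phi>_def using st C(2) by (intro integral_le f_const_integrable integrable_const_ivl) auto
        then show ?thesis using phi_nonneg st by (simp add: mult.commute)
      qed
      show "U \<in> sets lebesgue" using Ul by (rule fmeasurableD)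
    qed
    have "\<phi> (scaled_steiner \<rho> t) = \<phi> ((1 / m) *\<^sub>R integral U ?c)"
      using functional_steiner_eq[OF N' dom] st by (simp add: U_def m_def)
    also have "\<dots> \<le> (1 / m) * integral U (\<lambda>v. \<phi> (?c v))"
      unfolding m_def using m by (intro integral_average_jensen Ul ci cv cphi) (simp add: m_def)
    also have "\<dots> \<le> (1 / m) * integral U (\<lambda>v. (conj_value (W t) v - conj_value (W s) v) * (1 + \<kappa> * (t - s)))"
    proof (intro mult_left_mono integral_le cphi)
      show "(\<lambda>v. (conj_value (W t) v - conj_value (W s) v) * (1 + \<kappa> * (t - s))) integrable_on U"
        using Fi by (intro integrable_on_mult_left integrable_diff)
      show "\<phi> (?c v) \<le> (conj_value (W t) v - conj_value (W s) v) * (1 + \<kappa> * (t - s))" if "v \<in> U" for v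
        unfolding \<phi>_def using k[OF st] that UB by blast
    qed (use m in simp)
    also have "\<dots> = (average_conj \<rho> t - average_conj \<rho> s) * (1 + \<kappa> * (t - s))"
    proof -
      have "integral U (\<lambda>v. (conj_value (W t) v - conj_value (W s) v) * (1 + \<kappa> * (t - s)))
          = (integral U (conj_value (W t)) - integral U (conj_value (W s))) * (1 + \<kappa> * (t - s))"
        using integral_diff[OF Fi] by simp
      then show ?thesis
        unfolding average_conj_def U_def[symmetric] m_def[symmetric]
        by (simp only: right_diff_distrib[symmetric] mult.assoc)
    qed
    finally show ?thesis by (simp add: \<phi>_def)
  qed
  with k0 show ?thesis by blast
qed

end

section \<open>Passage to the full dual ball and the continuous-time ratio\<close>

context chasing
begin

lemma steiner_norm_le:
  obtains c where "c > 0"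
    "\<And>\<rho> s t. 0 < \<rho> \<Longrightarrow> \<rho> \<le> 1 \<Longrightarrow> 0 \<le> s \<Longrightarrow> s \<le> t \<Longrightarrow> t \<le> T \<Longrightarrow>
      norm (scaled_steiner \<rho> t - scaled_steiner \<rho> s) \<le> c / \<rho> * (scaled_potential \<rho> t - scaled_potential \<rho> s)"
    "\<And>\<rho> t. 0 < \<rho> \<Longrightarrow> \<rho> \<le> 1 \<Longrightarrow> 0 \<le> t \<Longrightarrow> t \<le> T \<Longrightarrow>
      norm (scaled_steiner \<rho> t) \<le> c / \<rho> * (real DIM('a) * W T 0)"
proof -
  obtain c where c: "c > 0" "\<And>x. c * norm x \<le> N x" using norm_fun_lower[OF N] by blast
  have *: "norm x \<le> (1 / c) / \<rho> * y" if "0 < \<rho>" "\<rho> * N x \<le> y" for \<rho> x y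
  proof -
    have "\<rho> * (c * norm x) \<le> \<rho> * N x" using c(2) that(1) by (intro mult_left_mono) auto
    with that(2) have "norm x * (c * \<rho>) \<le> y" by (simp add: mult_ac)
    then show ?thesis using c(1) that(1) by (simp add: pos_le_divide_eq mult_ac)
  qed
  show thesis
    by (rule that[of "1 / c"]) (use c(1) * steiner_movement scaled_steiner_bound in auto)
qed

text \<open>The displacement of the Steiner path is bounded by the increment of a monotone
  potential, so the path is continuous wherever the potential is, that is, off a countable set of
  times.\<close>

lemma scaled_steiner_request_integrable:
  assumes r: "0 < \<rho>" "\<rho> \<le> 1"
  shows "(\<lambda>t. f t (scaled_steiner \<rho> t)) integrable_on {0..T}"
proof -
  let ?X = "scaled_steiner \<rho>" and ?P = "scaled_potential \<rho>"
  obtain c where c0: "c > 0"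
    and mv: "\<And>s t. 0 \<le> s \<Longrightarrow> s \<le> t \<Longrightarrow> t \<le> T \<Longrightarrow> norm (?X t - ?X s) \<le> c / \<rho> * (?P t - ?P s)"
    and bd: "\<And>t. 0 \<le> t \<Longrightarrow> t \<le> T \<Longrightarrow> norm (?X t) \<le> c / \<rho> * (real DIM('a) * W T 0)"
    using steiner_norm_le r by metis
  define E where "E = {t \<in> {0..T}. \<not> continuous (at t within {0..T}) ?P}"
  have mono: "mono_on {0..T} ?P" by (intro mono_onI scaled_potential_mono[OF r]) auto
  have cE: "countable E" unfolding E_def by (rule mono_on_ctble_discont[OF mono])
  have up: "norm (?X t - ?X s) \<le> c / \<rho> * \<bar>?P t - ?P s\<bar>" if "s \<in> {0..T}" "t \<in> {0..T}" for s t
    using mv[of s t] mv[of t s] scaled_potential_mono[OF r, of s t] scaled_potential_mono[OF r, of t s] that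
    by (cases "s \<le> t") (auto simp: norm_minus_commute abs_if)
  have "continuous_on ({0..T} - E) ?X"
    unfolding continuous_on_def
  proof
    fix s assume s: "s \<in> {0..T} - E"
    have "(?P \<longlongrightarrow> ?P s) (at s within {0..T})" using s by (auto simp: E_def continuous_within)
    then have "(?P \<longlongrightarrow> ?P s) (at s within {0..T} - E)" by (rule tendsto_within_subset) auto
    then show "(?X \<longlongrightarrow> ?X s) (at s within {0..T} - E)"
      by (rule tendsto_of_modulus[OF _ up]) (use s in auto)
  qed
  moreover have "norm (?X t) \<le> c / \<rho> * (real DIM('a) * W T 0)" if "t \<in> {0..T}" for t using bd that by simp
  ultimately have "(\<lambda>t. f t (?X t)) absolutely_integrable_on {0..T}"
    by (intro f_along_integrable[OF _ cE]) auto
  then show ?thesis by (simp add: absolutely_integrable_on_def)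
qed

text \<open>\<open>service_increment\<close> freezes the Steiner point at the right end of the
  interval. Unfreezing it costs a Lipschitz constant times the movement, hence at most a multiple of
  the growth of the potential at each time.\<close>

lemma scaled_service_le:
  assumes r: "0 < \<rho>" "\<rho> < 1"
  shows "integral {0..T} (\<lambda>t. f t (scaled_steiner \<rho> t)) \<le> W T x"
proof -
  let ?X = "scaled_steiner \<rho>" and ?P = "scaled_potential \<rho>" and ?A = "average_conj \<rho>"
  have r': "0 < \<rho>" "\<rho> \<le> 1" using r by auto
  obtain c where c0: "c > 0"
    and mv: "\<And>s t. 0 \<le> s \<Longrightarrow> s \<le> t \<Longrightarrow> t \<le> T \<Longrightarrow> norm (?X t - ?X s) \<le> c / \<rho> * (?P t - ?P s)"
    and bd: "\<And>t. 0 \<le> t \<Longrightarrow> t \<le> T \<Longrightarrow> norm (?X t) \<le> c / \<rho> * (real DIM('a) * W T 0)"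
    using steiner_norm_le r' by metis
  obtain \<kappa> where k0: "\<kappa> \<ge> 0" and k: "\<And>s t. 0 \<le> s \<Longrightarrow> s < t \<Longrightarrow> t \<le> T \<Longrightarrow>
      integral {s..t} (\<lambda>r. f r (?X t)) \<le> (?A t - ?A s) * (1 + \<kappa> * (t - s))"
    using service_increment[OF r] by blast
  define R where "R = c / \<rho> * (real DIM('a) * W T 0)"
  obtain L where L0: "L > 0" and
    L: "\<And>t x y. t \<in> {0..T} \<Longrightarrow> norm x \<le> R \<Longrightarrow> norm y \<le> R \<Longrightarrow> \<bar>f t x - f t y\<bar> \<le> L * norm (x - y)"
    using f_lipschitz[of R] by blast
  define M where "M = L * (c / \<rho>)"
  \<comment> \<open>Collects both errors: \<kappa> times the growth of \<open>?A\<close> from the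
    service estimate, and \<open>M\<close> times the growth of \<open>?P\<close> from
    unfreezing.\<close>
  define V where "V t = \<kappa> * ?A t + M * ?P t" for t
  have i: "(\<lambda>t. f t (?X t)) integrable_on {0..T}" by (rule scaled_steiner_request_integrable[OF r'])
  have "integral {0..T} (\<lambda>t. f t (?X t)) \<le> ?A T - ?A 0"
  proof (rule integral_le_of_local_bound[OF T0 i])
    fix s t assume st: "0 \<le> s" "s < t" "t \<le> T"
    have "integral {s..t} (\<lambda>r. f r (?X r)) \<le> integral {s..t} (\<lambda>r. f r (?X t) + M * (?P t - ?P s))"
    proof (rule integral_le)
      show "(\<lambda>r. f r (?X r)) integrable_on {s..t}" by (rule integrable_on_subinterval[OF i]) (use st in auto)
      show "(\<lambda>r. f r (?X t) + M * (?P t - ?P s)) integrable_on {s..t}"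
        using st by (intro integrable_add f_const_integrable integrable_const_ivl) auto
      fix u assume u: "u \<in> {s..t}"
      have "\<bar>f u (?X t) - f u (?X u)\<bar> \<le> L * norm (?X t - ?X u)"
        using u st bd[of t, folded R_def] bd[of u, folded R_def] by (intro L) auto
      also have "\<dots> \<le> L * (c / \<rho> * (?P t - ?P u))" using u st L0 by (intro mult_left_mono mv) auto
      also have "\<dots> \<le> L * (c / \<rho> * (?P t - ?P s))"
        using u st c0 r L0 scaled_potential_mono[OF r', of s u] by (intro mult_left_mono) auto
      also have "\<dots> = M * (?P t - ?P s)" by (simp add: M_def)
      finally show "f u (?X u) \<le> f u (?X t) + M * (?P t - ?P s)" by linarith
    qed
    also have "\<dots> = integral {s..t} (\<lambda>r. f r (?X t)) + (t - s) * (M * (?P t - ?P s))"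
      using st by (subst integral_add) (auto intro: f_const_integrable)
    also have "\<dots> \<le> (?A t - ?A s) * (1 + \<kappa> * (t - s)) + (t - s) * (M * (?P t - ?P s))"
      using k[OF st] by simp
    also have "\<dots> = ?A t - ?A s + (t - s) * (V t - V s)"
      by (simp add: V_def algebra_simps)
    finally show "integral {s..t} (\<lambda>t. f t (?X t)) \<le> ?A t - ?A s + (t - s) * (V t - V s)" .
  qed
  moreover have "?A 0 = 0" using scaled_zero(3)[OF r'] by (simp add: average_conj_def)
  moreover have "?A T \<le> W T x"
  proof -
    have N': "norm_fun (\<lambda>x. \<rho> * N x)" by (rule norm_fun_scale[OF N r(1)])
    have "integral (interior (dual_ball (\<lambda>x. \<rho> * N x))) (conj_value (W T))
        \<le> measure lebesgue (interior (dual_ball (\<lambda>x. \<rho> * N x))) * W T x"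
      using T0 r' by (intro integral_conj_value_le N' work_function_dominates_scale) auto
    then show ?thesis unfolding average_conj_def
      using measure_interior_dual_ball_pos[OF N'] by (simp add: pos_divide_le_eq mult.commute)
  qed
  ultimately show ?thesis by simp
qed

lemma steiner_path_eq: "steiner_path N f t = scaled_steiner 1 t"
  by (simp add: steiner_path_def)

text \<open>The bound for scaled balls is independent of \<rho>, so it survives the limit: Steiner
  points converge at each time, requests are continuous in space, and a uniform bound permits
  dominated convergence.\<close>

lemma steiner_path_service:
  "(\<lambda>t. f t (steiner_path N f t)) integrable_on {0..T}"
  "integral {0..T} (\<lambda>t. f t (steiner_path N f t)) \<le> W T x"
proof -
  show i: "(\<lambda>t. f t (steiner_path N f t)) integrable_on {0..T}"
    unfolding steiner_path_eq by (rule scaled_steiner_request_integrable) auto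
  obtain c where c0: "c > 0"
    and bd: "\<And>\<rho> t. 0 < \<rho> \<Longrightarrow> \<rho> \<le> 1 \<Longrightarrow> 0 \<le> t \<Longrightarrow> t \<le> T \<Longrightarrow> norm (scaled_steiner \<rho> t) \<le> c / \<rho> * (real DIM('a) * W T 0)"
    using steiner_norm_le by metis
  \<comment> \<open>The divisor 1/2 is the smallest value of \<open>ratio\<close>, so
    \<open>R\<close> bounds all the scaled Steiner paths at once.\<close>
  define R where "R = c / (1 / 2) * (real DIM('a) * W T 0)"
  have WT: "W T 0 \<ge> 0" using dominates_zero_nonneg[OF N work_function_dominates[OF T0 order_refl]] .
  have half: "ratio k \<ge> 1 / 2" for k by (simp add: ratio_def field_simps)
  have bnd: "norm (scaled_steiner (ratio k) t) \<le> R" if t: "t \<in> {0..T}" for k t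
  proof -
    have "norm (scaled_steiner (ratio k) t) \<le> c / ratio k * (real DIM('a) * W T 0)"
      using t ratio[of k] by (intro bd) auto
    also have "\<dots> \<le> R"
      unfolding R_def using c0 WT half[of k] by (intro mult_right_mono divide_left_mono) auto
    finally show ?thesis .
  qed
  obtain C where C: "C > 0" "\<And>t x. t \<in> {0..T} \<Longrightarrow> norm x \<le> R \<Longrightarrow> f t x \<le> C"
    using f_bounded[of R] by blast
  have "(\<lambda>k. integral {0..T} (\<lambda>t. f t (scaled_steiner (ratio k) t))) \<longlonglongrightarrow> integral {0..T} (\<lambda>t. f t (steiner_path N f t))"
  proof (rule dominated_convergence(2))
    show "(\<lambda>t. f t (scaled_steiner (ratio k) t)) integrable_on {0..T}" for k
      using ratio[of k] by (intro scaled_steiner_request_integrable) auto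
    show "(\<lambda>t. C) integrable_on {0..T}" by (rule integrable_const_ivl)
    show "norm (f t (scaled_steiner (ratio k) t)) \<le> C" if "t \<in> {0..T}" for k t
      using C(2)[OF that bnd[OF that]] f_nonneg[OF that] by simp
    show "(\<lambda>k. f t (scaled_steiner (ratio k) t)) \<longlonglongrightarrow> f t (steiner_path N f t)" if t: "t \<in> {0..T}" for t
    proof -
      have "continuous_on UNIV (f t)" using convex_on_continuous[OF open_UNIV f_convex[OF t]] .
      then have "isCont (f t) (steiner_path N f t)" by (simp add: continuous_on_eq_continuous_at)
      moreover have "(\<lambda>k. scaled_steiner (ratio k) t) \<longlonglongrightarrow> steiner_path N f t"
        unfolding steiner_path_def using t by (intro functional_steiner_scaled_tendsto N work_function_dominates) auto
      ultimately show ?thesis by (rule isCont_tendsto_compose)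
    qed
  qed
  then show "integral {0..T} (\<lambda>t. f t (steiner_path N f t)) \<le> W T x"
    by (rule LIMSEQ_le_const2) (use scaled_service_le[OF ratio(1,2)] in blast)
qed

lemma steiner_path_movement:
  assumes "0 \<le> s" "s \<le> t" "t \<le> T"
  shows "N (steiner_path N f t - steiner_path N f s) \<le> scaled_potential 1 t - scaled_potential 1 s"
  using steiner_movement[of 1 s t] assms by (simp add: steiner_path_eq)

lemma steiner_path_zero: "steiner_path N f 0 = 0"
  using scaled_zero(1)[of 1] by (simp add: steiner_path_eq)

lemma steiner_path_polygon:
  assumes \<tau>: "mono_on {..k} \<tau>" "\<tau> ` {..k} \<subseteq> {0..T}"
  shows "(\<Sum>i<k. N (steiner_path N f (\<tau> (Suc i)) - steiner_path N f (\<tau> i))) \<le> scaled_potential 1 T"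
proof -
  have tau: "0 \<le> \<tau> i" "\<tau> i \<le> T" if "i \<le> k" for i using \<tau>(2) that by auto
  have "(\<Sum>i<k. N (steiner_path N f (\<tau> (Suc i)) - steiner_path N f (\<tau> i)))
      \<le> (\<Sum>i<k. scaled_potential 1 (\<tau> (Suc i)) - scaled_potential 1 (\<tau> i))"
  proof (rule sum_mono)
    fix i assume "i \<in> {..<k}"
    then show "N (steiner_path N f (\<tau> (Suc i)) - steiner_path N f (\<tau> i))
        \<le> scaled_potential 1 (\<tau> (Suc i)) - scaled_potential 1 (\<tau> i)"
      using tau[of i] tau[of "Suc i"] mono_onD[OF \<tau>(1), of i "Suc i"]
      by (intro steiner_path_movement) auto
  qed
  also have "\<dots> = scaled_potential 1 (\<tau> k) - scaled_potential 1 (\<tau> 0)" by (rule sum_lessThan_telescope)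
  also have "\<dots> \<le> scaled_potential 1 T - scaled_potential 1 0"
    using tau[of k] tau[of 0] by (intro diff_mono scaled_potential_mono) auto
  finally show ?thesis using scaled_zero(2)[of 1] by simp
qed

lemma scaled_potential_one_le: "scaled_potential 1 T \<le> real DIM('a) * W T x"
  using steiner_potential_le[OF N work_function_dominates[OF T0 order_refl]] by simp

text \<open>Movement contributes \<open>DIM('a)\<close> and service 1, both against
  \<open>W T\<close> at the end point of an arbitrary offline path.\<close>

lemma continuous_competitive:
  assumes T: "T > 0"
  shows "ereal (integral {0..T} (\<lambda>t. f t (steiner_path N f t))) + variation N {0..T} (steiner_path N f)
    \<le> ereal ((real DIM('a) + 1) * offline_opt N f T)"
proof -
  define S where "S = integral {0..T} (\<lambda>t. f t (steiner_path N f t)) + scaled_potential 1 T"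
  have S: "S \<le> (real DIM('a) + 1) * W T x" for x
    using steiner_path_service(2)[of x] scaled_potential_one_le[of x] by (simp add: S_def distrib_right)
  have "variation N {0..T} (steiner_path N f) \<le> ereal (scaled_potential 1 T)"
    unfolding variation_def using steiner_path_polygon by (intro SUP_least) auto
  then have "ereal (integral {0..T} (\<lambda>t. f t (steiner_path N f t))) + variation N {0..T} (steiner_path N f)
    \<le> ereal (integral {0..T} (\<lambda>t. f t (steiner_path N f t))) + ereal (scaled_potential 1 T)"
    by (rule add_left_mono)
  also have "\<dots> = ereal S" by (simp add: S_def)
  also have "\<dots> \<le> ereal ((real DIM('a) + 1) * offline_opt N f T)"
  proof -
    have "S \<le> (real DIM('a) + 1) * path_cost N f T q" if qT: "q \<in> paths T" for q :: "(real \<Rightarrow> 'a) \<times> (real \<Rightarrow> 'a)"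
    proof -
      obtain p p' where q: "q = (p, p')" "p 0 = 0" "segment_path 0 T p p'"
        using T0 qT by (cases q) (auto simp: paths_iff_segment)
      have "W T (p T) \<le> path_cost N f T q"
        using work_function_le[OF T0 order_refl q(2,3)] path_cost_eq[OF q(3)] q(1) by simp
      then have "(real DIM('a) + 1) * W T (p T) \<le> (real DIM('a) + 1) * path_cost N f T q"
        by (intro mult_left_mono) auto
      with S[of "p T"] show ?thesis by linarith
    qed
    moreover have "(\<lambda>_. 0, \<lambda>_. 0) \<in> (paths T :: ((real \<Rightarrow> 'a) \<times> (real \<Rightarrow> 'a)) set)"
      using T0 by (simp add: paths_iff_segment segment_path_const)
    ultimately have "S \<le> (real DIM('a) + 1) * offline_opt N f T"
      unfolding offline_opt_def by (intro le_mult_cINF) (auto simp: add_nonneg_pos)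
    then show ?thesis by simp
  qed
  finally show ?thesis .
qed

end

section \<open>Requests that are constant on an interval\<close>

lemma affine_image_interval:
  fixes a u \<mu> :: real
  assumes "\<mu> > 0" "a \<le> u"
  shows "(\<lambda>v. (a - \<mu> * a) + \<mu> *\<^sub>R v) ` {a..u} = {a..a + \<mu> * (u - a)}"
proof -
  have "(\<lambda>v. (a - \<mu> * a) + \<mu> *\<^sub>R v) ` {a..u} = (\<lambda>v. \<mu> * v + (a - \<mu> * a)) ` {a..u}"
    by (intro image_cong) auto
  also have "\<dots> = {a..a + \<mu> * (u - a)}"
    using image_affinity_atLeastAtMost[of \<mu> "a - \<mu> * a" a u] assms by (simp add: algebra_simps)
  finally show ?thesis .
qed

text \<open>The time change fixes \<open>a\<close> and sends \<open>t\<close> to \<open>s\<close>.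
  It is written as translation after scaling to match
  \<open>absolutely_integrable_affine\<close>.\<close>

lemma segment_path_rescale:
  fixes p :: "real \<Rightarrow> 'a::euclidean_space"
  assumes p: "segment_path a s p p'" and "a < s" "a < t"
  defines "\<mu> \<equiv> (s - a) / (t - a)"
  shows "segment_path a t (\<lambda>u. p ((a - \<mu> * a) + \<mu> *\<^sub>R u)) (\<lambda>u. \<mu> *\<^sub>R p' ((a - \<mu> * a) + \<mu> *\<^sub>R u))"
proof -
  have l: "\<mu> > 0" using assms by (simp add: \<mu>_def)
  have lt: "\<mu> * (t - a) = s - a" using assms by (simp add: \<mu>_def)
  note im = affine_image_interval[OF l]
  have ab: "p' absolutely_integrable_on (\<lambda>v. (a - \<mu> * a) + \<mu> *\<^sub>R v) ` {a..u}" if "a \<le> u" "u \<le> t" for u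
  proof -
    have "\<mu> * (u - a) \<le> s - a" using that l lt by (metis diff_right_mono less_imp_le mult_left_mono)
    then show ?thesis
      unfolding im[OF that(1)] by (intro set_integrable_subset[OF segment_pathD(1)[OF p]]) auto
  qed
  show ?thesis unfolding segment_path_def
  proof (intro conjI ballI)
    show "(\<lambda>u. \<mu> *\<^sub>R p' ((a - \<mu> * a) + \<mu> *\<^sub>R u)) absolutely_integrable_on {a..t}"
      using absolutely_integrable_affine(1)[OF l ab[of t]] assms by (intro absolutely_integrable_scaleR_left) simp
    fix u assume u: "u \<in> {a..t}"
    have le: "a + \<mu> * (u - a) \<le> s"
    proof -
      have "\<mu> * (u - a) \<le> \<mu> * (t - a)" using u l by (intro mult_left_mono) auto
      then show ?thesis using lt by simp
    qed
    have ge: "a \<le> a + \<mu> * (u - a)" using u l by simp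
    have e1: "(a - \<mu> * a) + \<mu> *\<^sub>R u = a + \<mu> * (u - a)" for u by (simp add: algebra_simps)
    have "p (a + \<mu> * (u - a)) = p a + integral {a..a + \<mu> * (u - a)} p'"
      by (rule segment_pathD(2)[OF p ge le])
    also have "integral {a..a + \<mu> * (u - a)} p' = \<mu> *\<^sub>R integral {a..u} (\<lambda>v. p' ((a - \<mu> * a) + \<mu> *\<^sub>R v))"
      using absolutely_integrable_affine(2)[OF l ab[of u]] u im[of a u] by simp
    also have "\<dots> = integral {a..u} (\<lambda>v. \<mu> *\<^sub>R p' ((a - \<mu> * a) + \<mu> *\<^sub>R v))" by simp
    finally show "p ((a - \<mu> * a) + \<mu> *\<^sub>R u) = p ((a - \<mu> * a) + \<mu> *\<^sub>R a) +
        integral {a..u} (\<lambda>v. \<mu> *\<^sub>R p' ((a - \<mu> * a) + \<mu> *\<^sub>R v))"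
      unfolding e1[of u] by simp
  qed
qed

lemma integral_rescale:
  fixes g :: "real \<Rightarrow> 'a::euclidean_space"
  assumes g: "g absolutely_integrable_on {a..s}" and "a < s" "a < t"
  defines "\<mu> \<equiv> (s - a) / (t - a)"
  shows "integral {a..s} g = \<mu> *\<^sub>R integral {a..t} (\<lambda>u. g ((a - \<mu> * a) + \<mu> *\<^sub>R u))"
proof -
  have l: "\<mu> > 0" using assms by (simp add: \<mu>_def)
  have "(\<lambda>v. (a - \<mu> * a) + \<mu> *\<^sub>R v) ` {a..t} = {a..a + \<mu> * (t - a)}"
    using l assms by (intro affine_image_interval) auto
  also have "a + \<mu> * (t - a) = s" using assms by (simp add: \<mu>_def)
  finally have im: "(\<lambda>v. (a - \<mu> * a) + \<mu> *\<^sub>R v) ` {a..t} = {a..s}" .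
  show ?thesis
    using absolutely_integrable_affine(2)[OF l, where g=g and t="a - \<mu> * a" and S="{a..t}"] g unfolding im by simp
qed

context chasing
begin

text \<open>Waiting at the minimiser of time \<open>s\<close> until \<open>t\<close> is one way to
  compete at time \<open>t\<close>.\<close>

lemma conj_value_le_step:
  assumes st: "0 \<le> s" "s < t" "t \<le> T" and v: "v \<in> interior (dual_ball N)"
  shows "conj_value (W t) v \<le> conj_value (W s) v + integral {s..t} (\<lambda>r. f r (conj_point (W s) v))"
proof -
  let ?w = "conj_point (W s) v"
  have "conj_value (W t) v \<le> W t ?w - v \<bullet> ?w"
    using st by (intro conj_value_le[OF N _ v] work_function_dominates) auto
  also have "W t ?w \<le> W s ?w + integral {s..t} (\<lambda>r. f r ?w)"
    using work_function_step[OF st, of ?w ?w] norm_fun_zero[OF N] by simp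
  finally show ?thesis by (simp add: conj_value_def)
qed

end

locale constant_request = chasing +
  fixes a b :: real and \<phi> :: "'a \<Rightarrow> real"
  assumes ab: "0 \<le> a" "a < b" "b \<le> T" and const: "\<And>s. a \<le> s \<Longrightarrow> s < b \<Longrightarrow> f s = \<phi>"
begin

lemma integral_const_request:
  assumes "a \<le> s" "t \<le> b"
  shows "integral {s..t} (\<lambda>r. f r (p r)) = integral {s..t} (\<lambda>r. \<phi> (p r))"
  by (rule integral_spike[where S="{b}"]) (use assms const in auto)

text \<open>Slowing a path down on \<open>[a, t]\<close> leaves its length unchanged and multiplies its request cost
  by the stretching factor.\<close>

lemma conj_value_rescale:
  assumes st: "a < s" "s < t" "t \<le> b" and v: "v \<in> interior (dual_ball N)"
  shows "conj_value (W t) v \<le> conj_value (W s) v + (t - s) / (s - a) * W T 0"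
proof -
  define w where "w = conj_point (W s) v"
  define \<mu> where "\<mu> = (s - a) / (t - a)"
  define \<kappa> where "\<kappa> = (t - s) / (s - a)"
  have l: "\<mu> > 0" using st by (simp add: \<mu>_def)
  have k: "\<kappa> \<ge> 0" "1 / \<mu> = 1 + \<kappa>" using st by (auto simp: \<kappa>_def \<mu>_def field_simps)
  have dom: "dominates (W t) N" "dominates (W s) N" using st ab by (auto intro: work_function_dominates)
  have v': "v \<in> dual_ball N" using v interior_subset by blast
  have "conj_value (W t) v \<le> conj_value (W s) v * (1 + \<kappa>)"
  proof (rule field_le_epsilon)
    fix e :: real assume e: "e > 0"
    define \<eta> where "\<eta> = e / (1 + \<kappa>)"
    have eta: "\<eta> > 0" "\<eta> * (1 + \<kappa>) = e" using e k(1) by (auto simp: \<eta>_def)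
    obtain p p' where p: "p 0 = 0" "segment_path 0 s p p'" "p s = w" "seg_cost 0 s p p' < W s w + \<eta>"
      using work_function_near[of s \<eta> w] st ab eta by auto
    have pa: "segment_path 0 a p p'" "segment_path a s p p'" using segment_path_sub[OF p(2)] st ab by auto
    let ?\<sigma> = "\<lambda>u. (a - \<mu> * a) + \<mu> *\<^sub>R u"
    let ?r = "\<lambda>u. p (?\<sigma> u)" and ?r' = "\<lambda>u. \<mu> *\<^sub>R p' (?\<sigma> u)"
    have r: "segment_path a t ?r ?r'"
      using segment_path_rescale[OF pa(2)] st unfolding \<mu>_def by simp
    have eq: "p a = ?r a" by simp
    have rt: "?r t = w"
    proof -
      have "?\<sigma> t = a + \<mu> * (t - a)" by (simp add: algebra_simps)
      also have "\<dots> = s" using st by (simp add: \<mu>_def)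
      finally show ?thesis using p(3) by simp
    qed
    define I where "I = integral {a..s} (\<lambda>u. f u (p u))"
    define len where "len = integral {a..s} (\<lambda>u. N (p' u))"
    have fa: "(\<lambda>u. \<phi> (p u)) absolutely_integrable_on {a..s}"
    proof -
      have "(\<lambda>u. f u (p u)) absolutely_integrable_on {a..s}"
        using segment_integrable(1)[OF pa(2)] st ab f_nonneg
        by (intro nonnegative_absolutely_integrable_1) auto
      then show ?thesis
        by (rule absolutely_integrable_spike[where S="{}"]) (use st const in auto)
    qed
    have Na: "(\<lambda>u. N (p' u)) absolutely_integrable_on {a..s}"
      using norm_fun_absolutely_integrable[OF N segment_pathD(1)[OF pa(2)]] by simp
    have i1: "\<mu> * integral {a..t} (\<lambda>u. f u (?r u)) = I"
      using integral_rescale[OF fa, of t] st integral_const_request[of a t ?r] integral_const_request[of a s p]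
      by (simp add: I_def \<mu>_def)
    have i2: "integral {a..t} (\<lambda>u. N (?r' u)) = len"
      using integral_rescale[OF Na, of t] st l by (simp add: len_def \<mu>_def norm_funD(3)[OF N])
    let ?q = "\<lambda>u. if u \<le> a then p u else ?r u" and ?q' = "\<lambda>u. if u \<le> a then p' u else ?r' u"
    have q: "segment_path 0 t ?q ?q'" using segment_path_join[OF pa(1) r eq] ab st by simp
    have qc: "seg_cost 0 t ?q ?q' = seg_cost 0 a p p' + seg_cost a t ?r ?r'"
      using seg_cost_join[OF pa(1) r eq] ab st by simp
    have "W t (?q t) \<le> seg_cost 0 t ?q ?q'"
      by (rule work_function_le) (use q p ab st in auto)
    then have Wt: "W t w \<le> seg_cost 0 a p p' + seg_cost a t ?r ?r'" using qc rt st by simp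
    have "integral {a..t} (\<lambda>u. f u (?r u)) = I * (1 + \<kappa>)"
      unfolding k(2)[symmetric] i1[symmetric] using l by simp
    then have rc: "seg_cost a t ?r ?r' = I * (1 + \<kappa>) + len" using i2 by (simp add: seg_cost_def)
    have pc: "seg_cost 0 s p p' = seg_cost 0 a p p' + (I + len)"
      using seg_cost_combine[OF p(2)] ab st by (simp add: seg_cost_def[of a s] I_def len_def)
    have nn: "integral {0..a} (\<lambda>u. f u (p u)) \<ge> 0" using segment_parts_nonneg(1)[OF pa(1)] ab by simp
    have "N w \<le> integral {0..s} (\<lambda>u. N (p' u))"
      using segment_length[OF p(2), of 0 s] p ab st by simp
    also have "\<dots> = integral {0..a} (\<lambda>u. N (p' u)) + len" unfolding len_def
      by (rule Henstock_Kurzweil_Integration.integral_combine[symmetric])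
         (use segment_integrable(2)[OF p(2)] ab st in auto)
    finally have "N w + I \<le> seg_cost 0 s p p'" using pc nn by (simp add: seg_cost_def[of 0 a])
    moreover have "v \<bullet> w \<le> N w" using v' unfolding dual_ball_iff[OF N] by blast
    \<comment> \<open>The length of the path already pays for \<open>v \<bullet> w\<close>, so the
      service on \<open>{a..s}\<close>, the only part that stretching increases, is bounded by the
      conjugate.\<close>
    ultimately have "I \<le> conj_value (W s) v + \<eta>" using p(4) by (simp add: conj_value_def w_def)
    then have "\<kappa> * I \<le> \<kappa> * (conj_value (W s) v + \<eta>)" using k(1) by (rule mult_left_mono)
    moreover have "conj_value (W t) v \<le> W t w - v \<bullet> w" by (rule conj_value_le[OF N dom(1) v])
    moreover have "conj_value (W s) v = W s w - v \<bullet> w" by (simp add: conj_value_def w_def)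
    ultimately have "conj_value (W t) v \<le> conj_value (W s) v + \<eta> + \<kappa> * (conj_value (W s) v + \<eta>)"
      using Wt rc pc p(4) by (simp add: distrib_left mult.commute)
    also have "\<dots> = conj_value (W s) v * (1 + \<kappa>) + e" using eta(2) by (simp add: algebra_simps)
    finally show "conj_value (W t) v \<le> conj_value (W s) v * (1 + \<kappa>) + e" .
  qed
  moreover have "conj_value (W s) v \<le> W T 0"
    using conj_value_le_zero[OF N dom(2) v] work_function_mono[of s T 0] st ab by simp
  then have "\<kappa> * conj_value (W s) v \<le> \<kappa> * W T 0" using k(1) by (rule mult_left_mono)
  ultimately show ?thesis by (simp add: \<kappa>_def algebra_simps)
qed

text \<open>\<open>conj_value_rescale\<close> degenerates at \<open>a\<close>, where there is no
  elapsed part of the interval to stretch. Waiting gives pointwise convergence of the conjugates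
  there, and semicontinuity of the potential does the rest; one \<open>u\<close> suffices by
  monotonicity.\<close>

lemma potential_right_continuous:
  assumes e: "e > 0"
  shows "\<exists>u. a < u \<and> u \<le> b \<and> scaled_potential 1 u < scaled_potential 1 a + e"
proof -
  define u where "u n = a + (b - a) / real (Suc n)" for n
  have u: "a < u n" "u n \<le> b" for n
  proof -
    have "(b - a) / real (Suc n) \<le> (b - a) / 1" using ab by (intro divide_left_mono) auto
    then show "a < u n" "u n \<le> b" using ab by (auto simp: u_def)
  qed
  have ulim: "u \<longlonglongrightarrow> a"
  proof -
    have "(\<lambda>n. a + (b - a) * inverse (real (Suc n))) \<longlonglongrightarrow> a + (b - a) * 0"
      by (intro tendsto_intros LIMSEQ_inverse_real_of_nat)
    then show ?thesis by (simp add: u_def[abs_def] divide_inverse)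
  qed
  have lim: "(\<lambda>n. conj_value (W (u n)) v) \<longlonglongrightarrow> conj_value (W a) v" if v: "v \<in> interior (dual_ball N)" for v
  proof -
    obtain C where C: "C > 0" "\<And>t x. t \<in> {0..T} \<Longrightarrow> norm x \<le> norm (conj_point (W a) v) \<Longrightarrow> f t x \<le> C"
      using f_bounded[of "norm (conj_point (W a) v)"] by blast
    have up: "conj_value (W (u n)) v \<le> conj_value (W a) v + (u n - a) * C" for n
    proof -
      have "integral {a..u n} (\<lambda>r. f r (conj_point (W a) v)) \<le> integral {a..u n} (\<lambda>r. C)"
        using u[of n] ab C(2) by (intro integral_le f_const_integrable integrable_const_ivl) auto
      then show ?thesis
        using conj_value_le_step[OF _ _ _ v, of a "u n"] u[of n] ab by simp
    qed
    have lo: "conj_value (W a) v \<le> conj_value (W (u n)) v" for n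
      using u[of n] ab by (intro conj_value_time_mono v) auto
    have "(\<lambda>n. conj_value (W a) v + (u n - a) * C) \<longlonglongrightarrow> conj_value (W a) v + (a - a) * C"
      by (intro tendsto_intros ulim)
    then have l: "(\<lambda>n. conj_value (W a) v + (u n - a) * C) \<longlonglongrightarrow> conj_value (W a) v" by simp
    show ?thesis
      by (rule tendsto_sandwich[OF always_eventually always_eventually tendsto_const l]) (use up lo in auto)
  qed
  have "\<forall>\<^sub>F n in sequentially. steiner_potential N (W (u n)) < steiner_potential N (W a) + e"
  proof (rule steiner_potential_upper_limit[OF N _ _ _ lim e])
    show "dominates (W a) N" using ab by (intro work_function_dominates) auto
    show "dominates (W (u n)) N" for n using u[of n] ab by (intro work_function_dominates) auto
    show "W (u n) 0 \<le> W T 0" for n using u[of n] ab by (intro work_function_mono) auto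
  qed
  then obtain n where "steiner_potential N (W (u n)) < steiner_potential N (W a) + e"
    using eventually_happens'[OF sequentially_bot] by blast
  then show ?thesis using u[of n] by auto
qed

text \<open>The potential is a modulus for the path, so only its continuity is at stake: right of
  \<open>a\<close> through the rescaling bound, at \<open>a\<close> through
  \<open>potential_right_continuous\<close>.\<close>

lemma steiner_path_continuous: "continuous_on {a..b} (steiner_path N f)"
proof -
  let ?P = "scaled_potential 1" and ?X = "steiner_path N f"
  obtain c where c: "c > 0" "\<And>x. c * norm x \<le> N x" using norm_fun_lower[OF N] by blast
  have XP: "c * norm (?X t - ?X s) \<le> \<bar>?P t - ?P s\<bar>" if "s \<in> {a..b}" "t \<in> {a..b}" for s t
  proof -
    have "N (?X t - ?X s) \<le> \<bar>?P t - ?P s\<bar>"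
    proof (cases "s \<le> t")
      case True
      then show ?thesis using steiner_path_movement[of s t] that ab by auto
    next
      case False
      then show ?thesis
        using steiner_path_movement[of t s] that ab norm_fun_diff_commute[OF N, of "?X t" "?X s"] by auto
    qed
    then show ?thesis using c(2) by (rule order_trans[rotated])
  qed
  have Pmono: "?P s \<le> ?P t" if "a \<le> s" "s \<le> t" "t \<le> b" for s t
    using that ab by (intro scaled_potential_mono) auto
  define D where "D = real DIM('a) * W T 0"
  have Pinc: "?P t - ?P s \<le> D * ((t - s) / (s - a))" if st: "a < s" "s < t" "t \<le> b" for s t
  proof -
    have "steiner_potential N (W t) \<le> steiner_potential N (W s) + real DIM('a) * ((t - s) / (s - a) * W T 0)"
      using st ab by (intro steiner_potential_mono N conj_value_rescale work_function_dominates) auto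
    then show ?thesis by (simp add: D_def mult_ac)
  qed
  have "(?P \<longlongrightarrow> ?P s) (at s within {a..b})" if s: "s \<in> {a..b}" for s
  proof (cases "s = a")
    case False
    then have sa: "a < s" using s by auto
    have D0: "D \<ge> 0" unfolding D_def using dominates_zero_nonneg[OF N work_function_dominates[OF T0 order_refl]] by simp
    \<comment> \<open>The denominator belongs to the earlier of the two times, so one majorant
      serves both one-sided limits; near \<open>s > a\<close> it stays away from 0.\<close>
    have "((\<lambda>t. D * (\<bar>t - s\<bar> / (min s t - a))) \<longlongrightarrow> D * (\<bar>s - s\<bar> / (min s s - a))) (at s within {a..b})"
      using sa by (intro tendsto_intros) auto
    then have lim: "((\<lambda>t. D * (\<bar>t - s\<bar> / (min s t - a))) \<longlongrightarrow> 0) (at s within {a..b})" by simp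
    have "\<forall>\<^sub>F t in at s within {a..b}. a < t"
      using sa by (intro order_tendstoD(1)[OF tendsto_ident_at])
    moreover have "\<forall>\<^sub>F t in at s within {a..b}. t \<in> {a..b}" by (simp add: eventually_at_filter)
    ultimately have "\<forall>\<^sub>F t in at s within {a..b}. norm (?P t - ?P s) \<le> D * (\<bar>t - s\<bar> / (min s t - a))"
    proof eventually_elim
      case (elim t)
      consider "t < s" | "t = s" | "s < t" by linarith
      then show ?case
      proof cases
        case 1
        then show ?thesis using Pinc[of t s] Pmono[of t s] elim s by (simp add: abs_if min_def)
      next
        case 2
        then show ?thesis by simp
      next
        case 3
        then show ?thesis using Pinc[of s t] Pmono[of s t] elim s sa by (simp add: abs_if min_def)
      qed
    qed
    then have "((\<lambda>t. ?P t - ?P s) \<longlongrightarrow> 0) (at s within {a..b})" by (rule Lim_null_comparison[OF _ lim])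
    then show ?thesis by (rule LIM_zero_cancel)
  next
    case True
    show ?thesis unfolding True
    proof (rule order_tendstoI)
      fix y assume y: "y < ?P a"
      have "\<forall>\<^sub>F t in at a within {a..b}. t \<in> {a..b}" by (simp add: eventually_at_filter)
      then show "\<forall>\<^sub>F t in at a within {a..b}. y < ?P t"
        by (rule eventually_mono) (use Pmono[of a] y in fastforce)
    next
      fix y assume "?P a < y"
      then obtain u where u: "a < u" "u \<le> b" "?P u < ?P a + (y - ?P a)"
        using potential_right_continuous[of "y - ?P a"] by auto
      have "\<forall>\<^sub>F t in at a within {a..b}. t \<in> {a..b}" by (simp add: eventually_at_filter)
      moreover have "\<forall>\<^sub>F t in at a within {a..b}. t < u"
        using u(1) by (intro order_tendstoD(2)[OF tendsto_ident_at])
      ultimately show "\<forall>\<^sub>F t in at a within {a..b}. ?P t < y"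
      proof eventually_elim
        case (elim t)
        then show ?case using Pmono[of t u] u by auto
      qed
    qed
  qed
  note Plim = this
  show ?thesis unfolding continuous_on_def
  proof
    fix s assume s: "s \<in> {a..b}"
    from Plim[OF s] show "(?X \<longlongrightarrow> ?X s) (at s within {a..b})"
      by (rule tendsto_of_modulus[where K="1 / c"]) (use XP[OF s] c(1) in \<open>simp add: pos_le_divide_eq mult.commute\<close>)
  qed
qed

end

section \<open>Chasing convex bodies\<close>

definition norm_infdist :: "('a::real_vector \<Rightarrow> real) \<Rightarrow> 'a set \<Rightarrow> 'a \<Rightarrow> real" where
  "norm_infdist N K x = (INF y \<in> K. N (x - y))"

lemma body_request_eq: "body_request N K n = (\<lambda>x. 3 * norm_infdist N (K n) x)"
  by (simp add: body_request_def norm_infdist_def fun_eq_iff)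

context
  fixes N :: "'a::euclidean_space \<Rightarrow> real" and K :: "'a set"
  assumes N: "norm_fun N" and K: "K \<noteq> {}"
begin

lemma norm_infdist_nonneg: "norm_infdist N K x \<ge> 0"
  unfolding norm_infdist_def by (intro cINF_greatest K norm_funD(1)[OF N])

lemma norm_infdist_le: "y \<in> K \<Longrightarrow> norm_infdist N K x \<le> N (x - y)"
  unfolding norm_infdist_def
  by (rule cINF_lower) (auto intro!: bdd_belowI[of _ 0] norm_funD(1)[OF N])

lemma norm_infdist_zero: "x \<in> K \<Longrightarrow> norm_infdist N K x = 0"
  using norm_infdist_le[of x x] norm_infdist_nonneg[of x] norm_fun_zero[OF N] by simp

lemma norm_infdist_near:
  assumes "e > 0"
  obtains y where "y \<in> K" "N (x - y) < norm_infdist N K x + e"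
proof -
  have "\<exists>y\<in>K. N (x - y) < norm_infdist N K x + e"
  proof (rule ccontr)
    assume "\<not> ?thesis"
    then have "norm_infdist N K x + e \<le> (INF y \<in> K. N (x - y))"
      by (intro cINF_greatest K) (meson not_le)
    then show False using assms by (simp add: norm_infdist_def)
  qed
  then show thesis using that by blast
qed

lemma norm_infdist_eq_0:
  assumes "closed K" "norm_infdist N K x = 0"
  shows "x \<in> K"
proof -
  obtain c where c: "c > 0" "\<And>x. c * norm x \<le> N x" using norm_fun_lower[OF N] by blast
  have "\<exists>y\<in>K. dist y x < e" if e: "e > 0" for e
  proof -
    have "c * e > 0" using c e by simp
    then obtain y where y: "y \<in> K" "N (x - y) < norm_infdist N K x + c * e" by (rule norm_infdist_near)
    have "c * norm (x - y) < c * e" using c(2)[of "x - y"] y(2) assms(2) by simp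
    then have "dist y x < e" using c(1) by (simp add: dist_norm norm_minus_commute)
    then show ?thesis using y(1) by blast
  qed
  then have "x \<in> closure K" by (simp add: closure_approachable)
  then show ?thesis using assms(1) by simp
qed

lemma norm_infdist_convex:
  assumes "convex K"
  shows "convex_on UNIV (norm_infdist N K)"
  unfolding convex_on_def
proof (intro conjI ballI allI impI)
  fix x y :: 'a and u v :: real
  assume uv: "0 \<le> u" "0 \<le> v" "u + v = 1"
  show "norm_infdist N K (u *\<^sub>R x + v *\<^sub>R y) \<le> u * norm_infdist N K x + v * norm_infdist N K y"
  proof (rule field_le_epsilon)
    fix e :: real assume e: "e > 0"
    obtain y1 where y1: "y1 \<in> K" "N (x - y1) < norm_infdist N K x + e" using norm_infdist_near[OF e] .
    obtain y2 where y2: "y2 \<in> K" "N (y - y2) < norm_infdist N K y + e" using norm_infdist_near[OF e] .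
    have "u *\<^sub>R y1 + v *\<^sub>R y2 \<in> K" using assms y1(1) y2(1) uv by (rule convexD)
    then have "norm_infdist N K (u *\<^sub>R x + v *\<^sub>R y) \<le> N ((u *\<^sub>R x + v *\<^sub>R y) - (u *\<^sub>R y1 + v *\<^sub>R y2))"
      by (rule norm_infdist_le)
    also have "(u *\<^sub>R x + v *\<^sub>R y) - (u *\<^sub>R y1 + v *\<^sub>R y2) = u *\<^sub>R (x - y1) + v *\<^sub>R (y - y2)"
      by (simp add: algebra_simps)
    also have "N \<dots> \<le> u * N (x - y1) + v * N (y - y2)"
      using norm_funD(4)[OF N, of "u *\<^sub>R (x - y1)" "v *\<^sub>R (y - y2)"] uv by (simp add: norm_funD(3)[OF N])
    also have "\<dots> \<le> u * (norm_infdist N K x + e) + v * (norm_infdist N K y + e)"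
      using y1(2) y2(2) uv by (intro add_mono mult_left_mono) auto
    also have "\<dots> = u * norm_infdist N K x + v * norm_infdist N K y + (u + v) * e" by (simp add: algebra_simps)
    finally show "norm_infdist N K (u *\<^sub>R x + v *\<^sub>R y) \<le> u * norm_infdist N K x + v * norm_infdist N K y + e"
      using uv(3) by simp
  qed
qed simp

end

context constant_request
begin

text \<open>A path ending outside \<open>K\<close> is beaten by going straight to a point of \<open>K\<close> near the path's
  closest approach and waiting there: the request cost saved exceeds the detour.\<close>

lemma conj_point_in_body:
  assumes K: "closed K" "K \<noteq> {}" and phi: "\<phi> = (\<lambda>x. 3 * norm_infdist N K x)" and len: "b - a = 1"
    and v: "v \<in> interior (dual_ball N)"
  shows "conj_point (W b) v \<in> K"
proof (rule ccontr)
  let ?d = "norm_infdist N K"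
  define w where "w = conj_point (W b) v"
  assume "conj_point (W b) v \<notin> K"
  then have D: "?d w > 0"
    using norm_infdist_eq_0[OF N K(2,1), of w] norm_infdist_nonneg[OF N K(2), of w] by (auto simp: w_def less_le)
  obtain r where r: "0 < r" "r < 1" "\<And>w. v \<bullet> w \<le> r * N w"
    using v unfolding interior_dual_ball_iff[OF N] by blast
  \<comment> \<open>The comparison below gives \<open>(1 - r) * N (w - y0) < 3 * e\<close>, whereas
    the left side is at least \<open>(1 - r) * ?d w = 4 * e\<close>.\<close>
  define e where "e = (1 - r) * ?d w / 4"
  have e: "e > 0" using D r by (simp add: e_def)
  have dom: "dominates (W b) N" using ab by (intro work_function_dominates) auto
  obtain p p' where p: "p 0 = 0" "segment_path 0 b p p'" "p b = w" "seg_cost 0 b p p' < W b w + e"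
    using work_function_near[of b e w] ab e by auto
  have pa: "segment_path 0 a p p'" "segment_path a b p p'" using segment_path_sub[OF p(2)] ab by auto
  have cvx: "convex_on UNIV \<phi>" using f_convex[of a] const[of a] ab by simp
  then have "continuous_on UNIV \<phi>" by (rule convex_on_continuous[OF open_UNIV])
  then have "continuous_on {a..b} (\<lambda>s. \<phi> (p s))"
    by (rule continuous_on_compose2[OF _ segment_path_continuous[OF pa(2)]]) auto
  then obtain s0 where s0: "s0 \<in> {a..b}" "\<And>s. s \<in> {a..b} \<Longrightarrow> \<phi> (p s0) \<le> \<phi> (p s)"
    using continuous_attains_inf[of "{a..b}" "\<lambda>s. \<phi> (p s)"] ab by auto
  define \<delta> where "\<delta> = ?d (p s0)"
  have d0: "\<delta> \<ge> 0" unfolding \<delta>_def by (rule norm_infdist_nonneg[OF N K(2)])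
  obtain y0 where y0: "y0 \<in> K" "N (p s0 - y0) < \<delta> + e"
    using norm_infdist_near[OF N K(2) e] unfolding \<delta>_def by blast
  define l1 where "l1 = integral {a..s0} (\<lambda>u. N (p' u))"
  define l2 where "l2 = integral {s0..b} (\<lambda>u. N (p' u))"
  \<comment> \<open>The interval has length 1 and \<open>s0\<close> minimises the request along the
    path. The saving of three \<delta> covers the excess of about one \<delta> in reaching
    \<open>y0\<close> (\<open>t1\<close>) and of another in the distance from \<open>y0\<close> to
    \<open>w\<close> (\<open>t2\<close>).\<close>
  have I: "3 * \<delta> \<le> integral {a..b} (\<lambda>u. f u (p u))"
  proof -
    have "integral {a..b} (\<lambda>u. 3 * \<delta>) \<le> integral {a..b} (\<lambda>u. \<phi> (p u))"
    proof (rule integral_le)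
      show "(\<lambda>u. \<phi> (p u)) integrable_on {a..b}"
        by (rule integrable_continuous_real) fact
      show "3 * \<delta> \<le> \<phi> (p u)" if "u \<in> {a..b}" for u using s0(2)[OF that] by (simp add: phi \<delta>_def)
    qed (rule integrable_const_ivl)
    then show ?thesis using len ab integral_const_request[of a b p] by simp
  qed
  have cost: "seg_cost 0 b p p' \<ge> W a (p a) + 3 * \<delta> + (l1 + l2)"
  proof -
    have "seg_cost 0 b p p' = seg_cost 0 a p p' + seg_cost a b p p'"
      using seg_cost_combine[OF p(2)] ab by simp
    moreover have "W a (p a) \<le> seg_cost 0 a p p'" using work_function_le[OF _ _ p(1) pa(1)] ab by simp
    moreover have "l1 + l2 = integral {a..b} (\<lambda>u. N (p' u))"
      unfolding l1_def l2_def using s0(1) segment_integrable(2)[OF pa(2)] ab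
      by (intro Henstock_Kurzweil_Integration.integral_combine) auto
    ultimately show ?thesis using I by (simp add: seg_cost_def[of a b])
  qed
  have up: "W b y0 \<le> W a (p a) + N (y0 - p a)"
  proof -
    have "integral {a..b} (\<lambda>u. f u y0) = integral {a..b} (\<lambda>u. \<phi> y0)"
      using integral_const_request[of a b "\<lambda>_. y0"] by simp
    also have "\<dots> = 0" by (simp add: phi norm_infdist_zero[OF N K(2) y0(1)])
    finally show ?thesis using work_function_step[of a b y0 "p a"] ab by simp
  qed
  have t1: "N (y0 - p a) \<le> \<delta> + e + l1"
    using norm_fun_triangle[OF N, of y0 "p a" "p s0"] norm_fun_diff_commute[OF N, of y0 "p s0"] y0(2)
      segment_length[OF pa(2), of a s0] s0(1) ab by (simp add: l1_def)
  have t2: "N (w - y0) \<le> l2 + \<delta> + e"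
    using norm_fun_triangle[OF N, of w y0 "p s0"] y0(2) segment_length[OF pa(2), of s0 b] s0(1) ab p(3)
    by (simp add: l2_def)
  have "conj_value (W b) v \<le> W b y0 - v \<bullet> y0" by (rule conj_value_le[OF N dom v])
  then have "W b w \<le> W b y0 + v \<bullet> (w - y0)" by (simp add: conj_value_def w_def inner_diff_right)
  also have "v \<bullet> (w - y0) \<le> r * N (w - y0)" by (rule r(3))
  finally have "(1 - r) * N (w - y0) < 3 * e"
    using up t1 t2 cost p(4) d0 by (simp add: left_diff_distrib)
  moreover have "(1 - r) * ?d w \<le> (1 - r) * N (w - y0)"
    using r norm_infdist_le[OF N K(2) y0(1)] by (intro mult_left_mono) auto
  ultimately show False using e by (simp add: e_def)
qed

lemma steiner_path_in_body:
  assumes K: "closed K" "K \<noteq> {}" "convex K" and phi: "\<phi> = (\<lambda>x. 3 * norm_infdist N K x)" and len: "b - a = 1"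
  shows "steiner_path N f b \<in> K"
proof -
  have dom: "dominates (W b) N" using ab by (intro work_function_dominates) auto
  have "conj_point (W b) integrable_on interior (dual_ball N)"
    using conj_point_absolutely_integrable[OF N dom] by (simp add: absolutely_integrable_on_def)
  then have "(1 / measure lebesgue (interior (dual_ball N))) *\<^sub>R integral (interior (dual_ball N)) (conj_point (W b)) \<in> K"
    by (rule integral_average_in_convex[OF interior_dual_ball_lmeasurable[OF N] measure_interior_dual_ball_pos[OF N]])
       (use K conj_point_in_body[OF K(1,2) phi len] in auto)
  then show ?thesis by (simp add: steiner_path_def functional_steiner_eq[OF N dom])
qed

end

section \<open>Discrete requests\<close>

text \<open>The step requests on \<open>[0, m]\<close> mention request \<open>m + 1\<close> at time \<open>m\<close>, which need not be convex.\<close>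

definition truncated_requests :: "nat \<Rightarrow> (nat \<Rightarrow> 'a \<Rightarrow> real) \<Rightarrow> real \<Rightarrow> 'a \<Rightarrow> real" where
  "truncated_requests m f s = (if s < real m then step_requests f s else (\<lambda>_. 0))"

lemma step_requests_eq:
  assumes "1 \<le> n" "real n - 1 \<le> s" "s < real n"
  shows "step_requests f s = f n"
proof -
  have "\<lfloor>s\<rfloor> = int n - 1" using assms by (simp add: floor_eq_iff)
  then have "nat \<lfloor>s\<rfloor> = n - 1" by simp
  then show ?thesis using assms(1) by (simp add: step_requests_def)
qed

lemma truncated_requests_eq:
  assumes "n \<in> {1..m}" "real n - 1 \<le> s" "s < real n"
  shows "truncated_requests m f s = f n"
  using assms step_requests_eq[of n s f] by (simp add: truncated_requests_def)

lemma nat_floor_bounds: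
  assumes "s \<ge> 0"
  shows "real (Suc (nat \<lfloor>s\<rfloor>)) - 1 \<le> s" "s < real (Suc (nat \<lfloor>s\<rfloor>))"
proof -
  have "real (nat \<lfloor>s\<rfloor>) = of_int \<lfloor>s\<rfloor>" using assms by simp
  then show "real (Suc (nat \<lfloor>s\<rfloor>)) - 1 \<le> s" "s < real (Suc (nat \<lfloor>s\<rfloor>))"
    unfolding of_nat_Suc by linarith+
qed

lemma truncated_requests_cases:
  assumes "s \<ge> 0"
  obtains n where "n \<in> {1..m}" "real n - 1 \<le> s" "s < real n" "truncated_requests m f s = f n"
  | "truncated_requests m f s = (\<lambda>_. 0)"
proof (cases "s < real m")
  case True
  define n where "n = Suc (nat \<lfloor>s\<rfloor>)"
  have n: "real n - 1 \<le> s" "s < real n" using nat_floor_bounds[OF assms] by (simp_all only: n_def)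
  have "n \<ge> 1" by (simp add: n_def)
  moreover have "n \<le> m" using True n by linarith
  ultimately have "n \<in> {1..m}" by simp
  with n show thesis using that(1) truncated_requests_eq by blast
qed (use that(2) in \<open>simp add: truncated_requests_def\<close>)

lemma convex_truncated_requests:
  fixes f :: "nat \<Rightarrow> 'a::euclidean_space \<Rightarrow> real"
  assumes f: "\<forall>n\<in>{1..m}. convex_on UNIV (f n) \<and> (\<forall>x. f n x \<ge> 0)"
  shows "convex_requests (real m) (truncated_requests m f)"
  unfolding convex_requests_def
proof (intro conjI ballI)
  fix t assume "t \<in> {0..real m}"
  then have t: "t \<ge> 0" by simp
  show "convex_on UNIV (truncated_requests m f t)"
    using t by (rule truncated_requests_cases[of t m f]) (use f in \<open>auto simp: convex_on_def\<close>)
  show "\<forall>x. truncated_requests m f t x \<ge> 0"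
    using t by (rule truncated_requests_cases[of t m f]) (use f in auto)
next
  show "\<exists>D. finite D \<and> (\<forall>x. continuous_on ({0..real m} - D) (\<lambda>t. truncated_requests m f t x))"
  proof (intro exI conjI allI)
    show "finite (real ` {..m})" by simp
    fix x
    show "continuous_on ({0..real m} - real ` {..m}) (\<lambda>t. truncated_requests m f t x)"
      unfolding continuous_on_def
    proof
      fix s assume s: "s \<in> {0..real m} - real ` {..m}"
      then have "s \<noteq> real m" by auto
      with s have sm: "0 \<le> s" "s < real m" by auto
      define n where "n = Suc (nat \<lfloor>s\<rfloor>)"
      have n: "real n - 1 \<le> s" "s < real n" using nat_floor_bounds[OF sm(1)] by (simp_all only: n_def)
      have "n \<ge> 1" by (simp add: n_def)
      moreover have "n \<le> m" using sm n by linarith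
      ultimately have nm: "n \<in> {1..m}" by simp
      have "real (n - 1) \<in> real ` {..m}" using nm by (intro imageI) auto
      then have "s \<noteq> real (n - 1)" using s by (metis DiffD2)
      moreover have "real (n - 1) = real n - 1" using nm by (simp add: of_nat_diff)
      ultimately have n1: "real n - 1 < s" using n by linarith
      have "\<forall>\<^sub>F t in at s within {0..real m} - real ` {..m}. real n - 1 < t"
        using n1 by (intro order_tendstoD(1)[OF tendsto_ident_at])
      moreover have "\<forall>\<^sub>F t in at s within {0..real m} - real ` {..m}. t < real n"
        using n(2) by (intro order_tendstoD(2)[OF tendsto_ident_at])
      ultimately have "\<forall>\<^sub>F t in at s within {0..real m} - real ` {..m}.
          truncated_requests m f t x = truncated_requests m f s x"
      proof eventually_elim
        case (elim t)
        then show ?case using truncated_requests_eq[OF nm, of t f] truncated_requests_eq[OF nm n, of f] by simp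
      qed
      then show "((\<lambda>t. truncated_requests m f t x) \<longlongrightarrow> truncated_requests m f s x)
          (at s within {0..real m} - real ` {..m})"
        by (rule tendsto_eventually)
    qed
  qed
next
  show "\<forall>x. bounded ((\<lambda>t. truncated_requests m f t x) ` {0..real m})"
  proof
    fix x
    have "(\<lambda>t. truncated_requests m f t x) ` {0..real m} \<subseteq> insert 0 ((\<lambda>n. f n x) ` {1..m})"
    proof (rule image_subsetI)
      fix t assume "t \<in> {0..real m}"
      then have "t \<ge> 0" by simp
      then show "truncated_requests m f t x \<in> insert 0 ((\<lambda>n. f n x) ` {1..m})"
        by (rule truncated_requests_cases[of t m f]) auto
    qed
    then show "bounded ((\<lambda>t. truncated_requests m f t x) ` {0..real m})"
      by (rule bounded_subset[rotated]) (simp add: finite_imp_bounded)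
  qed
qed

text \<open>Up to time \<open>m\<close> the two request families differ at most at the single time
  \<open>m\<close>, which no integral sees.\<close>

lemma steiner_path_truncated:
  assumes "t \<le> real m"
  shows "steiner_path N (step_requests f) t = steiner_path N (truncated_requests m f) t"
proof -
  have "path_cost N (step_requests f) t q = path_cost N (truncated_requests m f) t q" for q
    unfolding path_cost_def case_prod_unfold
    by (rule integral_spike[where S="{real m}"]) (use assms in \<open>auto simp: truncated_requests_def\<close>)
  then have "work_function N (step_requests f) t = work_function N (truncated_requests m f) t"
    by (simp add: work_function_def fun_eq_iff)
  then show ?thesis by (simp add: steiner_path_def)
qed

section \<open>Runs of the discrete algorithm\<close>

locale discrete_chasing =
  fixes N :: "'a::euclidean_space \<Rightarrow> real" and f :: "nat \<Rightarrow> 'a \<Rightarrow> real" and m :: nat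
  assumes norm: "norm_fun N" and requests: "\<forall>n\<in>{1..m}. convex_on UNIV (f n) \<and> (\<forall>x. f n x \<ge> 0)"

sublocale discrete_chasing \<subseteq> chasing N "truncated_requests m f" "real m"
  by (unfold_locales) (use norm requests convex_truncated_requests in auto)

context discrete_chasing
begin

lemma constant_step:
  assumes n: "n \<in> {1..m}"
  shows "constant_request N (truncated_requests m f) (real m) (real n - 1) (real n) (f n)"
  by (unfold_locales) (use n truncated_requests_eq[OF n] in auto)

abbreviation X :: "real \<Rightarrow> 'a" where "X \<equiv> steiner_path N (truncated_requests m f)"

lemma steiner_run_iff:
  "steiner_run N f m x \<longleftrightarrow> x 0 = 0 \<and> (\<forall>n\<in>{1..m}. \<exists>\<tau>\<in>{real n - 1..real n}.
     x n = X \<tau> \<and> (\<forall>t\<in>{real n - 1..<real n}. f n (X \<tau>) \<le> f n (X t)))"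
proof -
  have "(\<exists>\<tau>\<in>{real n - 1..real n}. x n = steiner_path N (step_requests f) \<tau> \<and>
        (\<forall>t\<in>{real n - 1..<real n}. f n (steiner_path N (step_requests f) \<tau>) \<le> f n (steiner_path N (step_requests f) t)))
      \<longleftrightarrow> (\<exists>\<tau>\<in>{real n - 1..real n}. x n = X \<tau> \<and> (\<forall>t\<in>{real n - 1..<real n}. f n (X \<tau>) \<le> f n (X t)))"
    if n: "n \<in> {1..m}" for n
  proof -
    have eq: "steiner_path N (step_requests f) t = X t" if "t \<le> real n" for t
      using that n by (intro steiner_path_truncated) auto
    show ?thesis by (rule bex_cong[OF refl]) (auto simp: eq)
  qed
  then show ?thesis unfolding steiner_run_def Let_def by blast
qed

lemma request_along_continuous:
  assumes n: "n \<in> {1..m}"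
  shows "continuous_on {real n - 1..real n} (\<lambda>t. f n (X t))"
proof (rule continuous_on_compose2[where g="f n" and f=X and t=UNIV])
  show "continuous_on {real n - 1..real n} X" by (rule constant_request.steiner_path_continuous[OF constant_step[OF n]])
  show "continuous_on UNIV (f n)" using requests n by (intro convex_on_continuous) auto
qed auto

text \<open>Continuity on the closed request interval yields a minimiser, possibly at the right end,
  which \<open>steiner_run\<close> admits.\<close>

lemma steiner_run_exists: "\<exists>x. steiner_run N f m x"
proof -
  have "\<exists>\<tau>\<in>{real n - 1..real n}. \<forall>t\<in>{real n - 1..real n}. f n (X \<tau>) \<le> f n (X t)" if "n \<in> {1..m}" for n
    by (rule continuous_attains_inf) (use request_along_continuous[OF that] in auto)
  then obtain \<tau> where t: "\<And>n. n \<in> {1..m} \<Longrightarrow> \<tau> n \<in> {real n - 1..real n}"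
    "\<And>n t. n \<in> {1..m} \<Longrightarrow> t \<in> {real n - 1..real n} \<Longrightarrow> f n (X (\<tau> n)) \<le> f n (X t)"
    by metis
  have "steiner_run N f m (\<lambda>n. if n = 0 then 0 else X (\<tau> n))"
    unfolding steiner_run_iff
  proof (intro conjI ballI)
    fix n assume n: "n \<in> {1..m}"
    show "\<exists>\<tau>'\<in>{real n - 1..real n}. (if n = 0 then 0 else X (\<tau> n)) = X \<tau>' \<and>
        (\<forall>t\<in>{real n - 1..<real n}. f n (X \<tau>') \<le> f n (X t))"
      using n t by (intro bexI[of _ "\<tau> n"]) auto
  qed simp
  then show ?thesis by blast
qed

text \<open>Consecutive request intervals meet only at end points, so the chosen times are ordered
  and the run is a polygon inscribed in the Steiner path, starting at time 0.\<close>

lemma steiner_run_movement: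
  assumes x: "steiner_run N f m x"
  shows "movement_cost N m x \<le> scaled_potential 1 (real m)"
proof -
  have "\<forall>n\<in>{1..m}. \<exists>\<tau>. \<tau> \<in> {real n - 1..real n} \<and> x n = X \<tau>" and x0: "x 0 = 0"
    using x unfolding steiner_run_iff by blast+
  then obtain \<sigma> where s: "\<And>n. n \<in> {1..m} \<Longrightarrow> \<sigma> n \<in> {real n - 1..real n} \<and> x n = X (\<sigma> n)" by metis
  define \<tau> where "\<tau> n = (if n = 0 then 0 else \<sigma> n)" for n
  have tau: "real n - 1 \<le> \<tau> n" "\<tau> n \<le> real n" "0 \<le> \<tau> n" "x n = X (\<tau> n)" if "n \<le> m" for n
    using s[of n] that x0 steiner_path_zero by (cases n; force simp: \<tau>_def)+
  have "mono_on {..m} \<tau>"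
  proof (rule mono_onI)
    fix i j assume ij: "i \<in> {..m}" "j \<in> {..m}" "i \<le> j"
    show "\<tau> i \<le> \<tau> j"
    proof (cases "i = j")
      case False
      then have "real i \<le> real j - 1" using ij by linarith
      then show ?thesis using tau(2)[of i] tau(1)[of j] ij by auto
    qed simp
  qed
  moreover have "\<tau> ` {..m} \<subseteq> {0..real m}" using tau by force
  ultimately have "(\<Sum>i<m. N (X (\<tau> (Suc i)) - X (\<tau> i))) \<le> scaled_potential 1 (real m)"
    by (rule steiner_path_polygon)
  moreover have "movement_cost N m x = (\<Sum>i<m. N (X (\<tau> (Suc i)) - X (\<tau> i)))"
  proof -
    have "movement_cost N m x = (\<Sum>i<m. N (x (Suc i) - x i))"
      unfolding movement_cost_def by (rule sum.reindex_bij_witness[of _ Suc "\<lambda>n. n - 1"]) auto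
    also have "\<dots> = (\<Sum>i<m. N (X (\<tau> (Suc i)) - X (\<tau> i)))"
      using tau(4) by (intro sum.cong refl) auto
    finally show ?thesis .
  qed
  ultimately show ?thesis by simp
qed

lemma steiner_run_service:
  assumes x: "steiner_run N f m x"
  shows "(\<Sum>n=1..m. f n (x n)) \<le> W (real m) y"
proof -
  let ?g = "\<lambda>t. truncated_requests m f t (X t)"
  have gi: "?g integrable_on {0..real m}" by (rule steiner_path_service(1))
  have "(\<Sum>n=1..k. f n (x n)) \<le> integral {0..real k} ?g" if "k \<le> m" for k
    using that
  proof (induction k)
    case (Suc k)
    have n: "Suc k \<in> {1..m}" using Suc.prems by simp
    obtain \<tau> where \<tau>: "x (Suc k) = X \<tau>" "\<And>t. t \<in> {real (Suc k) - 1..<real (Suc k)} \<Longrightarrow> f (Suc k) (X \<tau>) \<le> f (Suc k) (X t)"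
      using x n unfolding steiner_run_iff by blast
    have i: "?g integrable_on {0..real (Suc k)}" "?g integrable_on {real k..real (Suc k)}"
      by (rule integrable_on_subinterval[OF gi]; use Suc.prems in simp)+
    have "f (Suc k) (x (Suc k)) = integral {real k..real (Suc k)} (\<lambda>_. f (Suc k) (x (Suc k)))" by simp
    \<comment> \<open>At the right end the truncated request is no longer request
      \<open>Suc k\<close>; the integrand is altered at that one point so that the comparison holds
      everywhere.\<close>
    also have "\<dots> \<le> integral {real k..real (Suc k)} (\<lambda>t. if t = real (Suc k) then f (Suc k) (x (Suc k)) else ?g t)"
    proof (rule integral_le)
      show "(\<lambda>t. if t = real (Suc k) then f (Suc k) (x (Suc k)) else ?g t) integrable_on {real k..real (Suc k)}"
        by (rule integrable_spike[OF i(2), where S="{real (Suc k)}"]) auto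
      fix t assume t: "t \<in> {real k..real (Suc k)}"
      show "f (Suc k) (x (Suc k)) \<le> (if t = real (Suc k) then f (Suc k) (x (Suc k)) else ?g t)"
      proof (cases "t = real (Suc k)")
        case False
        then have t': "real (Suc k) - 1 \<le> t" "t < real (Suc k)" using t by auto
        have "f (Suc k) (X \<tau>) \<le> f (Suc k) (X t)" using t' by (intro \<tau>(2)) auto
        then show ?thesis using False unfolding truncated_requests_eq[OF n t', of f] \<tau>(1) by simp
      qed simp
    qed (rule integrable_const_ivl)
    also have "\<dots> = integral {real k..real (Suc k)} ?g"
      by (rule integral_spike[where S="{real (Suc k)}"]) auto
    finally have "(\<Sum>n=1..Suc k. f n (x n)) \<le> integral {0..real k} ?g + integral {real k..real (Suc k)} ?g"
      using Suc by simp
    also have "\<dots> = integral {0..real (Suc k)} ?g"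
      by (rule Henstock_Kurzweil_Integration.integral_combine) (use i in auto)
    finally show ?case .
  qed simp
  from this[of m] show ?thesis using steiner_path_service(2)[of y] by simp
qed

text \<open>Moving to the next point at the start of its request and waiting there for unit time
  costs, in the limit of fast moves, what the discrete sequence pays.\<close>

lemma work_function_le_function_cost:
  assumes y: "y 0 = 0"
  shows "W (real m) (y m) \<le> function_cost N f m y"
proof -
  have "W (real n) (y n) \<le> function_cost N f n y" if "n \<le> m" for n
    using that
  proof (induction n)
    case 0
    then show ?case using y norm_fun_zero[OF N] by (simp add: work_function_def function_cost_def)
  next
    case (Suc n)
    have n: "Suc n \<in> {1..m}" using Suc.prems by simp
    have "integral {real n..real (Suc n)} (\<lambda>r. truncated_requests m f r (y (Suc n)))
        = integral {real n..real (Suc n)} (\<lambda>r. f (Suc n) (y (Suc n)))"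
      by (rule integral_spike[where S="{real (Suc n)}"]) (auto simp: truncated_requests_eq[OF n])
    then have "W (real (Suc n)) (y (Suc n)) \<le> W (real n) (y n) + N (y (Suc n) - y n) + f (Suc n) (y (Suc n))"
      using work_function_step[of "real n" "real (Suc n)" "y (Suc n)" "y n"] Suc.prems by simp
    then show ?case using Suc by (simp add: function_cost_def)
  qed
  then show ?thesis by simp
qed

lemma steiner_run_competitive:
  assumes x: "steiner_run N f m x"
  shows "function_cost N f m x \<le> (real DIM('a) + 1) * function_opt N f m"
  unfolding function_opt_def
proof (rule le_mult_cINF)
  show "{y :: nat \<Rightarrow> 'a. y 0 = 0} \<noteq> {}" by auto
  fix y :: "nat \<Rightarrow> 'a" assume "y \<in> {y. y 0 = 0}"
  then have w: "W (real m) (y m) \<le> function_cost N f m y" by (intro work_function_le_function_cost) simp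
  have "function_cost N f m x = movement_cost N m x + (\<Sum>n=1..m. f n (x n))"
    by (simp add: function_cost_def movement_cost_def sum.distrib)
  also have "\<dots> \<le> real DIM('a) * W (real m) (y m) + W (real m) (y m)"
    using steiner_run_movement[OF x] scaled_potential_one_le[of "y m"] steiner_run_service[OF x, of "y m"] by simp
  also have "\<dots> = (real DIM('a) + 1) * W (real m) (y m)" by (simp add: distrib_right)
  also have "\<dots> \<le> (real DIM('a) + 1) * function_cost N f m y" using w by (intro mult_left_mono) auto
  finally show "function_cost N f m x \<le> (real DIM('a) + 1) * function_cost N f m y" .
qed (simp add: add_nonneg_pos)

end

section \<open>Convex bodies as requests\<close>

lemma body_request_convex:
  fixes N :: "'a::euclidean_space \<Rightarrow> real"
  assumes N: "norm_fun N" and K: "convex (K n)" "K n \<noteq> {}"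
  shows "convex_on UNIV (body_request N K n) \<and> (\<forall>x. body_request N K n x \<ge> 0)"
  unfolding body_request_eq
  using convex_on_cmul[of 3 UNIV "norm_infdist N (K n)"] norm_infdist_convex[OF N K(2,1)] norm_infdist_nonneg[OF N K(2)]
  by simp

context
  fixes N :: "'a::euclidean_space \<Rightarrow> real" and K :: "nat \<Rightarrow> 'a set" and m :: nat
  assumes N: "norm_fun N" and K: "\<forall>n\<in>{1..m}. closed (K n) \<and> convex (K n) \<and> K n \<noteq> {}"
begin

interpretation discrete_chasing N "body_request N K" m
  by unfold_locales (use N K body_request_convex[OF N] in auto)

lemma steiner_run_bodies_exists: "\<exists>x. steiner_run N (body_request N K) m x"
  by (rule steiner_run_exists)

text \<open>The path is in \<open>K n\<close> at time \<open>n\<close>, where the request vanishes.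
  Minimality over the half-open interval extends to its right end by continuity, so the chosen point
  has request value 0 and lies in the closed body.\<close>

lemma steiner_run_bodies_feasible:
  assumes x: "steiner_run N (body_request N K) m x" and n: "n \<in> {1..m}"
  shows "x n \<in> K n"
proof -
  have Kn: "closed (K n)" "convex (K n)" "K n \<noteq> {}" using K n by auto
  obtain \<tau> where \<tau>: "x n = X \<tau>" "\<And>t. t \<in> {real n - 1..<real n} \<Longrightarrow> body_request N K n (X \<tau>) \<le> body_request N K n (X t)"
    using x n unfolding steiner_run_iff by blast
  have cl: "closure {real n - 1..<real n} = {real n - 1..real n}" by (rule closure_atLeastLessThan) simp
  have "body_request N K n (X \<tau>) \<le> body_request N K n (X (real n))"
    by (rule continuous_ge_on_closure[of "{real n - 1..<real n}" "\<lambda>t. body_request N K n (X t)"])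
       (use request_along_continuous[OF n] \<tau>(2) in \<open>auto simp: cl\<close>)
  moreover have "X (real n) \<in> K n"
    by (rule constant_request.steiner_path_in_body[OF constant_step[OF n] Kn(1,3,2)]) (simp_all add: body_request_eq)
  then have "body_request N K n (X (real n)) = 0"
    by (simp add: body_request_eq norm_infdist_zero[OF N Kn(3)])
  ultimately have "norm_infdist N (K n) (x n) \<le> 0" by (simp add: body_request_eq \<tau>(1))
  then show ?thesis using norm_infdist_eq_0[OF N Kn(3,1)] norm_infdist_nonneg[OF N Kn(3), of "x n"] by simp
qed

text \<open>A feasible sequence pays no service, so its movement bounds the work function from
  above; the run is charged for movement only, which leaves the factor of the potential
  alone.\<close>

lemma steiner_run_bodies_competitive:
  assumes x: "steiner_run N (body_request N K) m x"
  shows "movement_cost N m x \<le> real DIM('a) * body_opt N K m"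
  unfolding body_opt_def
proof (rule le_mult_cINF)
    have "\<forall>n\<in>{1..m}. \<exists>y. y \<in> K n" using K by blast
    then obtain z where "\<And>n. n \<in> {1..m} \<Longrightarrow> z n \<in> K n" by metis
    then have "(\<lambda>n. if n = 0 then 0 else z n) \<in> {y. y 0 = 0 \<and> (\<forall>n\<in>{1..m}. y n \<in> K n)}" by simp
    then show "{y. y 0 = 0 \<and> (\<forall>n\<in>{1..m}. y n \<in> K n)} \<noteq> {}"
      unfolding ex_in_conv[symmetric] by (rule exI[of _ "\<lambda>n. if n = 0 then 0 else z n"])
    fix y assume "y \<in> {y. y 0 = 0 \<and> (\<forall>n\<in>{1..m}. y n \<in> K n)}"
    then have y: "y 0 = 0" "\<And>n. n \<in> {1..m} \<Longrightarrow> y n \<in> K n" by simp_all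
    have "function_cost N (body_request N K) m y = movement_cost N m y"
      unfolding function_cost_def movement_cost_def
    proof (rule sum.cong[OF refl])
      fix n assume n: "n \<in> {1..m}"
      then have "K n \<noteq> {}" using K by blast
      then have "norm_infdist N (K n) (y n) = 0" using y(2)[OF n] by (rule norm_infdist_zero[OF N])
      then show "N (y n - y (n - 1)) + body_request N K n (y n) = N (y n - y (n - 1))"
        by (simp only: body_request_eq mult_zero_right add_0_right)
    qed
    then have "W (real m) (y m) \<le> movement_cost N m y" using work_function_le_function_cost[of y, OF y(1)] by simp
    then have "real DIM('a) * W (real m) (y m) \<le> real DIM('a) * movement_cost N m y" by (intro mult_left_mono) auto
    then show "movement_cost N m x \<le> real DIM('a) * movement_cost N m y"
      using steiner_run_movement[OF x] scaled_potential_one_le[of "y m"] by linarith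
qed simp

end

theorem theorem5p6:
  fixes N :: "'a::euclidean_space \<Rightarrow> real"
  assumes "norm_fun N"
  shows
    "(\<forall>(f :: real \<Rightarrow> 'a \<Rightarrow> real) T. 0 < T \<and> convex_requests T f \<longrightarrow>
        steiner_path N f 0 = 0 \<and>
        (\<lambda>t. f t (steiner_path N f t)) integrable_on {0..T} \<and>
        ereal (integral {0..T} (\<lambda>t. f t (steiner_path N f t)))
            + variation N {0..T} (steiner_path N f)
          \<le> ereal ((real DIM('a) + 1) * offline_opt N f T)) \<and>
     (\<forall>(f :: nat \<Rightarrow> 'a \<Rightarrow> real) m.
        (\<forall>n\<in>{1..m}. convex_on UNIV (f n) \<and> (\<forall>x. f n x \<ge> 0)) \<longrightarrow>
        (\<exists>x. steiner_run N f m x) \<and>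
        (\<forall>x. steiner_run N f m x \<longrightarrow>
           function_cost N f m x \<le> (real DIM('a) + 1) * function_opt N f m)) \<and>
     (\<forall>(K :: nat \<Rightarrow> 'a set) m.
        (\<forall>n\<in>{1..m}. closed (K n) \<and> convex (K n) \<and> K n \<noteq> {}) \<longrightarrow>
        (\<exists>x. steiner_run N (body_request N K) m x) \<and>
        (\<forall>x. steiner_run N (body_request N K) m x \<longrightarrow>
           (\<forall>n\<in>{1..m}. x n \<in> K n) \<and>
           movement_cost N m x \<le> real DIM('a) * body_opt N K m))"
proof (intro conjI allI impI ballI; (elim conjE)?)
  fix f :: "real \<Rightarrow> 'a \<Rightarrow> real" and T :: real
  assume T: "0 < T" and f: "convex_requests T f"
  interpret chasing N f T by unfold_locales (use assms T f in auto)
  show "steiner_path N f 0 = 0" by (rule steiner_path_zero)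
  show "(\<lambda>t. f t (steiner_path N f t)) integrable_on {0..T}" by (rule steiner_path_service(1))
  show "ereal (integral {0..T} (\<lambda>t. f t (steiner_path N f t))) + variation N {0..T} (steiner_path N f)
    \<le> ereal ((real DIM('a) + 1) * offline_opt N f T)"
    by (rule continuous_competitive[OF T])
next
  fix f :: "nat \<Rightarrow> 'a \<Rightarrow> real" and m :: nat
  assume f: "\<forall>n\<in>{1..m}. convex_on UNIV (f n) \<and> (\<forall>x. f n x \<ge> 0)"
  interpret discrete_chasing N f m by unfold_locales (use assms f in auto)
  show "\<exists>x. steiner_run N f m x" by (rule steiner_run_exists)
  show "function_cost N f m x \<le> (real DIM('a) + 1) * function_opt N f m" if "steiner_run N f m x" for x
    using that by (rule steiner_run_competitive)
next
  fix K :: "nat \<Rightarrow> 'a set" and m :: nat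
  assume K: "\<forall>n\<in>{1..m}. closed (K n) \<and> convex (K n) \<and> K n \<noteq> {}"
  show "\<exists>x. steiner_run N (body_request N K) m x" by (rule steiner_run_bodies_exists[OF assms K])
  show "x n \<in> K n" if "steiner_run N (body_request N K) m x" "n \<in> {1..m}" for x n
    using steiner_run_bodies_feasible[OF assms K] that by blast
  show "movement_cost N m x \<le> real DIM('a) * body_opt N K m" if "steiner_run N (body_request N K) m x" for x
    using steiner_run_bodies_competitive[OF assms K that] .
qed

end
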